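(* Let $f, g\colon (\mathbb{R}^n,0)\to (\mathbb{R},0)$ be germs of $C^{\infty}$ functions. Suppose that $\mathrm{in}(f)$ and $\mathrm{in}(g)$ have algebraically isolated singularities at the origin. If $f$ and $g$ are $\mathcal{R}$-asymptotically Lipschitz equivalent at the origin, then $\mu(f)=\mu(g)$.
   Context: Milnor number: let $\mathcal{E}_n$ be the $\mathbb{R}$-algebra of germs at $0$ of $C^\infty$ functions $(\mathbb{R}^n,0)\to\mathbb{R}$. For $f\in\mathcal{E}_n$, $J(f)$ is the ideal of $\mathcal{E}_n$ generated by $\frac{\partial f}{\partial x_1},\dots,\frac{\partial f}{\partial x_n}$, and $\mu(f)=\dim_{\mathbb{R}}\mathcal{E}_n/J(f)\in\mathbb{N}\cup\{+\infty\}$. One says that $f$ has an algebraically isolated singularity at the origin if $\mu(f)<+\infty$. Initial part: for a $C^\infty$ germ $f$ with $f(0)=0$ and nonzero Taylor series at $0$, $\mathrm{in}(f)=\mathrm{in}_0(f)$ is the lowest-degree nonzero homogeneous component of the Taylor series of $f$ at $0$. The hypothesis on $\mathrm{in}(f)$ and $\mathrm{in}(g)$ includes that these initial parts exist. Lipeomorphism: a bijective map $\phi$ between subsets of Euclidean spaces for which there is $c>0$ with $\frac1c\|x-y\|\le\|\phi(x)-\phi(y)\|\le c\|x-y\|$ for all $x,y$ in its domain. A germ of lipeomorphism $(\mathbb{R}^n,0)\to(\mathbb{R}^n,0)$ is represented by a lipeomorphism between open neighbourhoods of $0$ fixing $0$. $f$ and $g$ are $\mathcal{R}$-asymptotically Lipschitz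 equivalent at the origin if there exist a germ of lipeomorphism $\phi\colon(\mathbb{R}^n,0)\to(\mathbb{R}^n,0)$, a neighbourhood $W$ of $0$ and constants $c_1,c_2>0$ such that $c_2|f(x)|\le|g(\phi(x))|\le c_1|f(x)|$ for all $x\in W$. *)

theory Defs
  imports
    "HOL-Analysis.Analysis"
    "HOL-Library.Extended_Nat"
    "HOL-Algebra.Embedded_Algebras"
    "HOL-Algebra.QuotRing"
begin

section \<open>Smooth germs\<close>

text \<open>A germ at the origin is given by a representative, a total function whose values away from
  a neighbourhood of the origin are irrelevant.\<close>

definition partial_deriv :: "'n::finite \<Rightarrow> (real^'n \<Rightarrow> real) \<Rightarrow> real^'n \<Rightarrow> real" where
  "partial_deriv i f x = frechet_derivative f (at x) (axis i 1)"

text \<open>\<open>Ck_on k f U\<close> is meant for open \<open>U\<close>, where it says that \<open>f\<close> is of class \<open>C\<^sup>k\<close> on \<open>U\<close>.\<close>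

primrec Ck_on :: "nat \<Rightarrow> (real^'n::finite \<Rightarrow> real) \<Rightarrow> (real^'n) set \<Rightarrow> bool" where
  "Ck_on 0 f U \<longleftrightarrow> continuous_on U f"
| "Ck_on (Suc k) f U \<longleftrightarrow>
     (\<forall>x\<in>U. f differentiable (at x)) \<and> (\<forall>i. Ck_on k (partial_deriv i f) U)"

definition smooth_germ :: "(real^'n::finite \<Rightarrow> real) \<Rightarrow> bool" where
  "smooth_germ f \<longleftrightarrow> (\<exists>U. open U \<and> 0 \<in> U \<and> (\<forall>k. Ck_on k f U))"


section \<open>The algebra of germs and the Milnor number\<close>

definition local_smooth_ring :: "(real^'n::finite \<Rightarrow> real) ring" where
  "local_smooth_ring =
     \<lparr>carrier = {f. smooth_germ f},
      mult = (\<lambda>f g x. f x * g x), one = (\<lambda>x. 1),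
      zero = (\<lambda>x. 0), add = (\<lambda>f g x. f x + g x)\<rparr>"

definition null_germs :: "(real^'n::finite \<Rightarrow> real) set" where
  "null_germs = {f. smooth_germ f \<and> (\<forall>\<^sub>F x in nhds 0. f x = 0)}"

text \<open>Two smooth representatives define the same germ iff their difference vanishes near the
  origin, so the ring of germs is the quotient by \<^const>\<open>null_germs\<close>.\<close>

definition germ_ring :: "(real^'n::finite \<Rightarrow> real) set ring" where
  "germ_ring = local_smooth_ring Quot null_germs"

definition germ :: "(real^'n::finite \<Rightarrow> real) \<Rightarrow> (real^'n \<Rightarrow> real) set" where
  "germ f = null_germs +>\<^bsub>local_smooth_ring\<^esub> f"

definition jacobian_ideal :: "(real^'n::finite \<Rightarrow> real) \<Rightarrow> (real^'n \<Rightarrow> real) set set" where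
  "jacobian_ideal f = Idl\<^bsub>germ_ring\<^esub> (range (\<lambda>i. germ (partial_deriv i f)))"

definition milnor_algebra :: "(real^'n::finite \<Rightarrow> real) \<Rightarrow> (real^'n \<Rightarrow> real) set set ring" where
  "milnor_algebra f = germ_ring Quot jacobian_ideal f"

text \<open>The copy of the real numbers inside the Milnor algebra, given by the constant germs.
  If the Jacobian ideal is the whole ring, the Milnor algebra is the zero ring, this
  set is \<open>{0}\<close>, and the dimension below is \<open>0\<close>.\<close>

definition milnor_scalars :: "(real^'n::finite \<Rightarrow> real) \<Rightarrow> (real^'n \<Rightarrow> real) set set set" where
  "milnor_scalars f = range (\<lambda>c. jacobian_ideal f +>\<^bsub>germ_ring\<^esub> germ (\<lambda>x. c))"

definition milnor_number :: "(real^'n::finite \<Rightarrow> real) \<Rightarrow> enat" where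
  "milnor_number f =
     (if ring.finite_dimension (milnor_algebra f) (milnor_scalars f) (carrier (milnor_algebra f))
      then enat (ring.dim (milnor_algebra f) (milnor_scalars f) (carrier (milnor_algebra f)))
      else \<infinity>)"

definition algebraically_isolated :: "(real^'n::finite \<Rightarrow> real) \<Rightarrow> bool" where
  "algebraically_isolated f \<longleftrightarrow> milnor_number f < \<infinity>"


section \<open>Initial part\<close>

text \<open>The component of degree \<open>k\<close> of the Taylor series at the origin is
  \<open>(1/k!) \<Sum> \<partial>\<^sup>kf/\<partial>x\<^sub>i\<^sub>1\<dots>\<partial>x\<^sub>i\<^sub>k (0) x\<^sub>i\<^sub>1 \<cdots> x\<^sub>i\<^sub>k\<close>, the sum being over
  all \<open>k\<close>-tuples of indices.\<close>

definition taylor_component :: "nat \<Rightarrow> (real^'n::finite \<Rightarrow> real) \<Rightarrow> real^'n \<Rightarrow> real" where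
  "taylor_component k f x =
     (\<Sum>is\<in>{is :: 'n list. length is = k}.
        foldr partial_deriv is f 0 * (\<Prod>i\<leftarrow>is. x $ i)) / fact k"

definition has_initial_part :: "(real^'n::finite \<Rightarrow> real) \<Rightarrow> bool" where
  "has_initial_part f \<longleftrightarrow> (\<exists>k. taylor_component k f \<noteq> (\<lambda>x. 0))"

definition initial_part :: "(real^'n::finite \<Rightarrow> real) \<Rightarrow> real^'n \<Rightarrow> real" where
  "initial_part f = taylor_component (LEAST k. taylor_component k f \<noteq> (\<lambda>x. 0)) f"


section \<open>Asymptotic Lipschitz equivalence\<close>

definition lipeomorphism ::
  "'a::real_normed_vector set \<Rightarrow> 'b::real_normed_vector set \<Rightarrow> ('a \<Rightarrow> 'b) \<Rightarrow> bool" where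
  "lipeomorphism A B \<phi> \<longleftrightarrow> bij_betw \<phi> A B \<and>
     (\<exists>c>0. \<forall>x\<in>A. \<forall>y\<in>A. 1 / c * norm (x - y) \<le> norm (\<phi> x - \<phi> y) \<and>
                            norm (\<phi> x - \<phi> y) \<le> c * norm (x - y))"

text \<open>The germ of \<open>\<phi>\<close> is represented on \<open>U\<close>; outside \<open>U\<close> the function \<open>\<phi>\<close> carries no meaning,
  so the neighbourhood \<open>W\<close> is taken inside \<open>U\<close>.\<close>

definition R_asymp_lipschitz_equiv ::
  "(real^'n::finite \<Rightarrow> real) \<Rightarrow> (real^'n \<Rightarrow> real) \<Rightarrow> bool" where
  "R_asymp_lipschitz_equiv f g \<longleftrightarrow>
     (\<exists>\<phi> U V. open U \<and> 0 \<in> U \<and> open V \<and> 0 \<in> V \<and> lipeomorphism U V \<phi> \<and> \<phi> 0 = 0 \<and>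
        (\<exists>W c\<^sub>1 c\<^sub>2. 0 \<in> interior W \<and> W \<subseteq> U \<and> c\<^sub>1 > 0 \<and> c\<^sub>2 > 0 \<and>
           (\<forall>x\<in>W. c\<^sub>2 * \<bar>f x\<bar> \<le> \<bar>g (\<phi> x)\<bar> \<and> \<bar>g (\<phi> x)\<bar> \<le> c\<^sub>1 * \<bar>f x\<bar>)))"


section \<open>The germs form a commutative ring\<close>

lemma partial_deriv_add:
  assumes "f differentiable (at x)" "g differentiable (at x)"
  shows "partial_deriv i (\<lambda>x. f x + g x) x = partial_deriv i f x + partial_deriv i g x"
proof -
  from assms have "((\<lambda>x. f x + g x) has_derivative
      (\<lambda>h. frechet_derivative f (at x) h + frechet_derivative g (at x) h)) (at x)"
    unfolding frechet_derivative_works by (rule has_derivative_add)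
  from frechet_derivative_at[OF this, symmetric] show ?thesis by (simp add: partial_deriv_def)
qed

lemma partial_deriv_mult:
  assumes "f differentiable (at x)" "g differentiable (at x)"
  shows "partial_deriv i (\<lambda>x. f x * g x) x = f x * partial_deriv i g x + partial_deriv i f x * g x"
proof -
  from assms have "((\<lambda>x. f x * g x) has_derivative
      (\<lambda>h. f x * frechet_derivative g (at x) h + frechet_derivative f (at x) h * g x)) (at x)"
    unfolding frechet_derivative_works by (rule has_derivative_mult)
  from frechet_derivative_at[OF this, symmetric] show ?thesis by (simp add: partial_deriv_def)
qed

lemma Ck_on_cong:
  assumes "open U" "\<And>x. x \<in> U \<Longrightarrow> f x = g x" "Ck_on k f U"
  shows "Ck_on k g U"
  using assms(2,3)
proof (induction k arbitrary: f g)
  case 0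
  then show ?case by (simp cong: continuous_on_cong)
next
  case (Suc k)
  have d: "(g has_derivative frechet_derivative f (at x)) (at x)" if "x \<in> U" for x
  proof (rule has_derivative_transform_within_open[OF _ \<open>open U\<close> that])
    show "(f has_derivative frechet_derivative f (at x)) (at x)"
      using Suc.prems(2) that frechet_derivative_works by auto
  qed (use Suc.prems(1) in auto)
  have "partial_deriv i f x = partial_deriv i g x" if "x \<in> U" for x i
    using frechet_derivative_at[OF d[OF that]] by (simp add: partial_deriv_def)
  then have "Ck_on k (partial_deriv i g) U" for i
    using Suc.IH[of "partial_deriv i f" "partial_deriv i g"] Suc.prems(2) by simp
  then show ?case using d by (auto simp: differentiable_def)
qed

lemma Ck_on_Suc: "open U \<Longrightarrow> Ck_on (Suc k) f U \<Longrightarrow> Ck_on k f U"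
proof (induction k arbitrary: f)
  case 0
  then show ?case
    by (auto intro!: continuous_at_imp_continuous_on differentiable_imp_continuous_within)
next
  case (Suc k)
  have "Ck_on k (partial_deriv i f) U" for i
    by (rule Suc.IH) (use Suc.prems in auto)
  with Suc.prems(2) show ?case by auto
qed

lemma Ck_on_const: "open U \<Longrightarrow> Ck_on k (\<lambda>x. c) U"
proof (induction k arbitrary: c)
  case (Suc k)
  have "partial_deriv i (\<lambda>x. c) = (\<lambda>x. 0)" for i :: 'a
    by (auto simp: partial_deriv_def fun_eq_iff)
  then show ?case using Suc by simp
qed simp

lemma Ck_on_add:
  "open U \<Longrightarrow> Ck_on k f U \<Longrightarrow> Ck_on k g U \<Longrightarrow> Ck_on k (\<lambda>x. f x + g x) U"
proof (induction k arbitrary: f g)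
  case 0
  then show ?case by (auto intro: continuous_on_add)
next
  case (Suc k)
  have "Ck_on k (partial_deriv i (\<lambda>x. f x + g x)) U" for i
    by (rule Ck_on_cong[OF \<open>open U\<close> _ Suc.IH[of "partial_deriv i f" "partial_deriv i g"]])
       (use Suc.prems in \<open>auto simp: partial_deriv_add\<close>)
  with Suc.prems show ?case by auto
qed

lemma Ck_on_mult:
  "open U \<Longrightarrow> Ck_on k f U \<Longrightarrow> Ck_on k g U \<Longrightarrow> Ck_on k (\<lambda>x. f x * g x) U"
proof (induction k arbitrary: f g)
  case 0
  then show ?case by (auto intro: continuous_on_mult)
next
  case (Suc k)
  have "Ck_on k (partial_deriv i (\<lambda>x. f x * g x)) U" for i
  proof (rule Ck_on_cong[OF \<open>open U\<close>])
    show "Ck_on k (\<lambda>x. f x * partial_deriv i g x + partial_deriv i f x * g x) U"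
      using Suc.prems Ck_on_Suc[OF \<open>open U\<close>, of k]
      by (intro Ck_on_add Suc.IH) auto
  qed (use Suc.prems in \<open>auto simp: partial_deriv_mult\<close>)
  with Suc.prems show ?case by auto
qed

lemma Ck_on_subset: "U \<subseteq> V \<Longrightarrow> Ck_on k f V \<Longrightarrow> Ck_on k f U"
  by (induction k arbitrary: f) (simp_all add: subset_eq continuous_on_subset)

lemma smooth_germ_const: "smooth_germ (\<lambda>x. c)"
  unfolding smooth_germ_def using Ck_on_const open_UNIV by blast

lemma smooth_germ_add: "smooth_germ (\<lambda>x. f x + g x)"
  and smooth_germ_mult: "smooth_germ (\<lambda>x. f x * g x)"
  if "smooth_germ f" "smooth_germ g"
proof -
  from that obtain U V where UV: "open U" "0 \<in> U" "\<And>k. Ck_on k f U" "open V" "0 \<in> V" "\<And>k. Ck_on k g V"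
    unfolding smooth_germ_def by blast
  then have "Ck_on k f (U \<inter> V)" "Ck_on k g (U \<inter> V)" for k
    by (auto intro: Ck_on_subset[of _ U] Ck_on_subset[of _ V])
  with UV show "smooth_germ (\<lambda>x. f x + g x)" "smooth_germ (\<lambda>x. f x * g x)"
    unfolding smooth_germ_def
    by (intro exI[of _ "U \<inter> V"] conjI allI open_Int Ck_on_add Ck_on_mult; simp)+
qed

lemma cring_local_smooth_ring: "cring (local_smooth_ring :: (real^'n::finite \<Rightarrow> real) ring)"
proof (rule cringI)
  show "abelian_group (local_smooth_ring :: (real^'n \<Rightarrow> real) ring)"
  proof (rule abelian_groupI)
    fix f :: "real^'n \<Rightarrow> real"
    assume "f \<in> carrier local_smooth_ring"
    then show "\<exists>g\<in>carrier local_smooth_ring. g \<oplus>\<^bsub>local_smooth_ring\<^esub> f = \<zero>\<^bsub>local_smooth_ring\<^esub>"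
      using smooth_germ_mult[OF smooth_germ_const[of "-1"], of f]
      by (intro bexI[of _ "\<lambda>x. -1 * f x"]) (auto simp: local_smooth_ring_def)
  qed (auto simp: local_smooth_ring_def smooth_germ_add smooth_germ_const)
  show "comm_monoid (local_smooth_ring :: (real^'n \<Rightarrow> real) ring)"
    by (rule comm_monoidI) (auto simp: local_smooth_ring_def smooth_germ_mult smooth_germ_const)
qed (auto simp: local_smooth_ring_def algebra_simps)

lemma ideal_null_germs: "ideal null_germs (local_smooth_ring :: (real^'n::finite \<Rightarrow> real) ring)"
proof -
  interpret cring "local_smooth_ring :: (real^'n \<Rightarrow> real) ring" by (rule cring_local_smooth_ring)
  have inv: "inv\<^bsub>add_monoid local_smooth_ring\<^esub> f = (\<lambda>x. - f x)" if "smooth_germ f" for f :: "real^'n \<Rightarrow> real"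
    unfolding a_inv_def[symmetric]
    by (rule minus_equality)
       (use that smooth_germ_mult[OF smooth_germ_const[of "-1"], of f] in \<open>auto simp: local_smooth_ring_def\<close>)
  show ?thesis
  proof (rule idealI)
    show "subgroup null_germs (add_monoid (local_smooth_ring :: (real^'n \<Rightarrow> real) ring))"
    proof
      fix f :: "real^'n \<Rightarrow> real" assume "f \<in> null_germs"
      then show "inv\<^bsub>add_monoid local_smooth_ring\<^esub> f \<in> null_germs"
        using smooth_germ_mult[OF smooth_germ_const[of "-1"], of f]
        by (subst inv) (auto simp: null_germs_def)
    next
      fix f g :: "real^'n \<Rightarrow> real" assume "f \<in> null_germs" "g \<in> null_germs"
      then show "f \<otimes>\<^bsub>add_monoid local_smooth_ring\<^esub> g \<in> null_germs"
        by (auto simp: null_germs_def local_smooth_ring_def smooth_germ_add elim: eventually_elim2)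
    qed (auto simp: null_germs_def local_smooth_ring_def smooth_germ_const)
  next
    fix f g :: "real^'n \<Rightarrow> real" assume "f \<in> null_germs" "g \<in> carrier local_smooth_ring"
    then have "smooth_germ f" "smooth_germ g" "\<forall>\<^sub>F x in nhds 0. f x = 0"
      by (auto simp: null_germs_def local_smooth_ring_def)
    moreover from this(3) have "\<forall>\<^sub>F x in nhds 0. f x = 0 \<or> g x = 0"
      by eventually_elim simp
    ultimately show "g \<otimes>\<^bsub>local_smooth_ring\<^esub> f \<in> null_germs" "f \<otimes>\<^bsub>local_smooth_ring\<^esub> g \<in> null_germs"
      by (simp_all add: null_germs_def local_smooth_ring_def smooth_germ_mult disj_commute)
  qed (rule ring_axioms)
qed

lemma cring_germ_ring: "cring (germ_ring :: (real^'n::finite \<Rightarrow> real) set ring)"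
  unfolding germ_ring_def
  by (rule ideal.quotient_is_cring[OF ideal_null_germs cring_local_smooth_ring])

lemma germ_eq_iff:
  fixes f g :: "real^'n::finite \<Rightarrow> real"
  assumes "smooth_germ f" "smooth_germ g"
  shows "germ f = germ g \<longleftrightarrow> (\<forall>\<^sub>F x in nhds 0. f x = g x)"
proof -
  interpret cring "local_smooth_ring :: (real^'n \<Rightarrow> real) ring" by (rule cring_local_smooth_ring)
  have neg: "smooth_germ (\<lambda>x. - g x)"
    using smooth_germ_mult[OF smooth_germ_const[of "-1"] assms(2)] by simp
  have inv: "\<ominus>\<^bsub>local_smooth_ring\<^esub> g = (\<lambda>x. - g x)"
    by (rule minus_equality) (use assms neg in \<open>auto simp: local_smooth_ring_def\<close>)
  have "f \<ominus>\<^bsub>local_smooth_ring\<^esub> g = (\<lambda>x. f x - g x)"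
    by (simp add: a_minus_def inv) (simp add: local_smooth_ring_def)
  moreover have "germ f = germ g \<longleftrightarrow> f \<ominus>\<^bsub>local_smooth_ring\<^esub> g \<in> null_germs"
    unfolding germ_def using assms
    by (intro quotient_eq_iff_same_a_r_cos[OF ideal_null_germs, symmetric]) (auto simp: local_smooth_ring_def)
  ultimately show ?thesis using smooth_germ_add[OF assms(1) neg] by (auto simp: null_germs_def)
qed

end

theory Submission
  imports Defs "HOL-Library.Poly_Mapping" "HOL-Library.Function_Algebras"
begin

text \<open>Asymptotic Lipschitz equivalence preserves the order of vanishing, so it suffices that the Milnor
  number depends only on \<open>n\<close> and the order \<open>e + 1\<close> when the initial part is algebraically isolated.
  In that case every variable has a power in the ideal generated by the \<open>n\<close> partial derivatives of the
  initial part, which are homogeneous of degree \<open>e\<close>. Powers of the variables form a regular sequence, and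
  this makes the Koszul complex of these derivatives acyclic. Comparing lowest homogeneous parts, the Koszul
  complex of the partial derivatives of the germ itself, truncated so that the terms in homological degree \<open>i\<close>
  have polynomial degree below \<open>s - i e\<close>, is exact outside homological degree \<open>0\<close>. The dimension of its last
  cokernel is therefore determined by \<open>n\<close>, \<open>e\<close> and \<open>s\<close>. By Nakayama's lemma the Jacobian ideal contains the
  \<open>s\<close>-th power of the maximal ideal for large \<open>s\<close>, and then this cokernel is the Milnor algebra.\<close>

section \<open>Polynomials in several variables\<close>

text \<open>The common value, classically \<open>e ^ n\<close>, is never computed: the chain spaces
  of the truncated complex are the same for both germs, so exactness alone forces equal ranks.
  Nonzero flat germs lie in every power of the maximal ideal, so formal power series cannot replace
  germs from the start. Hadamard's lemma makes a germ a polynomial modulo each such power, and once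
  a power lies in the Jacobian ideal, the Milnor algebra concerns polynomials of bounded degree
  only. The degree bound \<open>s - i * e\<close> is adapted to the differential, which raises
  orders by at least \<open>e\<close>: what is cut off in one homological degree is mapped into what
  is cut off in the next. Powers of the variables arise because finite dimension makes 1, x_i,
  x_i^2, ... linearly dependent modulo the ideal, and homogeneity of the generators isolates one
  power from the relation. Acyclicity is then derived from these powers by a homotopy rather than
  from regularity of the derivatives. The case \<open>e = 0\<close> is separate: the Milnor algebra
  is zero, and the constants in it do not form a field.\<close>

abbreviation lookup where "lookup \<equiv> Poly_Mapping.lookup"
abbreviation keys where "keys \<equiv> Poly_Mapping.keys"

type_synonym 'n mpoly = "('n \<Rightarrow>\<^sub>0 nat) \<Rightarrow>\<^sub>0 real"

lemma sum_single_keys: "(\<Sum>\<alpha>\<in>keys p. Poly_Mapping.single \<alpha> (lookup p \<alpha>)) = p"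
  by (rule poly_mapping_eqI) (auto simp: lookup_sum lookup_single when_def in_keys_iff)

lemma poly_mapping_additive_induct [case_names zero single add]:
  assumes "P 0" "\<And>\<alpha> c. P (Poly_Mapping.single \<alpha> c)" "\<And>p q. P p \<Longrightarrow> P q \<Longrightarrow> P (p + q)"
  shows "P (p :: 'a \<Rightarrow>\<^sub>0 'b::comm_monoid_add)"
proof -
  have "P (\<Sum>\<alpha>\<in>A. Poly_Mapping.single \<alpha> (lookup p \<alpha>))" if "finite A" for A
    using that by (induction A rule: finite_induct) (auto intro: assms)
  from this[of "keys p"] show ?thesis by (simp add: sum_single_keys)
qed

section \<open>Degree, truncation and homogeneous components\<close>

definition total_degree :: "('n::finite \<Rightarrow>\<^sub>0 nat) \<Rightarrow> nat" where
  "total_degree \<alpha> = (\<Sum>i\<in>UNIV. lookup \<alpha> i)"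

lemma total_degree_add: "total_degree (\<alpha> + \<beta>) = total_degree \<alpha> + total_degree \<beta>"
  by (simp add: total_degree_def lookup_add sum.distrib)

lemma total_degree_zero [simp]: "total_degree 0 = 0"
  by (simp add: total_degree_def)

lemma total_degree_single [simp]: "total_degree (Poly_Mapping.single i k) = k"
  by (simp add: total_degree_def lookup_single when_def)

text \<open>Selecting terms by a predicate on exponents covers truncation, homogeneous components
  and the splitting of monomial ideals, so additivity is proved once for all three.\<close>

definition restrict_keys :: "('a \<Rightarrow> bool) \<Rightarrow> ('a \<Rightarrow>\<^sub>0 'b::zero) \<Rightarrow> ('a \<Rightarrow>\<^sub>0 'b)" where
  "restrict_keys R p = Poly_Mapping.mapp (\<lambda>\<alpha> c. if R \<alpha> then c else 0) p"

lemma lookup_restrict_keys: "lookup (restrict_keys R p) \<alpha> = (if R \<alpha> then lookup p \<alpha> else 0)"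
  by (auto simp: restrict_keys_def lookup_mapp when_def in_keys_iff)

lemma keys_restrict_keys: "keys (restrict_keys R p) = {\<alpha>\<in>keys p. R \<alpha>}"
  by (auto simp: in_keys_iff lookup_restrict_keys split: if_splits)

lemma restrict_keys_add: "restrict_keys R (p + q) = restrict_keys R p + restrict_keys R (q :: _ \<Rightarrow>\<^sub>0 _::monoid_add)"
  by (rule poly_mapping_eqI) (auto simp: lookup_restrict_keys lookup_add)

lemma restrict_keys_zero [simp]: "restrict_keys R 0 = 0"
  by (rule poly_mapping_eqI) (auto simp: lookup_restrict_keys)

lemma restrict_keys_sum: "restrict_keys R (sum f A) = (\<Sum>x\<in>A. restrict_keys R (f x :: _ \<Rightarrow>\<^sub>0 _::comm_monoid_add))"
  by (rule poly_mapping_eqI) (auto simp: lookup_restrict_keys lookup_sum)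

lemma restrict_keys_uminus: "restrict_keys R (- p) = - restrict_keys R (p :: _ \<Rightarrow>\<^sub>0 _::ab_group_add)"
  by (rule poly_mapping_eqI) (auto simp: lookup_restrict_keys)

lemma restrict_keys_diff: "restrict_keys R (p - q) = restrict_keys R p - restrict_keys R (q :: _ \<Rightarrow>\<^sub>0 _::ab_group_add)"
  by (rule poly_mapping_eqI) (auto simp: lookup_restrict_keys lookup_minus)

lemma restrict_keys_id: "(\<And>\<alpha>. \<alpha> \<in> keys p \<Longrightarrow> R \<alpha>) \<Longrightarrow> restrict_keys R p = p"
  by (rule poly_mapping_eqI) (auto simp: lookup_restrict_keys in_keys_iff)

lemma restrict_keys_none: "(\<And>\<alpha>. \<alpha> \<in> keys p \<Longrightarrow> \<not> R \<alpha>) \<Longrightarrow> restrict_keys R p = 0"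
  by (rule poly_mapping_eqI) (auto simp: lookup_restrict_keys in_keys_iff)

lemma restrict_keys_compl: "p = restrict_keys R p + restrict_keys (\<lambda>\<alpha>. \<not> R \<alpha>) (p :: _ \<Rightarrow>\<^sub>0 _::monoid_add)"
  by (rule poly_mapping_eqI) (auto simp: lookup_restrict_keys lookup_add)

lemma keys_mult_ex:
  assumes "\<gamma> \<in> keys (p * q)"
  obtains \<alpha> \<beta> where "\<alpha> \<in> keys p" "\<beta> \<in> keys q" "\<gamma> = \<alpha> + \<beta>"
  using keys_mult[of p q] assms by blast

definition homog :: "nat \<Rightarrow> 'n::finite mpoly \<Rightarrow> bool" where
  "homog e p \<longleftrightarrow> (\<forall>\<alpha>\<in>keys p. total_degree \<alpha> = e)"

text \<open>Multiplication by \<open>P\<close> raises every degree by exactly \<open>e\<close>, so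
  selecting degrees commutes with it after a shift. The shift is an addition on the side of
  \<open>p\<close>, not a subtraction, so that nothing is selected there when the wanted degree is
  below \<open>e\<close>.\<close>

lemma restrict_keys_mult_homog:
  assumes "homog e P"
  shows "restrict_keys (\<lambda>\<alpha>. Q (total_degree \<alpha>)) (P * p) = P * restrict_keys (\<lambda>\<alpha>. Q (total_degree \<alpha> + e)) p"
proof -
  let ?R = "\<lambda>\<alpha>. Q (total_degree \<alpha> + e)"
  have "P * p = P * restrict_keys ?R p + P * restrict_keys (\<lambda>\<alpha>. \<not> ?R \<alpha>) p"
    by (subst restrict_keys_compl[of p ?R]) (simp add: distrib_left)
  moreover have "restrict_keys (\<lambda>\<alpha>. Q (total_degree \<alpha>)) (P * restrict_keys ?R p) = P * restrict_keys ?R p"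
    by (rule restrict_keys_id)
       (use assms in \<open>auto elim!: keys_mult_ex simp: keys_restrict_keys homog_def total_degree_add add.commute\<close>)
  moreover have "restrict_keys (\<lambda>\<alpha>. Q (total_degree \<alpha>)) (P * restrict_keys (\<lambda>\<alpha>. \<not> ?R \<alpha>) p) = 0"
    by (rule restrict_keys_none)
       (use assms in \<open>auto elim!: keys_mult_ex simp: keys_restrict_keys homog_def total_degree_add add.commute\<close>)
  ultimately show ?thesis by (simp add: restrict_keys_add)
qed

text \<open>The \<open>s\<close>-th power of the ideal generated by the variables, recognised on
  exponents. It is the polynomial counterpart of \<open>vorder s\<close>.\<close>

definition ord_ge :: "nat \<Rightarrow> 'n::finite mpoly set" where
  "ord_ge s = {p. \<forall>\<alpha>\<in>keys p. s \<le> total_degree \<alpha>}"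

lemma ord_ge_lookup: "p \<in> ord_ge s \<longleftrightarrow> (\<forall>\<alpha>. total_degree \<alpha> < s \<longrightarrow> lookup p \<alpha> = 0)"
  by (auto simp: ord_ge_def in_keys_iff not_le[symmetric])

lemma ord_ge_zero [simp]: "0 \<in> ord_ge s"
  by (simp add: ord_ge_def)

lemma ord_ge_0 [simp]: "p \<in> ord_ge 0"
  by (simp add: ord_ge_def)

lemma ord_ge_add: "p \<in> ord_ge s \<Longrightarrow> q \<in> ord_ge s \<Longrightarrow> p + q \<in> ord_ge s"
  by (simp add: ord_ge_lookup lookup_add)

lemma ord_ge_uminus: "p \<in> ord_ge s \<Longrightarrow> - p \<in> ord_ge s"
  by (simp add: ord_ge_lookup)

lemma ord_ge_diff: "p \<in> ord_ge s \<Longrightarrow> q \<in> ord_ge s \<Longrightarrow> p - q \<in> ord_ge s"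
  by (simp add: ord_ge_lookup lookup_minus)

lemma ord_ge_sum: "(\<And>x. x \<in> A \<Longrightarrow> f x \<in> ord_ge s) \<Longrightarrow> sum f A \<in> ord_ge s"
  by (simp add: ord_ge_lookup lookup_sum)

lemma ord_ge_mono: "p \<in> ord_ge s \<Longrightarrow> r \<le> s \<Longrightarrow> p \<in> ord_ge r"
  by (auto simp: ord_ge_def)

lemma ord_ge_mult: "p \<in> ord_ge r \<Longrightarrow> q \<in> ord_ge s \<Longrightarrow> p * q \<in> ord_ge (r + s)"
  unfolding ord_ge_def
  by (force elim!: keys_mult_ex simp: total_degree_add intro: add_mono)

lemma homog_ord_ge: "homog e p \<Longrightarrow> p \<in> ord_ge e"
  by (simp add: homog_def ord_ge_def)

lemma homog_ord_ge_eq_0: "homog e p \<Longrightarrow> p \<in> ord_ge s \<Longrightarrow> e < s \<Longrightarrow> p = 0"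
  by (rule poly_mapping_eqI) (force simp: homog_def ord_ge_def in_keys_iff)

abbreviation trunc :: "nat \<Rightarrow> 'n::finite mpoly \<Rightarrow> 'n mpoly" where
  "trunc s \<equiv> restrict_keys (\<lambda>\<alpha>. total_degree \<alpha> < s)"

abbreviation hpart :: "nat \<Rightarrow> 'n::finite mpoly \<Rightarrow> 'n mpoly" where
  "hpart r \<equiv> restrict_keys (\<lambda>\<alpha>. total_degree \<alpha> = r)"

lemma homog_hpart: "homog r (hpart r p)"
  by (simp add: homog_def keys_restrict_keys)

lemma diff_trunc_ord_ge: "p - trunc s p \<in> ord_ge s"
  by (simp add: ord_ge_lookup lookup_minus lookup_restrict_keys)

lemma trunc_eq_0_iff: "trunc s p = 0 \<longleftrightarrow> p \<in> ord_ge s"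
  by (auto simp: poly_mapping_eq_iff fun_eq_iff ord_ge_lookup lookup_restrict_keys)

lemma trunc_eq_iff: "trunc s p = trunc s q \<longleftrightarrow> p - q \<in> ord_ge s"
  by (simp add: trunc_eq_0_iff[symmetric] restrict_keys_diff)

lemma diff_hpart_ord_ge: "p \<in> ord_ge r \<Longrightarrow> p - hpart r p \<in> ord_ge (Suc r)"
  by (auto simp: ord_ge_lookup lookup_minus lookup_restrict_keys less_Suc_eq)

section \<open>Formal partial derivatives and Euler's relation\<close>

definition mp_var :: "'n \<Rightarrow> 'n mpoly" where
  "mp_var i = Poly_Mapping.single (Poly_Mapping.single i 1) 1"

definition mp_const :: "real \<Rightarrow> 'n mpoly" where
  "mp_const c = Poly_Mapping.single 0 c"

definition mp_deriv :: "'n \<Rightarrow> 'n mpoly \<Rightarrow> 'n mpoly" where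
  "mp_deriv i p = Poly_Mapping.mapp (\<lambda>\<beta> c. real (Suc (lookup \<beta> i)) * c)
     (Poly_Mapping.map_key (\<lambda>\<beta>. \<beta> + Poly_Mapping.single i 1) p)"

lemma lookup_mp_deriv: "lookup (mp_deriv i p) \<beta> = real (Suc (lookup \<beta> i)) * lookup p (\<beta> + Poly_Mapping.single i 1)"
proof -
  have "inj (\<lambda>\<beta>. \<beta> + Poly_Mapping.single i (1::nat))" by (simp add: inj_def)
  then show ?thesis
    by (simp add: mp_deriv_def lookup_mapp when_def in_keys_iff map_key.rep_eq)
qed

lemma mp_deriv_add: "mp_deriv i (p + q) = mp_deriv i p + mp_deriv i q"
  by (rule poly_mapping_eqI) (simp add: lookup_mp_deriv lookup_add algebra_simps)

lemma mp_deriv_zero [simp]: "mp_deriv i 0 = 0"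
  by (rule poly_mapping_eqI) (simp add: lookup_mp_deriv)

text \<open>If \<open>lookup \<alpha> i = 0\<close>, the truncated subtraction leaves the exponent
  unchanged, but then the coefficient is zero.\<close>

lemma mp_deriv_single:
  "mp_deriv i (Poly_Mapping.single \<alpha> c) =
     Poly_Mapping.single (\<alpha> - Poly_Mapping.single i 1) (real (lookup \<alpha> i) * c)"
proof (cases "lookup \<alpha> i")
  case 0
  have "\<alpha> \<noteq> \<beta> + Poly_Mapping.single i 1" for \<beta>
    using 0 by (auto simp: lookup_add)
  then show ?thesis
    using 0 by (intro poly_mapping_eqI) (simp add: lookup_mp_deriv lookup_single when_def)
next
  case (Suc k)
  have "\<alpha> = \<beta> + Poly_Mapping.single i 1 \<longleftrightarrow> \<alpha> - Poly_Mapping.single i 1 = \<beta>" for \<beta>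
  proof
    assume "\<alpha> - Poly_Mapping.single i 1 = \<beta>"
    then show "\<alpha> = \<beta> + Poly_Mapping.single i 1"
      using Suc by (auto intro!: poly_mapping_eqI simp: lookup_add lookup_minus lookup_single when_def)
  qed simp
  then show ?thesis
    using Suc by (intro poly_mapping_eqI) (auto simp: lookup_mp_deriv lookup_single when_def lookup_minus)
qed

lemma mp_deriv_hpart: "mp_deriv i (hpart (Suc r) p) = hpart r (mp_deriv i p)"
  by (rule poly_mapping_eqI) (simp add: lookup_mp_deriv lookup_restrict_keys total_degree_add)

lemma homog_mp_deriv: "homog (Suc r) p \<Longrightarrow> homog r (mp_deriv i p)"
  unfolding homog_def
proof
  fix \<alpha> assume "\<forall>\<beta>\<in>keys p. total_degree \<beta> = Suc r" "\<alpha> \<in> keys (mp_deriv i p)"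
  moreover from this(2) have "\<alpha> + Poly_Mapping.single i 1 \<in> keys p"
    by (auto simp: in_keys_iff lookup_mp_deriv)
  ultimately have "total_degree (\<alpha> + Poly_Mapping.single i 1) = Suc r" by blast
  then show "total_degree \<alpha> = r" by (simp add: total_degree_add)
qed

lemma single_diff_add: "lookup \<alpha> i \<noteq> 0 \<Longrightarrow> \<alpha> - Poly_Mapping.single i 1 + Poly_Mapping.single i (1::nat) = \<alpha>"
  by (rule poly_mapping_eqI) (auto simp: lookup_add lookup_minus lookup_single when_def)

text \<open>Every monomial is an eigenvector of the Euler operator with its total degree as
  eigenvalue, so the identity can be read off coefficient by coefficient.\<close>

lemma euler_mpoly: "lookup (\<Sum>i\<in>UNIV. mp_var i * mp_deriv i p) \<alpha> = real (total_degree \<alpha>) * lookup p \<alpha>"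
proof (induction p rule: poly_mapping_additive_induct)
  case zero
  then show ?case by simp
next
  case (single \<beta> c)
  have "mp_var i * mp_deriv i (Poly_Mapping.single \<beta> c) = Poly_Mapping.single \<beta> (real (lookup \<beta> i) * c)" for i
    by (cases "lookup \<beta> i = 0")
       (use single_diff_add[of \<beta> i] in \<open>auto simp: mp_var_def mp_deriv_single mult_single add.commute\<close>)
  then show ?case
    by (simp add: lookup_sum lookup_single when_def total_degree_def sum_distrib_right)
next
  case (add p q)
  then show ?case by (simp add: mp_deriv_add distrib_left sum.distrib lookup_add)
qed

lemma lookup_mp_const_mult: "lookup (mp_const c * p) \<alpha> = c * lookup p \<alpha>"
  by (simp add: mp_const_def mult_map_scale_conv_mult[symmetric] map.rep_eq when_def)

lemma euler_homog: "homog r p \<Longrightarrow> (\<Sum>i\<in>UNIV. mp_var i * mp_deriv i p) = mp_const (real r) * p"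
proof (rule poly_mapping_eqI)
  fix \<alpha> assume "homog r p"
  then have "real (total_degree \<alpha>) * lookup p \<alpha> = real r * lookup p \<alpha>"
    by (auto simp: homog_def in_keys_iff)
  then show "lookup (\<Sum>i\<in>UNIV. mp_var i * mp_deriv i p) \<alpha> = lookup (mp_const (real r) * p) \<alpha>"
    by (simp add: euler_mpoly lookup_mp_const_mult)
qed

section \<open>Polynomials as smooth functions\<close>

definition mpeval :: "'n::finite mpoly \<Rightarrow> real^'n \<Rightarrow> real" where
  "mpeval p x = (\<Sum>\<alpha>\<in>keys p. lookup p \<alpha> * (\<Prod>i\<in>UNIV. x $ i ^ lookup \<alpha> i))"

lemma mpeval_superset:
  "finite A \<Longrightarrow> keys p \<subseteq> A \<Longrightarrow> mpeval p x = (\<Sum>\<alpha>\<in>A. lookup p \<alpha> * (\<Prod>i\<in>UNIV. x $ i ^ lookup \<alpha> i))"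
  unfolding mpeval_def by (rule sum.mono_neutral_left) (auto simp: in_keys_iff)

lemma mpeval_zero [simp]: "mpeval 0 x = 0"
  by (simp add: mpeval_def)

lemma mpeval_add: "mpeval (p + q) x = mpeval p x + mpeval q x"
  using keys_add[of p q]
  by (simp add: mpeval_superset[of "keys p \<union> keys q"] lookup_add distrib_right sum.distrib)

lemma mpeval_single: "mpeval (Poly_Mapping.single \<alpha> c) x = c * (\<Prod>i\<in>UNIV. x $ i ^ lookup \<alpha> i)"
  by (cases "c = 0") (auto simp: mpeval_def)

lemma mpeval_mult: "mpeval (p * q) x = mpeval p x * mpeval q x"
proof (induction p rule: poly_mapping_additive_induct)
  case (single \<alpha> c)
  show ?case
    by (induction q rule: poly_mapping_additive_induct)
       (auto simp: mult_single mpeval_single lookup_add power_add prod.distrib distrib_left mpeval_add)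
qed (auto simp: mpeval_add distrib_right)

lemma mpeval_uminus: "mpeval (- p) x = - mpeval p x"
  using mpeval_add[of p "- p" x] by simp

lemma mpeval_diff: "mpeval (p - q) x = mpeval p x - mpeval q x"
  using mpeval_add[of p "- q" x] by (simp add: mpeval_uminus)

lemma mpeval_sum: "mpeval (sum f A) x = (\<Sum>a\<in>A. mpeval (f a) x)"
  by (induction A rule: infinite_finite_induct) (auto simp: mpeval_add)

lemma mpeval_mp_const [simp]: "mpeval (mp_const c) x = c"
  by (simp add: mp_const_def mpeval_single)

lemma mpeval_one [simp]: "mpeval 1 x = 1"
  using mpeval_mp_const[of 1] by (simp add: mp_const_def)

lemma mpeval_mp_var [simp]: "mpeval (mp_var i) x = x $ i"
proof -
  have "(\<Prod>j\<in>UNIV. x $ j ^ lookup (Poly_Mapping.single i 1) j) = (\<Prod>j\<in>UNIV. if j = i then x $ j else 1)"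
    by (rule prod.cong) (auto simp: lookup_single when_def)
  then show ?thesis by (simp add: mp_var_def mpeval_single)
qed

lemma mpeval_power: "mpeval (p ^ k) x = mpeval p x ^ k"
  by (induction k) (auto simp: mpeval_mult)

lemma mpeval_homog: "homog r p \<Longrightarrow> mpeval p (t *\<^sub>R x) = t ^ r * mpeval p x"
  unfolding mpeval_def homog_def sum_distrib_left
  by (rule sum.cong) (auto simp: power_mult_distrib prod.distrib total_degree_def power_sum[symmetric])

lemma mpeval_has_derivative:
  "(mpeval p has_derivative (\<lambda>h. \<Sum>i\<in>UNIV. h $ i * mpeval (mp_deriv i p) x)) (at x)"
proof (induction p rule: poly_mapping_additive_induct)
  case zero
  then show ?case by (simp add: mpeval_def[abs_def])
next
  case (single \<alpha> c)
  have "((\<lambda>x. c * (\<Prod>i\<in>UNIV. x $ i ^ lookup \<alpha> i)) has_derivative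
      (\<lambda>h. c * (\<Sum>i\<in>UNIV. (real (lookup \<alpha> i) * h $ i * x $ i ^ (lookup \<alpha> i - 1)) *
        (\<Prod>j\<in>UNIV - {i}. x $ j ^ lookup \<alpha> j)))) (at x)"
    by (auto intro!: derivative_eq_intros has_derivative_prod
        bounded_linear.has_derivative[OF bounded_linear_vec_nth] simp: mult_ac)
  moreover have "h $ i * mpeval (mp_deriv i (Poly_Mapping.single \<alpha> c)) x =
      c * ((real (lookup \<alpha> i) * h $ i * x $ i ^ (lookup \<alpha> i - 1)) *
        (\<Prod>j\<in>UNIV - {i}. x $ j ^ lookup \<alpha> j))" for h i
  proof -
    have "(\<Prod>j\<in>UNIV. x $ j ^ lookup (\<alpha> - Poly_Mapping.single i 1) j) =
        x $ i ^ (lookup \<alpha> i - 1) * (\<Prod>j\<in>UNIV - {i}. x $ j ^ lookup \<alpha> j)"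
      by (subst prod.remove[of UNIV i]) (auto simp: lookup_minus lookup_single when_def intro!: prod.cong)
    then show ?thesis by (simp add: mp_deriv_single mpeval_single)
  qed
  ultimately show ?case
    by (simp only: mpeval_single[abs_def] sum_distrib_left)
next
  case (add p q)
  from has_derivative_add[OF add] show ?case
    by (simp add: mpeval_add[abs_def] mp_deriv_add distrib_left sum.distrib)
qed

lemma axis_nth_if: "(\<Sum>j\<in>UNIV. (axis i 1 :: real^'n::finite) $ j * c j) = c i"
proof -
  have "(\<Sum>j\<in>UNIV. (axis i 1 :: real^'n) $ j * c j) = (\<Sum>j\<in>UNIV. if j = i then c j else 0)"
    by (rule sum.cong) (auto simp: axis_def)
  then show ?thesis by simp
qed

lemma partial_deriv_mpeval: "partial_deriv i (mpeval p) = mpeval (mp_deriv i p)"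
proof
  fix x
  have "frechet_derivative (mpeval p) (at x) = (\<lambda>h. \<Sum>i\<in>UNIV. h $ i * mpeval (mp_deriv i p) x)"
    using frechet_derivative_at[OF mpeval_has_derivative[of p x]] by simp
  then show "partial_deriv i (mpeval p) x = mpeval (mp_deriv i p) x"
    by (simp add: partial_deriv_def axis_nth_if)
qed

lemma Ck_on_mpeval: "Ck_on k (mpeval p) U"
proof (induction k arbitrary: p)
  case 0
  have "isCont (mpeval p) x" for x
    using mpeval_has_derivative has_derivative_continuous by blast
  then show ?case by (simp add: continuous_at_imp_continuous_on)
next
  case (Suc k)
  then show ?case
    using mpeval_has_derivative by (auto simp: differentiable_def partial_deriv_mpeval)
qed

lemma smooth_germ_mpeval: "smooth_germ (mpeval p)"
  unfolding smooth_germ_def using Ck_on_mpeval open_UNIV by blast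

section \<open>The Koszul complex of polynomials containing powers of all variables\<close>

text \<open>The sign of moving the \<open>j\<close>-th basis vector past those of smaller index in
  \<open>S\<close>. As only \<open>i < j\<close> is counted, \<open>S\<close>,
  \<open>insert j S\<close> and \<open>S - {j}\<close> give the same sign.\<close>

definition ksgn :: "nat set \<Rightarrow> nat \<Rightarrow> 'a::comm_ring_1" where
  "ksgn S j = (-1) ^ card {i\<in>S. i < j}"

text \<open>A chain is the family of its coefficients at the wedge products indexed by sets
  \<open>S\<close>. The Koszul differential is written coefficientwise: the coefficient at
  \<open>S\<close> collects the contributions of all sets with one more index.\<close>

definition kdiff :: "nat \<Rightarrow> (nat \<Rightarrow> 'a::comm_ring_1) \<Rightarrow> (nat set \<Rightarrow> 'a) \<Rightarrow> nat set \<Rightarrow> 'a" where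
  "kdiff n P a S = (\<Sum>j\<in>{..<n} - S. ksgn S j * P j * a (insert j S))"

definition kwedge :: "nat \<Rightarrow> (nat set \<Rightarrow> 'a::comm_ring_1) \<Rightarrow> nat set \<Rightarrow> 'a" where
  "kwedge j a S = (if j \<in> S then ksgn S j * a (S - {j}) else 0)"

text \<open>The homological degree is the size of the index sets. Requiring
  \<open>S \<subseteq> {..<n}\<close> keeps every set in the support finite, where
  \<open>card\<close> is meaningful.\<close>

definition kchain :: "nat \<Rightarrow> nat \<Rightarrow> (nat set \<Rightarrow> 'a::comm_ring_1) set" where
  "kchain n i = {a. \<forall>S. a S \<noteq> 0 \<longrightarrow> S \<subseteq> {..<n} \<and> card S = i}"

lemma ksgn_insert_self [simp]: "ksgn (insert j S) j = ksgn S j"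
  unfolding ksgn_def by (rule arg_cong[where f="\<lambda>A. (-1) ^ card A"]) auto

lemma ksgn_remove_self [simp]: "ksgn (S - {j}) j = ksgn S j"
  unfolding ksgn_def by (rule arg_cong[where f="\<lambda>A. (-1) ^ card A"]) auto

lemma ksgn_square [simp]: "ksgn S j * ksgn S j = 1"
  by (simp add: ksgn_def power_mult_distrib[symmetric])

lemma ksgn_square_left [simp]: "ksgn S j * (ksgn S j * x) = x"
  by (simp add: mult.assoc[symmetric])

lemma ksgn_insert:
  assumes "finite S" "j \<notin> S" "l \<noteq> j"
  shows "ksgn (insert j S) l = (if j < l then - ksgn S l else ksgn S l)"
proof -
  have "{i \<in> insert j S. i < l} = (if j < l then insert j {i \<in> S. i < l} else {i \<in> S. i < l})"
    using assms by auto
  then show ?thesis using assms by (auto simp: ksgn_def)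
qed

lemma ksgn_remove:
  assumes "finite S" "j \<in> S" "l \<noteq> j"
  shows "(ksgn (S - {j}) l :: 'a::comm_ring_1) = (if j < l then - ksgn S l else ksgn S l)"
proof -
  have "(ksgn S l :: 'a) = (if j < l then - ksgn (S - {j}) l else ksgn (S - {j}) l)"
    using ksgn_insert[of "S - {j}" j l] assms by (simp add: insert_absorb)
  then show ?thesis by (simp split: if_splits)
qed

lemma kdiff_add: "kdiff n P (\<lambda>S. a S + b S) S = kdiff n P a S + kdiff n P b S"
  by (simp add: kdiff_def distrib_left sum.distrib)

lemma kdiff_diff: "kdiff n P (\<lambda>S. a S - b S) S = kdiff n P a S - kdiff n P b S"
  by (simp add: kdiff_def right_diff_distrib sum_subtractf)

lemma kdiff_scale: "kdiff n P (\<lambda>S. y * a S) S = y * kdiff n P a S"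
  by (simp add: kdiff_def sum_distrib_left mult_ac)

lemma kdiff_zero [simp]: "kdiff n P (\<lambda>S. 0) S = 0"
  by (simp add: kdiff_def)

lemma kdiff_sum: "kdiff n P (\<lambda>S. \<Sum>j\<in>A. f j S) S = (\<Sum>j\<in>A. kdiff n P (f j) S)"
  by (induction A rule: infinite_finite_induct) (simp_all add: kdiff_add)

lemma kdiff_op_diff: "kdiff n P a S - kdiff n Q a S = kdiff n (\<lambda>j. P j - Q j) a S"
  by (simp add: kdiff_def sum_subtractf left_diff_distrib right_diff_distrib)

lemma kchainD: "a \<in> kchain n i \<Longrightarrow> a S \<noteq> 0 \<Longrightarrow> S \<subseteq> {..<n} \<and> card S = i"
  by (auto simp: kchain_def)

lemma kchain_zero [simp]: "(\<lambda>S. 0) \<in> kchain n i"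
  by (simp add: kchain_def)

lemma kchain_diff: "a \<in> kchain n i \<Longrightarrow> b \<in> kchain n i \<Longrightarrow> (\<lambda>S. a S - b S) \<in> kchain n i"
  unfolding kchain_def by (simp, metis diff_zero)

lemma kchain_add: "a \<in> kchain n i \<Longrightarrow> b \<in> kchain n i \<Longrightarrow> (\<lambda>S. a S + b S) \<in> kchain n i"
  unfolding kchain_def by (simp, metis add_0)

lemma kchain_sum: "(\<And>j. j \<in> A \<Longrightarrow> f j \<in> kchain n i) \<Longrightarrow> (\<lambda>S. \<Sum>j\<in>A. f j S) \<in> kchain n i"
  by (induction A rule: infinite_finite_induct) (simp_all add: kchain_add)

lemma kchain_comp: "a \<in> kchain n i \<Longrightarrow> \<phi> 0 = 0 \<Longrightarrow> (\<lambda>S. \<phi> (a S)) \<in> kchain n i"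
  unfolding kchain_def by (simp, metis)

lemma kchain_eq_zero: "n < i \<Longrightarrow> a \<in> kchain n i \<Longrightarrow> a S = 0"
  using card_mono[of "{..<n}" S] kchainD[of a n i S] by fastforce

lemma kdiff_kchain:
  assumes "a \<in> kchain n (Suc i)" shows "kdiff n P a \<in> kchain n i"
  unfolding kchain_def
proof (intro CollectI allI impI)
  fix S assume "kdiff n P a S \<noteq> 0"
  then obtain j where j: "j \<in> {..<n} - S" "a (insert j S) \<noteq> 0"
    unfolding kdiff_def by (metis (mono_tags, lifting) mult_zero_right sum.neutral)
  with kchainD[OF assms] have *: "insert j S \<subseteq> {..<n}" "card (insert j S) = Suc i" by blast+
  then have "finite S" using finite_subset by fastforce
  with * j show "S \<subseteq> {..<n} \<and> card S = i" by auto
qed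

lemma kwedge_kchain:
  assumes "j < n" "a \<in> kchain n i" shows "kwedge j a \<in> kchain n (Suc i)"
  unfolding kchain_def
proof (intro CollectI allI impI)
  fix S assume "kwedge j a S \<noteq> 0"
  then have "j \<in> S" "a (S - {j}) \<noteq> 0" by (auto simp: kwedge_def split: if_splits)
  moreover from kchainD[OF assms(2) this(2)] have "S - {j} \<subseteq> {..<n}" "card (S - {j}) = i" by auto
  moreover from this(1) have "finite S" using finite_subset by fastforce
  ultimately show "S \<subseteq> {..<n} \<and> card S = Suc i"
    using assms(1) by (metis card_Suc_Diff1 insert_Diff insert_subset lessThan_iff)
qed

text \<open>The induction removes the row and the column of one element together, where they cancel.
  This avoids dividing by 2 in a sum that is its own negative.\<close>

lemma sum_antisymmetric:
  fixes T :: "'b \<Rightarrow> 'b \<Rightarrow> 'a::ab_group_add"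
  assumes "finite A" "\<And>j l. j \<in> A \<Longrightarrow> l \<in> A \<Longrightarrow> j \<noteq> l \<Longrightarrow> T j l = - T l j"
  shows "(\<Sum>j\<in>A. \<Sum>l\<in>A - {j}. T j l) = 0"
  using assms
proof (induction A rule: finite_induct)
  case (insert x A)
  have "(\<Sum>l\<in>insert x A - {j}. T j l) = T j x + (\<Sum>l\<in>A - {j}. T j l)" if "j \<in> A" for j
  proof -
    have "insert x A - {j} = insert x (A - {j})" using that insert.hyps by auto
    then show ?thesis using insert.hyps by simp
  qed
  then have "(\<Sum>j\<in>A. \<Sum>l\<in>insert x A - {j}. T j l) = (\<Sum>j\<in>A. T j x) + (\<Sum>j\<in>A. \<Sum>l\<in>A - {j}. T j l)"
    by (simp add: sum.distrib)
  moreover have "(\<Sum>j\<in>A. \<Sum>l\<in>A - {j}. T j l) = 0"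
    by (rule insert.IH, rule insert.prems) simp_all
  moreover have "(\<Sum>l\<in>A. T x l) = - (\<Sum>j\<in>A. T j x)"
    unfolding sum_negf[symmetric]
    by (intro sum.cong refl insert.prems) (use insert.hyps in auto)
  ultimately show ?case using insert.hyps by simp
qed simp

text \<open>Exchanging the order in which \<open>j\<close> and \<open>l\<close> are added to
  \<open>S\<close> flips exactly one of the two signs, that of the larger index, so the double sum
  is antisymmetric. Finiteness of \<open>S\<close> enters because the signs are defined by
  cardinalities.\<close>

lemma kdiff_kdiff:
  fixes P :: "nat \<Rightarrow> 'a::comm_ring_1"
  assumes "finite S" shows "kdiff n P (kdiff n P a) S = 0"
proof -
  let ?A = "{..<n} - S"
  let ?T = "\<lambda>j l. ksgn S j * P j * (ksgn (insert j S) l * P l * a (insert l (insert j S)))"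
  have "kdiff n P (kdiff n P a) S = (\<Sum>j\<in>?A. \<Sum>l\<in>?A - {j}. ?T j l)"
    unfolding kdiff_def
    by (rule sum.cong) (auto simp: sum_distrib_left intro!: sum.cong)
  also have "\<dots> = 0"
  proof (rule sum_antisymmetric)
    fix j l assume jl: "j \<in> ?A" "l \<in> ?A" "j \<noteq> l"
    then have ins: "insert j (insert l S) = insert l (insert j S)" by auto
    have "ksgn S j * ksgn (insert j S) l = - (ksgn S l * ksgn (insert l S) j :: 'a)"
      using jl assms by (cases "j < l") (simp_all add: ksgn_insert)
    then have "(ksgn S j * ksgn (insert j S) l) * (P j * P l * a (insert l (insert j S))) =
        - (ksgn S l * ksgn (insert l S) j) * (P j * P l * a (insert l (insert j S)))"
      by simp
    then show "?T j l = - ?T l j"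
      by (simp add: ins mult_ac)
  qed simp
  finally show ?thesis .
qed

text \<open>Exterior multiplication by the \<open>j\<close>-th basis vector is a contracting homotopy for multiplication
  by \<open>P j\<close>, so the ideal generated by the \<open>P j\<close> annihilates Koszul homology.\<close>

lemma kdiff_kwedge:
  assumes "S \<subseteq> {..<n}" "j < n"
  shows "kdiff n P (kwedge j a) S + kwedge j (kdiff n P a) S = P j * a S"
proof (cases "j \<in> S")
  case False
  have "kdiff n P (kwedge j a) S =
      (\<Sum>l\<in>{..<n} - S. if l = j then ksgn S j * P j * kwedge j a (insert j S) else 0)"
    unfolding kdiff_def by (rule sum.cong) (use False in \<open>auto simp: kwedge_def\<close>)
  also have "\<dots> = ksgn S j * P j * kwedge j a (insert j S)"
    using False assms by simp
  also have "\<dots> = P j * a S"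
    using False by (simp add: kwedge_def mult_ac)
  finally show ?thesis using False by (simp add: kwedge_def)
next
  case True
  have fin: "finite S" using assms(1) finite_subset by blast
  \<comment> \<open>In the inner sum the term for \<open>j\<close> itself carries the sign twice and
    leaves \<open>P j * a S\<close>. The others cancel against the other composite, since inserting
    \<open>l\<close> and removing \<open>j\<close> anticommute.\<close>
  have "{..<n} - (S - {j}) = insert j ({..<n} - S)"
    using True assms by auto
  then have "kwedge j (kdiff n P a) S = ksgn S j * (ksgn S j * P j * a S +
      (\<Sum>l\<in>{..<n} - S. ksgn (S - {j}) l * P l * a (insert l (S - {j}))))"
    using True by (simp add: kwedge_def kdiff_def insert_absorb)
  also have "\<dots> = P j * a S +
      (\<Sum>l\<in>{..<n} - S. ksgn S j * (ksgn (S - {j}) l * P l * a (insert l (S - {j}))))"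
    by (simp add: distrib_left sum_distrib_left mult.assoc)
  also have "(\<Sum>l\<in>{..<n} - S. ksgn S j * (ksgn (S - {j}) l * P l * a (insert l (S - {j})))) =
     - kdiff n P (kwedge j a) S"
    unfolding kdiff_def sum_negf[symmetric]
  proof (rule sum.cong)
    fix l assume l: "l \<in> {..<n} - S"
    then have "insert l S - {j} = insert l (S - {j})" "l \<noteq> j" "l \<notin> S" using True by auto
    then show "ksgn S j * (ksgn (S - {j}) l * P l * a (insert l (S - {j}))) =
        - (ksgn S l * P l * kwedge j a (insert l S))"
      using True fin by (cases "j < l") (simp_all add: kwedge_def ksgn_insert ksgn_remove mult_ac)
  qed simp
  finally show ?thesis by simp
qed

text \<open>The ideal generated by the \<open>N\<close>-th powers of the first \<open>k\<close>
  variables in the enumeration \<open>\<nu>\<close>. As a monomial ideal it is described by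
  exponents, which makes membership of sums and cancellation questions about single monomials; for
  \<open>k = 0\<close> it is zero.\<close>

definition mon_ideal :: "nat \<Rightarrow> (nat \<Rightarrow> 'n) \<Rightarrow> nat \<Rightarrow> 'n mpoly set" where
  "mon_ideal N \<nu> k = {p. \<forall>\<alpha>\<in>keys p. \<exists>j<k. N \<le> lookup \<alpha> (\<nu> j)}"

lemma mon_ideal_zero [simp]: "0 \<in> mon_ideal N \<nu> k"
  by (simp add: mon_ideal_def)

lemma mon_ideal_0_iff [simp]: "p \<in> mon_ideal N \<nu> 0 \<longleftrightarrow> p = 0"
  by (simp add: mon_ideal_def)

lemma mon_ideal_add: "p \<in> mon_ideal N \<nu> k \<Longrightarrow> q \<in> mon_ideal N \<nu> k \<Longrightarrow> p + q \<in> mon_ideal N \<nu> k"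
  using keys_add[of p q] by (auto simp: mon_ideal_def)

lemma mon_ideal_uminus: "p \<in> mon_ideal N \<nu> k \<Longrightarrow> - p \<in> mon_ideal N \<nu> k"
  by (auto simp: mon_ideal_def in_keys_iff)

lemma mon_ideal_diff: "p \<in> mon_ideal N \<nu> k \<Longrightarrow> q \<in> mon_ideal N \<nu> k \<Longrightarrow> p - q \<in> mon_ideal N \<nu> k"
  using mon_ideal_add[OF _ mon_ideal_uminus, of p N \<nu> k q] by simp

lemma mon_ideal_mult: "q \<in> mon_ideal N \<nu> k \<Longrightarrow> p * q \<in> mon_ideal N \<nu> k"
  unfolding mon_ideal_def by (force elim!: keys_mult_ex simp: lookup_add intro: trans_le_add2)

lemma mon_ideal_sum: "(\<And>x. x \<in> A \<Longrightarrow> f x \<in> mon_ideal N \<nu> k) \<Longrightarrow> sum f A \<in> mon_ideal N \<nu> k"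
  by (induction A rule: infinite_finite_induct) (simp_all add: mon_ideal_add)

lemma kdiff_mon_ideal: "(\<And>S. a S \<in> mon_ideal N \<nu> k) \<Longrightarrow> kdiff n P a S \<in> mon_ideal N \<nu> k"
  unfolding kdiff_def by (intro mon_ideal_sum mon_ideal_mult) auto

lemma kwedge_mon_ideal: "(\<And>S. a S \<in> mon_ideal N \<nu> k) \<Longrightarrow> kwedge j a S \<in> mon_ideal N \<nu> k"
  unfolding kwedge_def by (auto intro: mon_ideal_mult)

lemma lookup_single_mult_shift:
  fixes p :: "'a::cancel_comm_monoid_add \<Rightarrow>\<^sub>0 'b::comm_semiring_1"
  shows "lookup (Poly_Mapping.single \<gamma> 1 * p) (\<gamma> + \<beta>) = lookup p \<beta>"
  by (induction p rule: poly_mapping_additive_induct)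
     (simp_all add: mult_single lookup_single when_def distrib_left lookup_add)

lemma mp_var_power: "mp_var i ^ N = Poly_Mapping.single (Poly_Mapping.single i N) 1"
  by (induction N) (simp_all add: mp_var_def mult_single single_add[symmetric])

text \<open>The next power is a nonzerodivisor modulo the earlier ones: multiplying by it changes
  only the exponent of a variable that, by injectivity of \<open>\<nu>\<close>, differs from all
  earlier ones.\<close>

lemma mon_ideal_cancel:
  assumes "inj_on \<nu> {..<n}" "k < n" "mp_var (\<nu> k) ^ N * p \<in> mon_ideal N \<nu> k"
  shows "p \<in> mon_ideal N \<nu> k"
  unfolding mon_ideal_def
proof (intro CollectI ballI)
  fix \<alpha> assume "\<alpha> \<in> keys p"
  then have "Poly_Mapping.single (\<nu> k) N + \<alpha> \<in> keys (mp_var (\<nu> k) ^ N * p)"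
    by (simp add: in_keys_iff mp_var_power lookup_single_mult_shift)
  with assms(3) obtain j where j: "j < k" "N \<le> lookup (Poly_Mapping.single (\<nu> k) N + \<alpha>) (\<nu> j)"
    unfolding mon_ideal_def by blast
  have "\<nu> j \<noteq> \<nu> k" using assms j(1) by (auto dest: inj_onD)
  with j show "\<exists>j<k. N \<le> lookup \<alpha> (\<nu> j)"
    by (auto simp: lookup_add lookup_single when_def)
qed

text \<open>Terms divisible by an earlier power go to \<open>\<phi> p\<close>; the others are
  divisible by the new power, and \<open>\<psi> p\<close> is their quotient, a shift of exponents.
  The splitting is by functions that fix zero, so that applying them to all coefficients of a chain
  gives a chain again.\<close>

lemma mon_ideal_Suc_split:
  obtains \<phi> \<psi> :: "'n mpoly \<Rightarrow> 'n mpoly" where "\<phi> 0 = 0" "\<psi> 0 = 0"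
    "\<And>p. p \<in> mon_ideal N \<nu> (Suc k) \<Longrightarrow> \<phi> p \<in> mon_ideal N \<nu> k"
    "\<And>p. p \<in> mon_ideal N \<nu> (Suc k) \<Longrightarrow> p = \<phi> p + mp_var (\<nu> k) ^ N * \<psi> p"
proof
  let ?R = "\<lambda>\<alpha>. \<exists>j<k. N \<le> lookup \<alpha> (\<nu> j)" and ?\<gamma> = "Poly_Mapping.single (\<nu> k) N"
  let ?\<psi> = "\<lambda>p. Poly_Mapping.map_key (\<lambda>\<beta>. ?\<gamma> + \<beta>) (restrict_keys (\<lambda>\<alpha>. \<not> ?R \<alpha>) p)"
  have inj: "inj (\<lambda>\<beta>. ?\<gamma> + \<beta>)" by (simp add: inj_def)
  show "restrict_keys ?R 0 = 0" "?\<psi> 0 = 0" by (simp_all add: inj)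
  fix p :: "'n mpoly" assume p: "p \<in> mon_ideal N \<nu> (Suc k)"
  show "restrict_keys ?R p \<in> mon_ideal N \<nu> k" by (simp add: mon_ideal_def keys_restrict_keys)
  have "restrict_keys (\<lambda>\<alpha>. \<not> ?R \<alpha>) p = Poly_Mapping.single ?\<gamma> 1 * ?\<psi> p"
  proof (rule poly_mapping_eqI)
    fix \<alpha>
    show "lookup (restrict_keys (\<lambda>\<alpha>. \<not> ?R \<alpha>) p) \<alpha> = lookup (Poly_Mapping.single ?\<gamma> 1 * ?\<psi> p) \<alpha>"
    proof (cases "N \<le> lookup \<alpha> (\<nu> k)")
      case True
      then have "\<alpha> = ?\<gamma> + (\<alpha> - ?\<gamma>)"
        by (intro poly_mapping_eqI) (auto simp: lookup_add lookup_minus lookup_single when_def)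
      then obtain \<beta> where "\<alpha> = ?\<gamma> + \<beta>" by blast
      then show ?thesis by (simp only: lookup_single_mult_shift map_key.rep_eq[OF inj] o_def)
    next
      case False
      have "\<alpha> \<notin> keys (Poly_Mapping.single ?\<gamma> 1 * ?\<psi> p)"
        using False by (auto elim!: keys_mult_ex simp: lookup_add lookup_single when_def)
      then have "lookup (Poly_Mapping.single ?\<gamma> 1 * ?\<psi> p) \<alpha> = 0"
        by (simp add: in_keys_iff)
      moreover have "lookup (restrict_keys (\<lambda>\<alpha>. \<not> ?R \<alpha>) p) \<alpha> = 0"
        using p False by (auto simp: lookup_restrict_keys mon_ideal_def in_keys_iff less_Suc_eq)
      ultimately show ?thesis by simp
    qed
  qed
  with restrict_keys_compl[of p ?R] show "p = restrict_keys ?R p + mp_var (\<nu> k) ^ N * ?\<psi> p"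
    by (simp add: mp_var_power)
qed

text \<open>Descending induction on \<open>k\<close>: if \<open>a\<close> is a cycle modulo the first \<open>k\<close> powers and \<open>h\<close> is the
  homotopy for the next power \<open>y\<close>, then \<open>h a\<close> is a cycle modulo one more power, hence
  \<open>h a = D c + z + y c'\<close> with \<open>z\<close> in the ideal of the first \<open>k\<close> powers. Applying \<open>D\<close> yields
  \<open>y a \<equiv> y (D c')\<close>, and \<open>y\<close> is a nonzerodivisor modulo this ideal.\<close>

lemma koszul_exact_mod:
  fixes P :: "nat \<Rightarrow> 'n mpoly"
  assumes inj: "inj_on \<nu> {..<n}"
    and gen: "\<And>k. k < n \<Longrightarrow> mp_var (\<nu> k) ^ N = (\<Sum>j<n. q k j * P j)"
    and "k \<le> n" "k < i" "a \<in> kchain n i" "\<And>S. kdiff n P a S \<in> mon_ideal N \<nu> k"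
  shows "\<exists>c\<in>kchain n (Suc i). \<forall>S. a S - kdiff n P c S \<in> mon_ideal N \<nu> k"
  using assms(3-)
proof (induction k arbitrary: a i rule: inc_induct)
  case base
  \<comment> \<open>The induction raises \<open>k\<close> and the homological degree together and so
    keeps \<open>k < i\<close>. At \<open>k = n\<close> the degree exceeds \<open>n\<close>, where
    every chain is zero.\<close>
  then have "a S = 0" for S by (intro kchain_eq_zero)
  then show ?case by (intro bexI[of _ "\<lambda>S. 0"]) auto
next
  case (step k)
  let ?y = "mp_var (\<nu> k) ^ N"
  \<comment> \<open>Combining the homotopies for the single \<open>P j\<close> with the coefficients
    that express \<open>?y\<close> through the \<open>P j\<close> gives a homotopy for
    multiplication by \<open>?y\<close>.\<close>
  define h where "h a S = (\<Sum>j<n. q k j * kwedge j a S)" for a S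
  have homotopy: "kdiff n P (h a) S + h (kdiff n P a) S = ?y * a S" if "S \<subseteq> {..<n}" for a S
  proof -
    have "kdiff n P (h a) S + h (kdiff n P a) S =
        (\<Sum>j<n. q k j * (kdiff n P (kwedge j a) S + kwedge j (kdiff n P a) S))"
      by (simp add: h_def[abs_def] kdiff_sum kdiff_scale distrib_left sum.distrib)
    also have "\<dots> = (\<Sum>j<n. q k j * (P j * a S))"
      by (rule sum.cong) (simp_all add: kdiff_kwedge[OF that])
    also have "\<dots> = ?y * a S"
      by (simp add: gen[OF step.hyps(2)] sum_distrib_right mult.assoc)
    finally show ?thesis .
  qed
  have h_ideal: "h (kdiff n P a) S \<in> mon_ideal N \<nu> k" for S
    unfolding h_def by (intro mon_ideal_sum mon_ideal_mult kwedge_mon_ideal step.prems)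
  have ha: "h a \<in> kchain n (Suc i)"
    unfolding h_def[abs_def]
    by (intro kchain_sum kchain_comp[where \<phi>="\<lambda>p. q k _ * p"] kwedge_kchain step.prems) auto
  obtain \<phi> \<psi> :: "'n mpoly \<Rightarrow> 'n mpoly" where split: "\<phi> 0 = 0" "\<psi> 0 = 0"
    "\<And>p. p \<in> mon_ideal N \<nu> (Suc k) \<Longrightarrow> \<phi> p \<in> mon_ideal N \<nu> k"
    "\<And>p. p \<in> mon_ideal N \<nu> (Suc k) \<Longrightarrow> p = \<phi> p + ?y * \<psi> p"
    by (rule mon_ideal_Suc_split[of N \<nu> k]) (rule that)
  have y: "?y * p \<in> mon_ideal N \<nu> (Suc k)" for p
    unfolding mon_ideal_def mp_var_power
    by (auto elim!: keys_mult_ex simp: lookup_add)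
  have sub: "p \<in> mon_ideal N \<nu> (Suc k)" if "p \<in> mon_ideal N \<nu> k" for p
    using that unfolding mon_ideal_def by (blast intro: less_SucI)
  have dha: "kdiff n P (h a) S \<in> mon_ideal N \<nu> (Suc k)" for S
  proof (cases "S \<subseteq> {..<n}")
    case True
    then have "kdiff n P (h a) S = ?y * a S - h (kdiff n P a) S"
      using homotopy[of S a] by (simp add: algebra_simps)
    then show ?thesis by (simp add: mon_ideal_diff y sub h_ideal)
  next
    case False
    then have "kdiff n P (h a) S = 0"
      using kchainD[OF kdiff_kchain[OF ha]] by blast
    then show ?thesis by simp
  qed
  from step.IH[of "Suc i" "h a", OF _ ha dha] step.prems
  obtain c where c: "c \<in> kchain n (Suc (Suc i))"
    "\<And>S. h a S - kdiff n P c S \<in> mon_ideal N \<nu> (Suc k)" by auto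
  define u where "u S = h a S - kdiff n P c S" for S
  define c' where "c' S = \<psi> (u S)" for S
  have u: "u \<in> kchain n (Suc i)"
    unfolding u_def[abs_def] by (intro kchain_diff ha kdiff_kchain c)
  have c': "c' \<in> kchain n (Suc i)"
    unfolding c'_def[abs_def] by (rule kchain_comp[where \<phi>=\<psi>, OF u split(2)])
  show ?case
  proof (intro bexI[OF _ c'] allI)
    fix S
    show "a S - kdiff n P c' S \<in> mon_ideal N \<nu> k"
    proof (cases "S \<subseteq> {..<n}")
      case True
      then have fin: "finite S" using finite_subset by blast
      have "u S' = \<phi> (u S') + ?y * c' S'" for S'
        using split(4)[of "u S'"] c(2) by (simp add: u_def c'_def)
      then have "kdiff n P u S = kdiff n P (\<lambda>S. \<phi> (u S) + ?y * c' S) S"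
        by (intro arg_cong[where f="\<lambda>u. kdiff n P u S"] ext)
      then have "kdiff n P u S = kdiff n P (\<lambda>S. \<phi> (u S)) S + ?y * kdiff n P c' S"
        by (simp only: kdiff_add kdiff_scale)
      moreover have "kdiff n P u S = kdiff n P (h a) S"
        unfolding u_def[abs_def] by (simp add: kdiff_diff kdiff_kdiff[OF fin])
      ultimately have "?y * (a S - kdiff n P c' S) =
          kdiff n P (\<lambda>S. \<phi> (u S)) S + h (kdiff n P a) S"
        using homotopy[OF True, of a] by (simp add: right_diff_distrib algebra_simps)
      moreover have "kdiff n P (\<lambda>S. \<phi> (u S)) S \<in> mon_ideal N \<nu> k"
        by (rule kdiff_mon_ideal) (use split(3) c(2) in \<open>auto simp: u_def\<close>)
      ultimately have "?y * (a S - kdiff n P c' S) \<in> mon_ideal N \<nu> k"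
        by (simp add: mon_ideal_add h_ideal)
      then show ?thesis by (rule mon_ideal_cancel[OF inj step.hyps(2)])
    next
      case False
      then have "a S = 0" "kdiff n P c' S = 0"
        using kchainD[OF step.prems(2)] kchainD[OF kdiff_kchain[OF c']] by blast+
      then show ?thesis by simp
    qed
  qed
qed

text \<open>For \<open>k = 0\<close> the monomial ideal is zero, and the congruence becomes an
  equality in every positive degree.\<close>

lemma koszul_exact:
  fixes P :: "nat \<Rightarrow> 'n mpoly"
  assumes "inj_on \<nu> {..<n}" "\<And>k. k < n \<Longrightarrow> mp_var (\<nu> k) ^ N = (\<Sum>j<n. q k j * P j)"
    and "0 < i" "a \<in> kchain n i" "\<And>S. kdiff n P a S = 0"
  obtains c where "c \<in> kchain n (Suc i)" "\<And>S. a S = kdiff n P c S"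
  using koszul_exact_mod[OF assms(1,2), of 0 i a] assms(3-) by auto

section \<open>Hadamard's lemma\<close>

lemma frechet_derivative_partial_deriv:
  fixes f :: "real^'n::finite \<Rightarrow> real"
  assumes "f differentiable (at x)"
  shows "frechet_derivative f (at x) v = (\<Sum>i\<in>UNIV. v $ i * partial_deriv i f x)"
proof -
  have lin: "linear (frechet_derivative f (at x))"
    by (rule linear_frechet_derivative[OF assms])
  have "v = (\<Sum>i\<in>UNIV. (v $ i) *\<^sub>R axis i 1)"
    using basis_expansion[of v] by (simp add: scalar_mult_eq_scaleR)
  from arg_cong[OF this, of "frechet_derivative f (at x)"]
  have "frechet_derivative f (at x) v = frechet_derivative f (at x) (\<Sum>i\<in>UNIV. (v $ i) *\<^sub>R axis i 1)" .
  also have "\<dots> = (\<Sum>i\<in>UNIV. v $ i * partial_deriv i f x)"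
    by (simp add: linear_sum[OF lin] linear_cmul[OF lin] partial_deriv_def)
  finally show ?thesis .
qed

lemma has_derivative_partial_deriv:
  fixes f :: "real^'n::finite \<Rightarrow> real"
  assumes "f differentiable (at x)"
  shows "(f has_derivative (\<lambda>v. \<Sum>i\<in>UNIV. v $ i * partial_deriv i f x)) (at x)"
  using assms frechet_derivative_partial_deriv[OF assms, abs_def]
  by (simp add: frechet_derivative_works)

lemma has_vector_derivative_ray:
  fixes f :: "real^'n::finite \<Rightarrow> real"
  assumes "f differentiable (at (t *\<^sub>R x))"
  shows "((\<lambda>t. f (t *\<^sub>R x)) has_vector_derivative (\<Sum>i\<in>UNIV. x $ i * partial_deriv i f (t *\<^sub>R x))) (at t)"
proof -
  have "((\<lambda>t. t *\<^sub>R x) has_derivative (\<lambda>s. s *\<^sub>R x)) (at t)"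
    by (rule bounded_linear_imp_has_derivative[OF bounded_linear_scaleR_left])
  from has_derivative_compose[OF this has_derivative_partial_deriv[OF assms]]
  show ?thesis
    by (simp add: has_vector_derivative_def sum_distrib_left mult.assoc)
qed

lemma Ck_on_imp_continuous_on: "open U \<Longrightarrow> Ck_on k f U \<Longrightarrow> continuous_on U f"
  by (induction k) (use Ck_on_Suc in auto)

lemma scaleR_unit_in_ball:
  assumes "x \<in> ball 0 r" "t \<in> {0..1::real}" shows "t *\<^sub>R x \<in> ball (0::'a::real_normed_vector) r"
proof -
  have "\<bar>t\<bar> * norm x \<le> 1 * norm x" using assms(2) by (intro mult_right_mono) auto
  then show ?thesis using assms(1) by simp
qed

text \<open>Differentiation under the integral sign. By the chain rule each partial derivative
  brings out a further factor \<open>t\<close>, so the weight \<open>t ^ k\<close> with arbitrary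
  \<open>k\<close> is what the induction needs.\<close>

lemma Ck_on_parametric_integral:
  fixes h :: "real^'n::finite \<Rightarrow> real"
  assumes "\<And>m. Ck_on m h (ball 0 r)"
  shows "Ck_on m (\<lambda>x. integral {0..1} (\<lambda>t. t ^ k * h (t *\<^sub>R x))) (ball 0 r)"
  using assms
proof (induction m arbitrary: h k)
  case (0 h k)
  let ?B = "ball 0 r :: (real^'n) set"
  have "continuous_on (?B \<times> cbox 0 1) (\<lambda>(x, t). t ^ k * h (t *\<^sub>R x))"
    unfolding case_prod_beta
  proof (intro continuous_intros continuous_on_compose2[of ?B h "?B \<times> cbox 0 1" "\<lambda>z. snd z *\<^sub>R fst z"])
    show "continuous_on ?B h" using 0 by (metis Ck_on.simps(1))
    show "(\<lambda>z. snd z *\<^sub>R fst z) ` (?B \<times> cbox 0 (1::real)) \<subseteq> ?B"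
      using scaleR_unit_in_ball by fastforce
  qed
  from integral_continuous_on_param[OF this] show ?case by simp
next
  case (Suc m h k)
  let ?B = "ball 0 r :: (real^'n) set"
  define H where "H k h x = integral {0..1} (\<lambda>t. t ^ k * h (t *\<^sub>R x))"
    for k and h :: "real^'n \<Rightarrow> real" and x
  \<comment> \<open>The derivative in \<open>x\<close> as a bounded linear map: the Leibniz rule for
    integrals asks for an integrand depending continuously on \<open>(x, t)\<close> with values in
    such maps.\<close>
  define D where "D x t = (t ^ k) *\<^sub>R (\<Sum>i\<in>UNIV. (t * partial_deriv i h (t *\<^sub>R x)) *\<^sub>R
    blinfun_inner_left (axis i 1 :: real^'n))" for x and t :: real
  have tx: "t *\<^sub>R x \<in> ?B" if "x \<in> ?B" "t \<in> cbox 0 1" for t and x :: "real^'n"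
    by (rule scaleR_unit_in_ball[OF that(1)]) (use that(2) in simp)
  have pd: "\<And>i m. Ck_on m (partial_deriv i h) ?B" and diff: "\<And>x. x \<in> ?B \<Longrightarrow> h differentiable (at x)"
    using Suc.prems[of "Suc _"] by auto
  have cont: "continuous_on (?B \<times> cbox 0 1) (\<lambda>z. g (snd z *\<^sub>R fst z))"
    if "continuous_on ?B g" for g :: "real^'n \<Rightarrow> real"
    by (rule continuous_on_compose2[OF that]) (use tx in \<open>auto intro!: continuous_intros\<close>)
  have cont_pd: "continuous_on (?B \<times> cbox 0 1) (\<lambda>z. partial_deriv i h (snd z *\<^sub>R fst z))" for i
    by (rule cont[OF Ck_on_imp_continuous_on[OF open_ball pd[of 0]]])
  have contD: "continuous_on (?B \<times> cbox 0 1) (\<lambda>(x, t). D x t)"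
    unfolding case_prod_beta D_def
    by (intro continuous_intros cont_pd)
  have int: "(\<lambda>t. t ^ k * h (t *\<^sub>R x)) integrable_on cbox 0 1" if "x \<in> ?B" for x
  proof -
    have "continuous_on (cbox 0 1) (\<lambda>t. h (t *\<^sub>R x))"
      by (rule continuous_on_compose2[OF Ck_on_imp_continuous_on[OF open_ball Suc.prems[of 0]]])
         (use tx[OF that] in \<open>auto intro!: continuous_intros\<close>)
    then show ?thesis by (intro integrable_continuous continuous_on_mult continuous_intros)
  qed
  have der: "((\<lambda>x. t ^ k * h (t *\<^sub>R x)) has_derivative blinfun_apply (D x t)) (at x within ?B)"
    if x: "x \<in> ?B" and t: "t \<in> cbox 0 1" for x t
  proof -
    have "((\<lambda>x. t *\<^sub>R x) has_derivative (\<lambda>v. t *\<^sub>R v)) (at x)"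
      by (rule bounded_linear_imp_has_derivative[OF bounded_linear_scaleR_right])
    from has_derivative_compose[OF this has_derivative_partial_deriv[OF diff[OF tx[OF x t]]]]
    have "((\<lambda>x. h (t *\<^sub>R x)) has_derivative (\<lambda>v. \<Sum>i\<in>UNIV. (t *\<^sub>R v) $ i * partial_deriv i h (t *\<^sub>R x))) (at x)" .
    from has_derivative_mult_right[OF this, of "t ^ k"]
    have "((\<lambda>x. t ^ k * h (t *\<^sub>R x)) has_derivative
        (\<lambda>v. t ^ k * (\<Sum>i\<in>UNIV. (t *\<^sub>R v) $ i * partial_deriv i h (t *\<^sub>R x)))) (at x)" .
    moreover have "(\<lambda>v. t ^ k * (\<Sum>i\<in>UNIV. (t *\<^sub>R v) $ i * partial_deriv i h (t *\<^sub>R x))) = blinfun_apply (D x t)"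
      by (auto simp: D_def fun_eq_iff blinfun.scaleR_left blinfun.sum_left inner_axis mult_ac)
    ultimately show ?thesis by (simp add: has_derivative_at_withinI)
  qed
  have leib: "(H k h has_derivative blinfun_apply (integral (cbox 0 1) (D x))) (at x)" if x: "x \<in> ?B" for x
  proof -
    have "((\<lambda>x. integral (cbox 0 1) (\<lambda>t. t ^ k * h (t *\<^sub>R x))) has_derivative
        blinfun_apply (integral (cbox 0 1) (D x))) (at x within ?B)"
      by (rule leibniz_rule[OF der int contD x convex_ball])
    then show ?thesis using at_within_open[OF x open_ball] by (simp add: H_def[abs_def])
  qed
  have eq: "partial_deriv i (H k h) x = H (Suc k) (partial_deriv i h) x" if x: "x \<in> ?B" for x i
  proof -
    have c: "continuous_on (cbox 0 1) (\<lambda>t. (x, t :: real))" by (intro continuous_intros)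
    have "continuous_on (cbox 0 1) (\<lambda>t. case (x, t) of (x, t) \<Rightarrow> D x t)"
      by (rule continuous_on_compose2[OF contD c]) (use x in auto)
    then have "D x integrable_on cbox 0 1"
      by (intro integrable_continuous) simp
    moreover have "blinfun_apply (D x t) (axis i 1) = t ^ Suc k * partial_deriv i h (t *\<^sub>R x)" for t
      using axis_nth_if[of i "\<lambda>j. t * partial_deriv j h (t *\<^sub>R x)"]
      by (simp add: D_def blinfun.scaleR_left blinfun.sum_left inner_axis mult_ac)
    ultimately show ?thesis
      using frechet_derivative_at[OF leib[OF x], symmetric]
      by (simp add: partial_deriv_def blinfun_apply_integral H_def)
  qed
  have "Ck_on m (H (Suc k) (partial_deriv i h)) ?B" for i
    unfolding H_def[abs_def] by (rule Suc.IH) (rule pd)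
  then have "Ck_on m (partial_deriv i (H k h)) ?B" for i
    by (rule Ck_on_cong[OF open_ball, rotated]) (rule eq[symmetric])
  moreover have "H k h differentiable (at x)" if "x \<in> ?B" for x
    using leib[OF that] by (rule differentiableI)
  ultimately have "Ck_on (Suc m) (H k h) ?B" by simp
  then show ?case by (simp add: H_def[abs_def])
qed

text \<open>The fundamental theorem of calculus along the segment from 0 to \<open>x\<close>, after
  shrinking the domain to a ball so that the segment stays inside.\<close>

lemma hadamard_lemma:
  fixes f :: "real^'n::finite \<Rightarrow> real"
  assumes "smooth_germ f"
  obtains g where "\<And>i. smooth_germ (g i)" "\<forall>\<^sub>F x in nhds 0. f x = f 0 + (\<Sum>i\<in>UNIV. x $ i * g i x)"
proof -
  from assms obtain U where U: "open U" "0 \<in> U" "\<And>k. Ck_on k f U"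
    unfolding smooth_germ_def by blast
  then obtain r where r: "r > 0" "ball 0 r \<subseteq> U" by (meson open_contains_ball)
  let ?B = "ball 0 r :: (real^'n) set"
  have fB: "Ck_on k f ?B" for k using Ck_on_subset[OF r(2) U(3)] .
  have pd: "\<And>i m. Ck_on m (partial_deriv i f) ?B" and diff: "\<And>x. x \<in> ?B \<Longrightarrow> f differentiable (at x)"
    using fB[of "Suc _"] by auto
  \<comment> \<open>The factor \<open>t ^ 0\<close> gives the integrand the shape of the parametric
    integral lemma.\<close>
  define g where "g i x = integral {0..1} (\<lambda>t. t ^ 0 * partial_deriv i f (t *\<^sub>R x))" for i x
  have "Ck_on m (g i) ?B" for m i
    unfolding g_def[abs_def] by (rule Ck_on_parametric_integral[OF pd])
  then have "smooth_germ (g i)" for i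
    unfolding smooth_germ_def using r(1) by (intro exI[of _ ?B]) simp
  have expand: "f x = f 0 + (\<Sum>i\<in>UNIV. x $ i * g i x)" if x: "x \<in> ?B" for x
  proof -
    have tx: "t *\<^sub>R x \<in> ?B" if "t \<in> {0..1}" for t
      using x that by (rule scaleR_unit_in_ball)
    have "((\<lambda>t. f (t *\<^sub>R x)) has_vector_derivative (\<Sum>i\<in>UNIV. x $ i * partial_deriv i f (t *\<^sub>R x))) (at t within {0..1})"
      if t: "t \<in> {0..1}" for t
      using has_vector_derivative_ray[OF diff[OF tx[OF t]]] by (rule has_vector_derivative_at_within)
    from fundamental_theorem_of_calculus[OF _ this]
    have "((\<lambda>t. \<Sum>i\<in>UNIV. x $ i * partial_deriv i f (t *\<^sub>R x)) has_integral (f x - f 0)) {0..1}"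
      by simp
    moreover have "(\<lambda>t. partial_deriv i f (t *\<^sub>R x)) integrable_on {0..1}" for i
    proof (rule integrable_continuous_real)
      show "continuous_on {0..1} (\<lambda>t. partial_deriv i f (t *\<^sub>R x))"
        by (rule continuous_on_compose2[OF Ck_on_imp_continuous_on[OF open_ball pd[of 0]]])
           (use tx in \<open>auto intro!: continuous_intros\<close>)
    qed
    then have "((\<lambda>t. \<Sum>i\<in>UNIV. x $ i * partial_deriv i f (t *\<^sub>R x)) has_integral (\<Sum>i\<in>UNIV. x $ i * g i x)) {0..1}"
      unfolding g_def by (intro has_integral_sum has_integral_mult_right) (auto intro: integrable_integral)
    ultimately have "f x - f 0 = (\<Sum>i\<in>UNIV. x $ i * g i x)" by (rule has_integral_unique)
    then show ?thesis by simp
  qed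
  have "\<forall>\<^sub>F x in nhds 0. x \<in> ?B"
    by (rule eventually_nhds_in_open) (use r(1) in auto)
  then have "\<forall>\<^sub>F x in nhds 0. f x = f 0 + (\<Sum>i\<in>UNIV. x $ i * g i x)"
    by (rule eventually_mono) (rule expand)
  with \<open>\<And>i. smooth_germ (g i)\<close> show ?thesis by (rule that)
qed

section \<open>Powers of the maximal ideal\<close>

lemma smooth_germ_cong:
  assumes "smooth_germ f" "\<forall>\<^sub>F x in nhds 0. f x = g x"
  shows "smooth_germ g"
proof -
  from assms(1) obtain U where U: "open U" "0 \<in> U" "\<And>k. Ck_on k f U"
    unfolding smooth_germ_def by blast
  from assms(2) obtain V where V: "open V" "0 \<in> V" "\<forall>x\<in>V. f x = g x"
    unfolding eventually_nhds by blast
  have "Ck_on k g (U \<inter> V)" for k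
    by (rule Ck_on_cong[of _ f]) (use U V Ck_on_subset[of "U \<inter> V" U] in auto)
  with U V show ?thesis unfolding smooth_germ_def by (intro exI[of _ "U \<inter> V"]) auto
qed

lemma smooth_germ_uminus: "smooth_germ f \<Longrightarrow> smooth_germ (\<lambda>x. - f x)"
  using smooth_germ_mult[OF smooth_germ_const[of "-1"], of f] by simp

lemma smooth_germ_diff: "smooth_germ f \<Longrightarrow> smooth_germ g \<Longrightarrow> smooth_germ (\<lambda>x. f x - g x)"
  using smooth_germ_add[OF _ smooth_germ_uminus, of f g] by simp

lemma smooth_germ_sum: "(\<And>i. i \<in> A \<Longrightarrow> smooth_germ (f i)) \<Longrightarrow> smooth_germ (\<lambda>x. \<Sum>i\<in>A. f i x)"
  by (induction A rule: infinite_finite_induct) (simp_all add: smooth_germ_const smooth_germ_add)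

lemma smooth_germ_coord: "smooth_germ (\<lambda>x. x $ i)"
  using smooth_germ_mpeval[of "mp_var i"] by (simp add: mpeval_mp_var[abs_def])

lemma smooth_germ_partial_deriv: "smooth_germ f \<Longrightarrow> smooth_germ (partial_deriv i f)"
  unfolding smooth_germ_def by (metis Ck_on.simps(2))

lemma smooth_germ_eventually_differentiable:
  assumes "smooth_germ f" shows "\<forall>\<^sub>F x in nhds 0. f differentiable (at x)"
proof -
  from assms obtain U where "open U" "0 \<in> U" "Ck_on (Suc 0) f U"
    unfolding smooth_germ_def by blast
  then show ?thesis by (auto simp: eventually_nhds)
qed

lemma eventually_partial_deriv_cong:
  assumes "\<forall>\<^sub>F x in nhds 0. f x = g x"
  shows "\<forall>\<^sub>F x in nhds 0. partial_deriv i f x = partial_deriv i g x"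
proof -
  have eq: "frechet_derivative f (at x) = frechet_derivative g (at x)"
    if "\<forall>\<^sub>F y in nhds x. f y = g y" for x
  proof -
    have ev: "\<forall>\<^sub>F y in at x. f y = g y" and ev': "\<forall>\<^sub>F y in at x. g y = f y"
      unfolding eventually_at_filter using that by (auto elim: eventually_mono)
    have "f x = g x" using that by (rule eventually_nhds_x_imp_x)
    then have "(f has_derivative D) (at x) \<longleftrightarrow> (g has_derivative D) (at x)" for D
      using has_derivative_transform_eventually[OF _ ev] has_derivative_transform_eventually[OF _ ev']
      by auto
    then show ?thesis by (simp add: frechet_derivative_def)
  qed
  from assms have "\<forall>\<^sub>F x in nhds 0. \<forall>\<^sub>F y in nhds x. f y = g y"
    by (simp add: eventually_eventually)
  then show ?thesis by eventually_elim (simp add: partial_deriv_def eq)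
qed

text \<open>The partial derivatives are minus the squared inverse times those of \<open>f\<close>,
  so class C^k of the inverse yields class C^(k+1), on one fixed neighbourhood for all
  \<open>k\<close>.\<close>

lemma smooth_germ_inverse:
  assumes "smooth_germ f" "f 0 \<noteq> 0" shows "smooth_germ (\<lambda>x. inverse (f x))"
proof -
  from assms obtain U where U: "open U" "0 \<in> U" "\<And>k. Ck_on k f U"
    unfolding smooth_germ_def by blast
  define V where "V = U \<inter> f -` (- {0})"
  have V: "open V" "0 \<in> V" "\<And>x. x \<in> V \<Longrightarrow> f x \<noteq> 0"
    using U assms(2) Ck_on_imp_continuous_on[OF U(1) U(3)[of 0]]
    by (auto simp: V_def intro: continuous_open_preimage)
  have f: "Ck_on k f V" for k using Ck_on_subset[OF _ U(3), of V] by (auto simp: V_def)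
  have "Ck_on k (\<lambda>x. inverse (f x)) V" for k
  proof (induction k)
    case 0
    then show ?case
      using Ck_on_imp_continuous_on[OF V(1) f[of 0]] V(3) by (auto intro: continuous_on_inverse)
  next
    case (Suc k)
    have d: "f differentiable (at x)" if "x \<in> V" for x using f[of "Suc 0"] that by auto
    have der: "((\<lambda>x. inverse (f x)) has_derivative
        (\<lambda>h. - (inverse (f x) * frechet_derivative f (at x) h * inverse (f x)))) (at x)" if "x \<in> V" for x
      using V(3)[OF that] d[OF that, unfolded frechet_derivative_works]
      by (rule Deriv.has_derivative_inverse)
    have "Ck_on k (partial_deriv i (\<lambda>x. inverse (f x))) V" for i
    proof (rule Ck_on_cong[OF V(1)])
      show "Ck_on k (\<lambda>x. (-1) * (inverse (f x) * partial_deriv i f x * inverse (f x))) V"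
        using f[of "Suc k"] by (intro Ck_on_mult Ck_on_const V(1) Suc.IH) auto
      fix x assume "x \<in> V"
      from frechet_derivative_at[OF der[OF this], symmetric]
      show "(-1) * (inverse (f x) * partial_deriv i f x * inverse (f x)) = partial_deriv i (\<lambda>x. inverse (f x)) x"
        by (simp add: partial_deriv_def)
    qed
    then show ?case using der by (auto simp: differentiable_def)
  qed
  with V show ?thesis unfolding smooth_germ_def by blast
qed

text \<open>\<open>vorder s\<close> is the \<open>s\<close>-th power of the maximal ideal of the ring of germs.\<close>

primrec vorder :: "nat \<Rightarrow> (real^'n::finite \<Rightarrow> real) set" where
  "vorder 0 = {h. smooth_germ h}"
| "vorder (Suc s) = {h. smooth_germ h \<and>
     (\<exists>g. (\<forall>i. g i \<in> vorder s) \<and> (\<forall>\<^sub>F x in nhds 0. h x = (\<Sum>i\<in>UNIV. x $ i * g i x)))}"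

declare vorder.simps(2) [simp del]

lemma vorder_SucI:
  assumes "smooth_germ h" "\<And>i. g i \<in> vorder s" "\<forall>\<^sub>F x in nhds 0. h x = (\<Sum>i\<in>UNIV. x $ i * g i x)"
  shows "h \<in> vorder (Suc s)"
  using assms unfolding vorder.simps(2) by blast

lemma vorder_SucE:
  assumes "h \<in> vorder (Suc s)"
  obtains g where "\<And>i. g i \<in> vorder s" "\<forall>\<^sub>F x in nhds 0. h x = (\<Sum>i\<in>UNIV. x $ i * g i x)"
  using assms unfolding vorder.simps(2) by blast

lemma vorder_smooth: "h \<in> vorder s \<Longrightarrow> smooth_germ h"
  by (cases s) (auto simp: vorder.simps(2))

lemma vorder_cong: "h \<in> vorder s \<Longrightarrow> \<forall>\<^sub>F x in nhds 0. h x = k x \<Longrightarrow> k \<in> vorder s"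
proof (cases s)
  case 0
  then show "h \<in> vorder s \<Longrightarrow> \<forall>\<^sub>F x in nhds 0. h x = k x \<Longrightarrow> k \<in> vorder s"
    by (auto intro: smooth_germ_cong)
next
  case (Suc r)
  assume h: "h \<in> vorder s" and eq: "\<forall>\<^sub>F x in nhds 0. h x = k x"
  from h[unfolded Suc] obtain g where g: "\<And>i. g i \<in> vorder r" "\<forall>\<^sub>F x in nhds 0. h x = (\<Sum>i\<in>UNIV. x $ i * g i x)"
    by (rule vorder_SucE) (rule that)
  from g(2) eq have "\<forall>\<^sub>F x in nhds 0. k x = (\<Sum>i\<in>UNIV. x $ i * g i x)"
    by eventually_elim simp
  moreover have "smooth_germ k" using smooth_germ_cong[OF vorder_smooth[OF h] eq] .
  ultimately show "k \<in> vorder s" using g(1) Suc by (auto intro: vorder_SucI)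
qed

lemma vorder_add: "a \<in> vorder s \<Longrightarrow> b \<in> vorder s \<Longrightarrow> (\<lambda>x. a x + b x) \<in> vorder s"
proof (induction s arbitrary: a b)
  case (Suc s)
  from Suc.prems(1) obtain g where g: "\<And>i. g i \<in> vorder s" "\<forall>\<^sub>F x in nhds 0. a x = (\<Sum>i\<in>UNIV. x $ i * g i x)"
    by (rule vorder_SucE) (rule that)
  from Suc.prems(2) obtain h where h: "\<And>i. h i \<in> vorder s" "\<forall>\<^sub>F x in nhds 0. b x = (\<Sum>i\<in>UNIV. x $ i * h i x)"
    by (rule vorder_SucE) (rule that)
  from g(2) h(2) have "\<forall>\<^sub>F x in nhds 0. a x + b x = (\<Sum>i\<in>UNIV. x $ i * (g i x + h i x))"
    by eventually_elim (simp add: distrib_left sum.distrib)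
  then show ?case
    by (intro vorder_SucI[where g="\<lambda>i x. g i x + h i x"] smooth_germ_add Suc.IH g h
        vorder_smooth[OF Suc.prems(1)] vorder_smooth[OF Suc.prems(2)])
qed (simp add: smooth_germ_add)

lemma vorder_zero [simp]: "(\<lambda>x. 0) \<in> vorder s"
proof (induction s)
  case (Suc s)
  then show ?case by (intro vorder_SucI[where g="\<lambda>i x. 0"] smooth_germ_const) auto
qed (simp add: smooth_germ_const)

lemma vorder_sum: "(\<And>i. i \<in> A \<Longrightarrow> f i \<in> vorder s) \<Longrightarrow> (\<lambda>x. \<Sum>i\<in>A. f i x) \<in> vorder s"
  by (induction A rule: infinite_finite_induct) (simp_all add: vorder_add)

lemma vorder_mult: "a \<in> vorder r \<Longrightarrow> b \<in> vorder s \<Longrightarrow> (\<lambda>x. a x * b x) \<in> vorder (r + s)"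
proof (induction r arbitrary: a)
  case 0
  then have "smooth_germ a" by simp
  from 0(2) this show ?case
  proof (induction s arbitrary: b)
    case (Suc s)
    from Suc.prems(1) obtain g where g: "\<And>i. g i \<in> vorder s" "\<forall>\<^sub>F x in nhds 0. b x = (\<Sum>i\<in>UNIV. x $ i * g i x)"
      by (rule vorder_SucE) (rule that)
    from g(2) have "\<forall>\<^sub>F x in nhds 0. a x * b x = (\<Sum>i\<in>UNIV. x $ i * (a x * g i x))"
      by eventually_elim (simp add: sum_distrib_left mult.left_commute)
    moreover have "(\<lambda>x. a x * g i x) \<in> vorder s" for i using Suc.IH[OF g(1) Suc.prems(2)] by simp
    ultimately have "(\<lambda>x. a x * b x) \<in> vorder (Suc s)"
      by (intro vorder_SucI[where g="\<lambda>i x. a x * g i x"] smooth_germ_mult Suc.prems(2) vorder_smooth[OF Suc.prems(1)])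
    then show ?case by simp
  qed (simp add: smooth_germ_mult)
next
  case (Suc r)
  from Suc.prems(1) obtain g where g: "\<And>i. g i \<in> vorder r" "\<forall>\<^sub>F x in nhds 0. a x = (\<Sum>i\<in>UNIV. x $ i * g i x)"
    by (rule vorder_SucE) (rule that)
  from g(2) have "\<forall>\<^sub>F x in nhds 0. a x * b x = (\<Sum>i\<in>UNIV. x $ i * (g i x * b x))"
    by eventually_elim (simp add: sum_distrib_right mult.assoc)
  then have "(\<lambda>x. a x * b x) \<in> vorder (Suc (r + s))"
    by (intro vorder_SucI[where g="\<lambda>i x. g i x * b x"] smooth_germ_mult Suc.IH g(1)
        Suc.prems(2) vorder_smooth[OF Suc.prems(1)] vorder_smooth[OF Suc.prems(2)])
  then show ?case by simp
qed

lemma vorder_smooth_mult: "smooth_germ a \<Longrightarrow> b \<in> vorder s \<Longrightarrow> (\<lambda>x. a x * b x) \<in> vorder s"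
  using vorder_mult[of a 0 b s] by simp

lemma vorder_uminus: "a \<in> vorder s \<Longrightarrow> (\<lambda>x. - a x) \<in> vorder s"
  using vorder_smooth_mult[OF smooth_germ_const[of "-1"], of a s] by simp

lemma vorder_diff: "a \<in> vorder s \<Longrightarrow> b \<in> vorder s \<Longrightarrow> (\<lambda>x. a x - b x) \<in> vorder s"
  using vorder_add[OF _ vorder_uminus, of a s b] by simp

lemma vorder_Suc: "h \<in> vorder (Suc s) \<Longrightarrow> h \<in> vorder s"
proof (induction s arbitrary: h)
  case (Suc s)
  from Suc.prems obtain g where g: "\<And>i. g i \<in> vorder (Suc s)" "\<forall>\<^sub>F x in nhds 0. h x = (\<Sum>i\<in>UNIV. x $ i * g i x)"
    by (rule vorder_SucE) (rule that)
  show ?case by (rule vorder_SucI[OF vorder_smooth[OF Suc.prems] Suc.IH[OF g(1)] g(2)])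
qed (auto dest: vorder_smooth)

lemma vorder_mono: "h \<in> vorder s \<Longrightarrow> r \<le> s \<Longrightarrow> h \<in> vorder r"
  by (induction s) (auto simp: le_Suc_eq dest: vorder_Suc)

lemma vorder_coord: "(\<lambda>x :: real^'n::finite. x $ i) \<in> vorder (Suc 0)"
proof -
  have "(\<Sum>j\<in>UNIV. x $ j * (if j = i then 1 else 0)) = x $ i" for x :: "real^'n"
    by (simp add: if_distrib cong: if_cong)
  then show ?thesis
    by (intro vorder_SucI[where g="\<lambda>j x. if j = i then 1 else 0"])
       (auto simp: smooth_germ_coord smooth_germ_const)
qed

lemma vorder_mpeval_single: "mpeval (Poly_Mapping.single \<alpha> c) \<in> vorder (total_degree \<alpha>)"
proof (induction "total_degree \<alpha>" arbitrary: \<alpha>)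
  case 0
  then show ?case by (simp add: smooth_germ_mpeval)
next
  case (Suc s)
  then obtain i where i: "lookup \<alpha> i \<noteq> 0" by (metis total_degree_def nat.distinct(1) sum.neutral)
  define \<beta> where "\<beta> = \<alpha> - Poly_Mapping.single i 1"
  have \<alpha>: "\<alpha> = Poly_Mapping.single i 1 + \<beta>" using single_diff_add[OF i] by (simp add: \<beta>_def add.commute)
  with Suc(2) have "s = total_degree \<beta>" by (simp add: total_degree_add)
  from vorder_mult[OF vorder_coord Suc(1)[OF this], of i]
  have "(\<lambda>x. x $ i * mpeval (Poly_Mapping.single \<beta> c) x) \<in> vorder (total_degree \<alpha>)"
    using Suc(2) \<open>s = total_degree \<beta>\<close> by (metis plus_1_eq_Suc One_nat_def)
  moreover have "x $ i * mpeval (Poly_Mapping.single \<beta> c) x = mpeval (Poly_Mapping.single \<alpha> c) x" for x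
  proof -
    have "Poly_Mapping.single \<alpha> c = mp_var i * Poly_Mapping.single \<beta> c"
      by (simp add: mp_var_def mult_single \<alpha>)
    then show ?thesis by (simp add: mpeval_mult)
  qed
  ultimately show ?case by simp
qed

lemma vorder_mpeval: "p \<in> ord_ge s \<Longrightarrow> mpeval p \<in> vorder s"
proof -
  assume p: "p \<in> ord_ge s"
  have "(\<lambda>x. \<Sum>\<alpha>\<in>keys p. mpeval (Poly_Mapping.single \<alpha> (lookup p \<alpha>)) x) \<in> vorder s"
    by (rule vorder_sum) (use p vorder_mono[OF vorder_mpeval_single] in \<open>auto simp: ord_ge_def\<close>)
  then show ?thesis by (simp add: mpeval_sum[symmetric] sum_single_keys)
qed

text \<open>The product rule on a sum of \<open>x $ j * g j x\<close> gives \<open>g i\<close> plus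
  coordinates times derivatives of the \<open>g j\<close>. The order lost by differentiating
  \<open>g j\<close> is regained from the coordinate.\<close>

lemma vorder_partial_deriv: "h \<in> vorder (Suc s) \<Longrightarrow> partial_deriv i h \<in> vorder s"
proof (induction s arbitrary: h)
  case 0
  then show ?case by (simp add: smooth_germ_partial_deriv vorder_smooth)
next
  case (Suc s)
  from Suc.prems obtain g where g: "\<And>j. g j \<in> vorder (Suc s)"
    "\<forall>\<^sub>F x in nhds 0. h x = (\<Sum>j\<in>UNIV. x $ j * g j x)"
    by (rule vorder_SucE) (rule that)
  have d: "\<forall>\<^sub>F x in nhds 0. \<forall>j. g j differentiable (at x)"
    by (intro eventually_all_finite smooth_germ_eventually_differentiable vorder_smooth[OF g(1)])
  have "\<forall>\<^sub>F x in nhds 0. partial_deriv i (\<lambda>x. \<Sum>j\<in>UNIV. x $ j * g j x) x =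
      g i x + (\<Sum>j\<in>UNIV. x $ j * partial_deriv i (g j) x)"
    using d
  proof eventually_elim
    case (elim x)
    have "((\<lambda>x. \<Sum>j\<in>UNIV. x $ j * g j x) has_derivative
        (\<lambda>v. \<Sum>j\<in>UNIV. x $ j * frechet_derivative (g j) (at x) v + v $ j * g j x)) (at x)"
      using elim by (intro has_derivative_sum has_derivative_mult
          bounded_linear.has_derivative[OF bounded_linear_vec_nth has_derivative_ident])
        (auto simp: frechet_derivative_works)
    from frechet_derivative_at[OF this, symmetric] show ?case
      using axis_nth_if[of i "\<lambda>j. g j x"]
      by (simp add: partial_deriv_def sum.distrib)
  qed
  with eventually_partial_deriv_cong[OF g(2), of i]
  have "\<forall>\<^sub>F x in nhds 0. g i x + (\<Sum>j\<in>UNIV. x $ j * partial_deriv i (g j) x) = partial_deriv i h x"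
    by eventually_elim simp
  moreover have "(\<lambda>x. g i x + (\<Sum>j\<in>UNIV. x $ j * partial_deriv i (g j) x)) \<in> vorder (Suc s)"
    using vorder_mult[OF vorder_coord Suc.IH[OF g(1)]] g(1)
    by (intro vorder_add vorder_sum) auto
  ultimately show ?case by (rule vorder_cong[rotated])
qed

lemma vorder_Suc_at_0: "h \<in> vorder (Suc s) \<Longrightarrow> h 0 = 0"
  by (erule vorder_SucE) (drule eventually_nhds_x_imp_x, simp)

lemma hadamard_vorder: "smooth_germ f \<Longrightarrow> (\<lambda>x. f x - f 0) \<in> vorder (Suc 0)"
proof -
  assume f: "smooth_germ f"
  then obtain g where g: "\<And>i. smooth_germ (g i)" "\<forall>\<^sub>F x in nhds 0. f x = f 0 + (\<Sum>i\<in>UNIV. x $ i * g i x)"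
    by (rule hadamard_lemma) (rule that)
  from g(2) have "\<forall>\<^sub>F x in nhds 0. f x - f 0 = (\<Sum>i\<in>UNIV. x $ i * g i x)"
    by (rule eventually_mono) (simp only: add_diff_cancel_left')
  then show ?thesis
    by (intro vorder_SucI smooth_germ_diff f smooth_germ_const) (simp_all add: g(1))
qed

lemma mp_var_ord_ge: "mp_var i \<in> ord_ge (Suc 0)"
  by (simp add: ord_ge_def mp_var_def)

text \<open>Hadamard's lemma settles order zero; in higher order it is applied to the coefficients
  of the coordinates, and the leading parts are reassembled.\<close>

lemma vorder_leading_part:
  "h \<in> vorder s \<Longrightarrow> \<exists>q. q \<in> ord_ge s \<and> (\<lambda>x. h x - mpeval q x) \<in> vorder (Suc s)"
proof (induction s arbitrary: h)
  case 0
  then show ?case using hadamard_vorder[of h] by (intro exI[of _ "mp_const (h 0)"]) simp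
next
  case (Suc s)
  from Suc.prems obtain g where g: "\<And>i. g i \<in> vorder s" "\<forall>\<^sub>F x in nhds 0. h x = (\<Sum>i\<in>UNIV. x $ i * g i x)"
    by (rule vorder_SucE) (rule that)
  from Suc.IH[OF g(1)] obtain q where q: "\<And>i. q i \<in> ord_ge s" "\<And>i. (\<lambda>x. g i x - mpeval (q i) x) \<in> vorder (Suc s)"
    by metis
  let ?q = "\<Sum>i\<in>UNIV. mp_var i * q i"
  have "?q \<in> ord_ge (Suc s)"
    using ord_ge_mult[OF mp_var_ord_ge q(1)] by (intro ord_ge_sum) simp
  moreover have "(\<lambda>x. \<Sum>i\<in>UNIV. x $ i * (g i x - mpeval (q i) x)) \<in> vorder (Suc (Suc s))"
    using vorder_mult[OF vorder_coord q(2)] by (intro vorder_sum) simp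
  then have "(\<lambda>x. h x - mpeval ?q x) \<in> vorder (Suc (Suc s))"
  proof (rule vorder_cong)
    from g(2) show "\<forall>\<^sub>F x in nhds 0. (\<Sum>i\<in>UNIV. x $ i * (g i x - mpeval (q i) x)) = h x - mpeval ?q x"
    by eventually_elim (simp add: mpeval_sum mpeval_mult right_diff_distrib sum_subtractf)
  qed
  ultimately show ?case by blast
qed

text \<open>Leading parts are added one order at a time. Only the congruence is recorded; the terms
  of \<open>p\<close> of degree \<open>s\<close> or more are left open.\<close>

lemma smooth_germ_taylor:
  assumes "smooth_germ f"
  obtains p where "(\<lambda>x. f x - mpeval p x) \<in> vorder s"
proof -
  have "\<exists>p. (\<lambda>x. f x - mpeval p x) \<in> vorder s"
  proof (induction s)
    case 0
    then show ?case using assms by (intro exI[of _ 0]) simp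
  next
    case (Suc s)
    then obtain p where "(\<lambda>x. f x - mpeval p x) \<in> vorder s" ..
    from vorder_leading_part[OF this] obtain q where "(\<lambda>x. f x - mpeval p x - mpeval q x) \<in> vorder (Suc s)" by blast
    then show ?case by (intro exI[of _ "p + q"]) (simp add: mpeval_add diff_diff_eq)
  qed
  with that show ?thesis by blast
qed

lemma mpeval_0: "mpeval p 0 = lookup p 0"
proof (induction p rule: poly_mapping_additive_induct)
  case (single \<alpha> c)
  have "(\<Prod>i\<in>UNIV. (0::real) ^ lookup \<alpha> i) = (if \<alpha> = 0 then 1 else 0)"
    by (auto simp: power_0_left poly_mapping_eq_iff fun_eq_iff)
  then show ?case by (simp add: mpeval_single lookup_single when_def)
qed (simp_all add: mpeval_add lookup_add)

text \<open>The passage from germs to polynomials: a congruence of polynomial functions modulo a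
  power of the maximal ideal is a congruence of coefficients. Differentiation lowers both orders by
  one, and the factor it puts on a coefficient is nonzero.\<close>

lemma mpeval_vorder_iff: "mpeval p \<in> vorder s \<longleftrightarrow> p \<in> ord_ge s"
proof
  show "mpeval p \<in> vorder s \<Longrightarrow> p \<in> ord_ge s"
  proof (induction s arbitrary: p)
    case (Suc s)
    show ?case
      unfolding ord_ge_lookup
    proof (intro allI impI)
      fix \<alpha> :: "'a \<Rightarrow>\<^sub>0 nat" assume \<alpha>: "total_degree \<alpha> < Suc s"
      show "lookup p \<alpha> = 0"
      proof (cases "\<alpha> = 0")
        case True
        then show ?thesis using vorder_Suc_at_0[OF Suc.prems] by (simp add: mpeval_0)
      next
        case False
        then obtain i where i: "lookup \<alpha> i \<noteq> 0" by (auto simp: poly_mapping_eq_iff fun_eq_iff)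
        define \<beta> where "\<beta> = \<alpha> - Poly_Mapping.single i 1"
        have \<beta>: "\<alpha> = \<beta> + Poly_Mapping.single i 1" using single_diff_add[OF i] by (simp add: \<beta>_def)
        have "mp_deriv i p \<in> ord_ge s"
          using vorder_partial_deriv[OF Suc.prems, of i] by (intro Suc.IH) (simp add: partial_deriv_mpeval)
        moreover have "total_degree \<beta> < s" using \<alpha> by (simp add: \<beta> total_degree_add)
        ultimately have "lookup (mp_deriv i p) \<beta> = 0" by (simp add: ord_ge_lookup)
        then show ?thesis by (simp add: lookup_mp_deriv \<beta>)
      qed
    qed
  qed simp
qed (rule vorder_mpeval)

lemma mpeval_eq_iff: "mpeval p = mpeval q \<longleftrightarrow> p = q"
proof
  assume "mpeval p = mpeval q"
  then have "mpeval (p - q) = (\<lambda>x. 0)" by (simp add: mpeval_diff fun_eq_iff)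
  then have "p - q \<in> ord_ge s" for s by (metis mpeval_vorder_iff vorder_zero)
  then have "lookup (p - q) \<alpha> = 0" for \<alpha> by (metis ord_ge_lookup lessI)
  then show "p = q" by (intro poly_mapping_eqI) (simp add: lookup_minus)
qed simp

text \<open>Algebraic order is turned into a growth rate here, which is the form in which a
  lipeomorphism can act on it.\<close>

lemma vorder_bound:
  assumes "h \<in> vorder s"
  obtains C where "0 < C" "\<forall>\<^sub>F x in nhds 0. \<bar>h x\<bar> \<le> C * norm x ^ s"
proof -
  have "\<exists>C>0. \<forall>\<^sub>F x in nhds 0. \<bar>h x\<bar> \<le> C * norm x ^ s"
    using assms
  proof (induction s arbitrary: h)
    case 0
    then have "smooth_germ h" by simp
    then obtain U where "open U" "0 \<in> U" "Ck_on 0 h U" unfolding smooth_germ_def by blast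
    then have "isCont h 0" by (simp add: continuous_on_eq_continuous_at)
    then have "\<forall>\<^sub>F x in nhds 0. dist (h x) (h 0) < 1"
      unfolding continuous_at_eps_delta eventually_nhds_metric by (simp add: dist_commute)
    then have "\<forall>\<^sub>F x in nhds 0. \<bar>h x\<bar> \<le> (\<bar>h 0\<bar> + 1) * norm x ^ 0"
      by eventually_elim (simp add: dist_real_def)
    then show ?case by (intro exI[of _ "\<bar>h 0\<bar> + 1"]) auto
  next
    case (Suc s)
    from Suc.prems obtain g where g: "\<And>i. g i \<in> vorder s" "\<forall>\<^sub>F x in nhds 0. h x = (\<Sum>i\<in>UNIV. x $ i * g i x)"
      by (rule vorder_SucE) (rule that)
    from Suc.IH[OF g(1)] obtain C where C: "\<And>i. C i > 0" "\<And>i. \<forall>\<^sub>F x in nhds 0. \<bar>g i x\<bar> \<le> C i * norm x ^ s"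
      by metis
    have "\<forall>\<^sub>F x in nhds 0. \<forall>i. \<bar>g i x\<bar> \<le> C i * norm x ^ s"
      by (intro eventually_all_finite C(2))
    with g(2) have "\<forall>\<^sub>F x in nhds 0. \<bar>h x\<bar> \<le> (\<Sum>i\<in>UNIV. C i) * norm x ^ Suc s"
    proof eventually_elim
      case (elim x)
      have "\<bar>h x\<bar> \<le> (\<Sum>i\<in>UNIV. \<bar>x $ i * g i x\<bar>)" unfolding elim(1) by (rule sum_abs)
      also have "\<dots> \<le> (\<Sum>i\<in>UNIV. norm x * (C i * norm x ^ s))"
        using elim(2) by (intro sum_mono) (auto simp: abs_mult intro!: mult_mono component_le_norm_cart)
      finally show ?case by (simp add: sum_distrib_left sum_distrib_right mult_ac)
    qed
    moreover have "(\<Sum>i\<in>UNIV. C i) > 0" using C(1) by (intro sum_pos) auto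
    ultimately show ?case by blast
  qed
  with that show ?thesis by blast
qed

section \<open>Taylor components and Nakayama's lemma\<close>

lemma taylor_component_0: "taylor_component 0 f x = f 0"
  by (simp add: taylor_component_def)

text \<open>The last index of a tuple is split off, because \<open>foldr\<close> applies that
  derivative to \<open>f\<close> first. The quotient of the factorials gives the
  denominator.\<close>

lemma taylor_component_Suc:
  "taylor_component (Suc k) f x =
     (\<Sum>i\<in>UNIV. x $ i * taylor_component k (partial_deriv i f) x) / real (Suc k)"
proof -
  let ?L = "{is :: 'a list. length is = k}"
  have im: "{is :: 'a list. length is = Suc k} = (\<lambda>(is, i). is @ [i]) ` (?L \<times> UNIV)"
    by (auto simp: length_Suc_conv_rev image_iff)
  have inj: "inj_on (\<lambda>(is, i). is @ [i]) (?L \<times> UNIV)"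
    by (auto simp: inj_on_def)
  let ?s = "\<lambda>is i. x $ i * (foldr partial_deriv is (partial_deriv i f) 0 * (\<Prod>i\<leftarrow>is. x $ i))"
  have "(\<Sum>is | length is = Suc k. foldr partial_deriv is f 0 * (\<Prod>i\<leftarrow>is. x $ i)) =
      (\<Sum>(is, i)\<in>?L \<times> UNIV. ?s is i)"
    unfolding im sum.reindex[OF inj] by (rule sum.cong) (auto simp: mult_ac)
  also have "\<dots> = (\<Sum>i\<in>UNIV. \<Sum>is\<in>?L. ?s is i)"
    unfolding sum.cartesian_product[symmetric] by (rule sum.swap)
  finally show ?thesis
    by (simp add: taylor_component_def sum_distrib_left[symmetric] sum_divide_distrib[symmetric] mult.commute)
qed

lemma taylor_component_cong:
  "\<forall>\<^sub>F x in nhds 0. f x = g x \<Longrightarrow> taylor_component k f x = taylor_component k g x"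
proof (induction k arbitrary: f g)
  case 0
  from eventually_nhds_x_imp_x[OF this] show ?case by (simp add: taylor_component_0)
next
  case (Suc k)
  then show ?case
    by (simp add: taylor_component_Suc Suc.IH[OF eventually_partial_deriv_cong])
qed

lemma taylor_component_add:
  "smooth_germ f \<Longrightarrow> smooth_germ g \<Longrightarrow>
    taylor_component k (\<lambda>x. f x + g x) x = taylor_component k f x + taylor_component k g x"
proof (induction k arbitrary: f g)
  case (Suc k)
  have "\<forall>\<^sub>F x in nhds 0. partial_deriv i (\<lambda>x. f x + g x) x = partial_deriv i f x + partial_deriv i g x" for i
    using smooth_germ_eventually_differentiable[OF Suc.prems(1)]
      smooth_germ_eventually_differentiable[OF Suc.prems(2)]
    by eventually_elim (rule partial_deriv_add)
  then have "taylor_component k (partial_deriv i (\<lambda>x. f x + g x)) x =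
      taylor_component k (\<lambda>x. partial_deriv i f x + partial_deriv i g x) x" for i
    by (rule taylor_component_cong)
  also have "\<dots> i = taylor_component k (partial_deriv i f) x + taylor_component k (partial_deriv i g) x" for i
    by (intro Suc.IH smooth_germ_partial_deriv Suc.prems)
  finally show ?case
    by (simp add: taylor_component_Suc distrib_left sum.distrib add_divide_distrib)
qed (simp add: taylor_component_0)

lemma taylor_component_vorder: "h \<in> vorder s \<Longrightarrow> k < s \<Longrightarrow> taylor_component k h x = 0"
proof (induction k arbitrary: h s)
  case 0
  then show ?case by (cases s) (auto simp: taylor_component_0 vorder_Suc_at_0)
next
  case (Suc k)
  then obtain r where "s = Suc r" "k < r" by (cases s) auto
  with Suc show ?case by (simp add: taylor_component_Suc Suc.IH[OF vorder_partial_deriv])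
qed

lemma total_degree_eq_0_iff: "total_degree \<alpha> = 0 \<longleftrightarrow> \<alpha> = 0"
  by (auto simp: total_degree_def poly_mapping_eq_iff fun_eq_iff)

text \<open>The recursion for Taylor components is Euler's relation divided by the degree, so for
  polynomials it returns the homogeneous components.\<close>

lemma taylor_component_mpeval: "taylor_component k (mpeval p) x = mpeval (hpart k p) x"
proof (induction k arbitrary: p)
  case 0
  have "hpart 0 p = mp_const (lookup p 0)"
    by (rule poly_mapping_eqI) (auto simp: lookup_restrict_keys total_degree_eq_0_iff mp_const_def lookup_single when_def)
  then show ?case by (simp add: taylor_component_0 mpeval_0)
next
  case (Suc k)
  have "(\<Sum>i\<in>UNIV. x $ i * taylor_component k (partial_deriv i (mpeval p)) x) =
      mpeval (\<Sum>i\<in>UNIV. mp_var i * mp_deriv i (hpart (Suc k) p)) x"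
    by (simp add: partial_deriv_mpeval Suc.IH mpeval_sum mpeval_mult mp_deriv_hpart)
  also have "\<dots> = real (Suc k) * mpeval (hpart (Suc k) p) x"
    by (simp only: euler_homog[OF homog_hpart] mpeval_mult mpeval_mp_const)
  finally show ?case by (simp add: taylor_component_Suc)
qed

text \<open>A Taylor polynomial modulo order \<open>Suc k\<close> has the Taylor components of
  \<open>f\<close> as its homogeneous parts up to degree \<open>k\<close>; those below the least
  nonvanishing one are zero.\<close>

lemma initial_part_expansion:
  fixes f :: "real^'n::finite \<Rightarrow> real"
  assumes "smooth_germ f" "has_initial_part f"
  obtains k P where "homog k P" "P \<noteq> 0" "initial_part f = mpeval P"
    "(\<lambda>x. f x - mpeval P x) \<in> vorder (Suc k)"
proof -
  define k where "k = (LEAST k. taylor_component k f \<noteq> (\<lambda>x. 0))"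
  have k: "taylor_component k f \<noteq> (\<lambda>x. 0)"
    using assms(2) unfolding has_initial_part_def k_def by (rule LeastI_ex)
  have less: "taylor_component r f = (\<lambda>x. 0)" if "r < k" for r
    using not_less_Least[of r] that unfolding k_def by blast
  obtain p where p: "(\<lambda>x. f x - mpeval p x) \<in> vorder (Suc k)"
    using smooth_germ_taylor[OF assms(1)] by blast
  have tc: "taylor_component r f = mpeval (hpart r p)" if "r \<le> k" for r
  proof
    fix x
    have "taylor_component r f x = taylor_component r (\<lambda>x. (f x - mpeval p x) + mpeval p x) x"
      by simp
    also have "\<dots> = taylor_component r (\<lambda>x. f x - mpeval p x) x + taylor_component r (mpeval p) x"
      by (rule taylor_component_add[OF vorder_smooth[OF p] smooth_germ_mpeval])
    also have "\<dots> = mpeval (hpart r p) x"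
      using that by (simp add: taylor_component_vorder[OF p] taylor_component_mpeval)
    finally show "taylor_component r f x = mpeval (hpart r p) x" .
  qed
  have z: "hpart r p = 0" if "r < k" for r
  proof -
    have "mpeval (hpart r p) = mpeval 0" using tc[of r] less[OF that] that by (simp add: fun_eq_iff)
    then show ?thesis by (simp only: mpeval_eq_iff)
  qed
  show ?thesis
  proof (rule that[OF homog_hpart])
    show "hpart k p \<noteq> 0" using tc[of k] k by auto
    show "initial_part f = mpeval (hpart k p)"
      using tc[of k] by (simp add: initial_part_def k_def)
    have "p \<in> ord_ge k"
      unfolding ord_ge_lookup
    proof (intro allI impI)
      fix \<alpha> :: "'n \<Rightarrow>\<^sub>0 nat" assume "total_degree \<alpha> < k"
      from z[OF this] have "lookup (hpart (total_degree \<alpha>) p) \<alpha> = 0" by simp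
      then show "lookup p \<alpha> = 0" by (simp add: lookup_restrict_keys)
    qed
    then have "mpeval (p - hpart k p) \<in> vorder (Suc k)"
      by (intro vorder_mpeval diff_hpart_ord_ge)
    from vorder_add[OF p this] show "(\<lambda>x. f x - mpeval (hpart k p) x) \<in> vorder (Suc k)"
      by (simp add: mpeval_diff)
  qed
qed

text \<open>On a ray \<open>t *\<^sub>R v\<close> the leading form is \<open>t ^ k\<close> times a
  constant. If \<open>m\<close> exceeded \<open>k\<close>, the bound and the remainder would both be
  of order \<open>t ^ Suc k\<close>, and letting \<open>t\<close> tend to 0 would make
  \<open>P\<close> vanish everywhere.\<close>

lemma order_le_of_bound:
  assumes P: "homog k P" "P \<noteq> 0" and f: "(\<lambda>x. f x - mpeval P x) \<in> vorder (Suc k)"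
    and bound: "\<forall>\<^sub>F x in nhds 0. \<bar>f x\<bar> \<le> C * norm x ^ m"
  shows "m \<le> k"
proof (rule ccontr)
  assume "\<not> m \<le> k"
  then have mk: "Suc k \<le> m" by simp
  obtain C' where C': "0 < C'" "\<forall>\<^sub>F x in nhds 0. \<bar>f x - mpeval P x\<bar> \<le> C' * norm x ^ Suc k"
    using vorder_bound[OF f] by blast
  have "mpeval P v = 0" for v
  proof -
    have lim: "((\<lambda>t. t *\<^sub>R v) \<longlongrightarrow> 0) (at_right (0::real))"
      by (intro tendsto_eq_intros) auto
    have "((\<lambda>t. norm (t *\<^sub>R v)) \<longlongrightarrow> 0) (at_right (0::real))"
      using tendsto_norm[OF lim] by simp
    then have small: "\<forall>\<^sub>F t in at_right 0. norm (t *\<^sub>R v) < 1"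
      by (rule order_tendstoD) simp
    have "\<forall>\<^sub>F t in at_right 0. \<bar>mpeval P v\<bar> \<le> (\<bar>C\<bar> + C') * norm v ^ Suc k * t"
      using filterlim_iff[THEN iffD1, OF lim, rule_format, OF bound]
        filterlim_iff[THEN iffD1, OF lim, rule_format, OF C'(2)]
        small eventually_at_right_less[of 0]
    proof eventually_elim
      case (elim t)
      have "norm (t *\<^sub>R v) ^ m \<le> norm (t *\<^sub>R v) ^ Suc k"
        using elim(3) mk by (intro power_decreasing) auto
      then have "C * norm (t *\<^sub>R v) ^ m \<le> \<bar>C\<bar> * norm (t *\<^sub>R v) ^ Suc k"
        by (intro mult_mono) auto
      then have "\<bar>mpeval P (t *\<^sub>R v)\<bar> \<le> (\<bar>C\<bar> + C') * norm (t *\<^sub>R v) ^ Suc k"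
        using elim(1,2) unfolding distrib_right by linarith
      then have "t ^ k * \<bar>mpeval P v\<bar> \<le> t ^ k * ((\<bar>C\<bar> + C') * norm v ^ Suc k * t)"
        using elim(4) by (simp add: mpeval_homog[OF P(1)] abs_mult power_mult_distrib mult_ac)
      then show ?case using elim(4) by simp
    qed
    moreover have "((\<lambda>t. (\<bar>C\<bar> + C') * norm v ^ Suc k * t) \<longlongrightarrow> 0) (at_right (0::real))"
      by (intro tendsto_eq_intros) auto
    ultimately have "\<bar>mpeval P v\<bar> \<le> 0"
      by (intro tendsto_le[OF trivial_limit_at_right_real _ tendsto_const])
    then show ?thesis by simp
  qed
  then have "mpeval P = mpeval 0" by (simp add: fun_eq_iff)
  with P(2) show False by (simp add: mpeval_eq_iff)
qed

section \<open>Finitely generated ideals of germs and Nakayama's lemma\<close>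

definition germ_span :: "'i set \<Rightarrow> ('i \<Rightarrow> real^'n::finite \<Rightarrow> real) \<Rightarrow> (real^'n \<Rightarrow> real) set" where
  "germ_span A v = {h. smooth_germ h \<and>
     (\<exists>a. (\<forall>i. smooth_germ (a i)) \<and> (\<forall>\<^sub>F x in nhds 0. h x = (\<Sum>i\<in>A. a i x * v i x)))}"

lemma germ_spanI:
  "smooth_germ h \<Longrightarrow> (\<And>i. smooth_germ (a i)) \<Longrightarrow> \<forall>\<^sub>F x in nhds 0. h x = (\<Sum>i\<in>A. a i x * v i x) \<Longrightarrow>
    h \<in> germ_span A v"
  by (auto simp: germ_span_def)

lemma germ_spanE:
  assumes "h \<in> germ_span A v"
  obtains a where "\<And>i. smooth_germ (a i)" "\<forall>\<^sub>F x in nhds 0. h x = (\<Sum>i\<in>A. a i x * v i x)"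
  using assms by (auto simp: germ_span_def)

lemma germ_span_smooth: "h \<in> germ_span A v \<Longrightarrow> smooth_germ h"
  by (simp add: germ_span_def)

lemma germ_span_cong:
  assumes "h \<in> germ_span A v" "\<forall>\<^sub>F x in nhds 0. h x = k x" shows "k \<in> germ_span A v"
proof -
  from assms(1) obtain a where a: "\<And>i. smooth_germ (a i)" "\<forall>\<^sub>F x in nhds 0. h x = (\<Sum>i\<in>A. a i x * v i x)"
    by (rule germ_spanE) (rule that)
  from a(2) assms(2) have "\<forall>\<^sub>F x in nhds 0. k x = (\<Sum>i\<in>A. a i x * v i x)"
    by eventually_elim simp
  then show ?thesis
    by (rule germ_spanI[OF smooth_germ_cong[OF germ_span_smooth[OF assms(1)] assms(2)] a(1)])
qed

lemma germ_span_zero: "(\<lambda>x. 0) \<in> germ_span A v"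
  by (rule germ_spanI[where a="\<lambda>i x. 0"]) (auto simp: smooth_germ_const)

lemma germ_span_add:
  assumes "h \<in> germ_span A v" "k \<in> germ_span A v" shows "(\<lambda>x. h x + k x) \<in> germ_span A v"
proof -
  from assms(1) obtain a where a: "\<And>i. smooth_germ (a i)" "\<forall>\<^sub>F x in nhds 0. h x = (\<Sum>i\<in>A. a i x * v i x)"
    by (rule germ_spanE) (rule that)
  from assms(2) obtain b where b: "\<And>i. smooth_germ (b i)" "\<forall>\<^sub>F x in nhds 0. k x = (\<Sum>i\<in>A. b i x * v i x)"
    by (rule germ_spanE) (rule that)
  from a(2) b(2) have "\<forall>\<^sub>F x in nhds 0. h x + k x = (\<Sum>i\<in>A. (a i x + b i x) * v i x)"
    by eventually_elim (simp add: distrib_right sum.distrib)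
  then show ?thesis
    by (intro germ_spanI[where a="\<lambda>i x. a i x + b i x"] smooth_germ_add a(1) b(1)
        germ_span_smooth[OF assms(1)] germ_span_smooth[OF assms(2)])
qed

lemma germ_span_mult:
  assumes "smooth_germ c" "h \<in> germ_span A v" shows "(\<lambda>x. c x * h x) \<in> germ_span A v"
proof -
  from assms(2) obtain a where a: "\<And>i. smooth_germ (a i)" "\<forall>\<^sub>F x in nhds 0. h x = (\<Sum>i\<in>A. a i x * v i x)"
    by (rule germ_spanE) (rule that)
  from a(2) have "\<forall>\<^sub>F x in nhds 0. c x * h x = (\<Sum>i\<in>A. (c x * a i x) * v i x)"
    by eventually_elim (simp add: sum_distrib_left mult.assoc)
  then show ?thesis
    by (intro germ_spanI[where a="\<lambda>i x. c x * a i x"] smooth_germ_mult assms(1) a(1)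
        germ_span_smooth[OF assms(2)])
qed

lemma germ_span_sum: "(\<And>j. j \<in> B \<Longrightarrow> h j \<in> germ_span A v) \<Longrightarrow> (\<lambda>x. \<Sum>j\<in>B. h j x) \<in> germ_span A v"
  by (induction B rule: infinite_finite_induct) (simp_all add: germ_span_zero germ_span_add)

lemma germ_span_diff: "h \<in> germ_span A v \<Longrightarrow> k \<in> germ_span A v \<Longrightarrow> (\<lambda>x. h x - k x) \<in> germ_span A v"
  using germ_span_add[of h A v, OF _ germ_span_mult[OF smooth_germ_const[of "-1"], of k]] by simp

lemma germ_span_base: "finite A \<Longrightarrow> i \<in> A \<Longrightarrow> smooth_germ (v i) \<Longrightarrow> v i \<in> germ_span A v"
  by (rule germ_spanI[where a="\<lambda>j x. if j = i then 1 else 0"])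
     (auto simp: smooth_germ_const if_distrib[of "\<lambda>z. z * _"] cong: if_cong)

text \<open>Nakayama's lemma by elimination: the last relation is solved for its generator, because
  \<open>1 - m\<close> is a unit when \<open>m\<close> vanishes at the origin, and substituted into the others.\<close>

lemma nakayama_germ_span:
  fixes w :: "'a \<Rightarrow> real^'n::finite \<Rightarrow> real"
  assumes "finite A" "\<And>i. smooth_germ (w i)"
    "\<And>i. i \<in> A \<Longrightarrow> u i \<in> germ_span B F"
    "\<And>i j. smooth_germ (m i j)" "\<And>i j. m i j 0 = 0"
    "\<And>i. i \<in> A \<Longrightarrow> \<forall>\<^sub>F x in nhds 0. w i x = u i x + (\<Sum>j\<in>A. m i j x * w j x)"
    "i \<in> A"
  shows "w i \<in> germ_span B F"
  using assms
proof (induction A arbitrary: u m i rule: finite_induct)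
  case (insert a A)
  define c where "c x = inverse (1 - m a a x)" for x
  have smooth_c: "smooth_germ c"
    unfolding c_def[abs_def]
    using insert.prems(3,4) by (intro smooth_germ_inverse smooth_germ_diff smooth_germ_const) auto
  have "isCont (m a a) 0"
    using smooth_germ_eventually_differentiable[OF insert.prems(3)]
    by (auto dest!: eventually_nhds_x_imp_x intro: differentiable_imp_continuous_within)
  then have "(m a a \<longlongrightarrow> 0) (nhds 0)"
    by (simp add: isCont_def tendsto_nhds_iff insert.prems(4))
  then have "\<forall>\<^sub>F x in nhds 0. m a a x < 1" by (rule order_tendstoD) simp
  with insert.prems(5)[OF insertI1]
  have wa: "\<forall>\<^sub>F x in nhds 0. w a x = c x * u a x + (\<Sum>j\<in>A. c x * m a j x * w j x)"
  proof eventually_elim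
    case (elim x)
    then have "(1 - m a a x) * w a x = u a x + (\<Sum>j\<in>A. m a j x * w j x)"
      using insert.hyps by (simp add: left_diff_distrib)
    then have "w a x = c x * (u a x + (\<Sum>j\<in>A. m a j x * w j x))"
      using elim unfolding c_def by (simp add: field_simps)
    then show ?case by (simp add: distrib_left sum_distrib_left mult.assoc)
  qed
  have *: "w i \<in> germ_span B F" if "i \<in> A" for i
  proof (rule insert.IH[of "\<lambda>i x. u i x + m i a x * (c x * u a x)"
        "\<lambda>i j x. m i j x + m i a x * (c x * m a j x)" i])
    fix i assume i: "i \<in> A"
    show "(\<lambda>x. u i x + m i a x * (c x * u a x)) \<in> germ_span B F"
      using insert.prems i by (intro germ_span_add germ_span_mult smooth_c) auto
    from wa insert.prems(5)[OF insertI2[OF i]]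
    show "\<forall>\<^sub>F x in nhds 0. w i x = u i x + m i a x * (c x * u a x) +
        (\<Sum>j\<in>A. (m i j x + m i a x * (c x * m a j x)) * w j x)"
    proof eventually_elim
      case (elim x)
      have "w i x = u i x + (m i a x * w a x + (\<Sum>j\<in>A. m i j x * w j x))"
        using elim(2) i insert.hyps by auto
      also have "m i a x * w a x = m i a x * (c x * u a x) + (\<Sum>j\<in>A. m i a x * (c x * m a j x) * w j x)"
        by (subst elim(1)) (simp add: distrib_left sum_distrib_left mult.assoc)
      finally show ?case by (simp add: distrib_right sum.distrib)
    qed
  next
    show "smooth_germ (w i)" "smooth_germ (\<lambda>x. m i j x + m i a x * (c x * m a j x))" for i j
      by (intro insert.prems smooth_germ_add smooth_germ_mult smooth_c)+
    show "m i j 0 + m i a 0 * (c 0 * m a j 0) = 0" for i j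
      by (simp add: insert.prems(4))
  qed fact
  have "(\<lambda>x. c x * u a x + (\<Sum>j\<in>A. c x * m a j x * w j x)) \<in> germ_span B F"
    by (intro germ_span_add germ_span_sum germ_span_mult smooth_germ_mult smooth_c
        insert.prems *) auto
  then have "w a \<in> germ_span B F"
    by (rule germ_span_cong) (use wa in eventually_elim, simp)
  with * insert.prems(6) show ?case by auto
qed simp

lemma finite_total_degree_le: "finite {\<alpha> :: 'n::finite \<Rightarrow>\<^sub>0 nat. total_degree \<alpha> \<le> s}"
proof (rule finite_subset)
  let ?F = "{f :: 'n \<Rightarrow> nat. \<forall>i. f i \<le> s}"
  have "finite (PiE UNIV (\<lambda>_ :: 'n. {..s}))" by (intro finite_PiE) auto
  then have "finite ?F" by (rule finite_subset[rotated]) (auto simp: PiE_def Pi_def)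
  then show "finite (Poly_Mapping.Abs_poly_mapping ` ?F)" by (rule finite_imageI)
  show "{\<alpha>. total_degree \<alpha> \<le> s} \<subseteq> Poly_Mapping.Abs_poly_mapping ` ?F"
  proof
    fix \<alpha> :: "'n \<Rightarrow>\<^sub>0 nat" assume "\<alpha> \<in> {\<alpha>. total_degree \<alpha> \<le> s}"
    then have "lookup \<alpha> i \<le> s" for i
      using member_le_sum[of i UNIV "lookup \<alpha>"] by (simp add: total_degree_def)
    then show "\<alpha> \<in> Poly_Mapping.Abs_poly_mapping ` ?F"
      by (intro image_eqI[of _ _ "lookup \<alpha>"]) (auto simp: lookup_inverse)
  qed
qed

lemma finite_total_degree_eq: "finite {\<alpha> :: 'n::finite \<Rightarrow>\<^sub>0 nat. total_degree \<alpha> = s}"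
  by (rule finite_subset[OF _ finite_total_degree_le[of s]]) auto

abbreviation monomial :: "('n::finite \<Rightarrow>\<^sub>0 nat) \<Rightarrow> real^'n \<Rightarrow> real" where
  "monomial \<alpha> \<equiv> mpeval (Poly_Mapping.single \<alpha> 1)"

text \<open>Finite generation of the powers of the maximal ideal, which makes them accessible to
  Nakayama's lemma.\<close>

lemma vorder_germ_span: "h \<in> vorder s \<Longrightarrow> h \<in> germ_span {\<alpha>. total_degree \<alpha> = s} monomial"
proof (induction s arbitrary: h)
  case 0
  have "monomial 0 x = 1" for x :: "real^'a" by (simp add: mpeval_single)
  moreover have "{\<alpha> :: 'a \<Rightarrow>\<^sub>0 nat. total_degree \<alpha> = 0} = {0}" by (auto simp: total_degree_eq_0_iff)
  ultimately show ?case using 0 by (intro germ_spanI[where a="\<lambda>_. h"]) simp_all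
next
  case (Suc s)
  from Suc.prems obtain g where g: "\<And>i. g i \<in> vorder s" "\<forall>\<^sub>F x in nhds 0. h x = (\<Sum>i\<in>UNIV. x $ i * g i x)"
    by (rule vorder_SucE) (rule that)
  have "(\<lambda>x. x $ i * g i x) \<in> germ_span {\<alpha>. total_degree \<alpha> = Suc s} monomial" for i
  proof -
    from Suc.IH[OF g(1)] obtain b where b: "\<And>\<alpha>. smooth_germ (b \<alpha>)"
      "\<forall>\<^sub>F x in nhds 0. g i x = (\<Sum>\<alpha> | total_degree \<alpha> = s. b \<alpha> x * monomial \<alpha> x)"
      by (rule germ_spanE) (rule that)
    have "(\<lambda>x. \<Sum>\<alpha> | total_degree \<alpha> = s. b \<alpha> x * monomial (\<alpha> + Poly_Mapping.single i 1) x)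
        \<in> germ_span {\<alpha>. total_degree \<alpha> = Suc s} monomial"
      by (intro germ_span_sum germ_span_mult b germ_span_base finite_total_degree_eq smooth_germ_mpeval)
         (simp add: total_degree_add)
    moreover have "monomial (\<alpha> + Poly_Mapping.single i 1) x = x $ i * monomial \<alpha> x" for \<alpha> x
    proof -
      have "Poly_Mapping.single (\<alpha> + Poly_Mapping.single i 1) 1 = mp_var i * Poly_Mapping.single \<alpha> 1"
        by (simp add: mp_var_def mult_single add.commute)
      then show ?thesis by (simp add: mpeval_mult)
    qed
    moreover from b(2) have "\<forall>\<^sub>F x in nhds 0. (\<Sum>\<alpha> | total_degree \<alpha> = s. b \<alpha> x * (x $ i * monomial \<alpha> x)) = x $ i * g i x"
      by eventually_elim (simp add: sum_distrib_left mult.left_commute)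
    ultimately show ?thesis by (auto intro: germ_span_cong)
  qed
  then have "(\<lambda>x. \<Sum>i\<in>UNIV. x $ i * g i x) \<in> germ_span {\<alpha>. total_degree \<alpha> = Suc s} monomial"
    by (intro germ_span_sum)
  then show ?case by (rule germ_span_cong) (use g(2) in eventually_elim, simp)
qed

text \<open>The power \<open>Suc s\<close> is the maximal ideal times the power \<open>s\<close>:
  the outermost coordinate stays in the coefficients and makes them vanish at the origin.\<close>

lemma vorder_Suc_germ_span:
  assumes "h \<in> vorder (Suc s)"
  obtains m where "\<And>\<alpha>. smooth_germ (m \<alpha>)" "\<And>\<alpha>. m \<alpha> 0 = 0"
    "\<forall>\<^sub>F x in nhds 0. h x = (\<Sum>\<alpha> | total_degree \<alpha> = s. m \<alpha> x * monomial \<alpha> x)"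
proof -
  from assms obtain g where g: "\<And>i. g i \<in> vorder s" "\<forall>\<^sub>F x in nhds 0. h x = (\<Sum>i\<in>UNIV. x $ i * g i x)"
    by (rule vorder_SucE) (rule that)
  have "\<forall>i. \<exists>b. (\<forall>\<alpha>. smooth_germ (b \<alpha>)) \<and> (\<forall>\<^sub>F x in nhds 0. g i x = (\<Sum>\<alpha> | total_degree \<alpha> = s. b \<alpha> x * monomial \<alpha> x))"
    using vorder_germ_span[OF g(1)] by (auto simp: germ_span_def)
  from choice[OF this] obtain b where b: "\<And>i \<alpha>. smooth_germ (b i \<alpha>)"
    "\<And>i. \<forall>\<^sub>F x in nhds 0. g i x = (\<Sum>\<alpha> | total_degree \<alpha> = s. b i \<alpha> x * monomial \<alpha> x)" by blast
  have "\<forall>\<^sub>F x in nhds 0. \<forall>i. g i x = (\<Sum>\<alpha> | total_degree \<alpha> = s. b i \<alpha> x * monomial \<alpha> x)"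
    by (intro eventually_all_finite b)
  with g(2) have "\<forall>\<^sub>F x in nhds 0. h x = (\<Sum>\<alpha> | total_degree \<alpha> = s. (\<Sum>i\<in>UNIV. x $ i * b i \<alpha> x) * monomial \<alpha> x)"
  proof eventually_elim
    case (elim x)
    have "h x = (\<Sum>i\<in>UNIV. \<Sum>\<alpha> | total_degree \<alpha> = s. x $ i * b i \<alpha> x * monomial \<alpha> x)"
      using elim by (simp add: sum_distrib_left mult.assoc)
    also have "\<dots> = (\<Sum>\<alpha> | total_degree \<alpha> = s. \<Sum>i\<in>UNIV. x $ i * b i \<alpha> x * monomial \<alpha> x)"
      by (rule sum.swap)
    finally show ?case by (simp add: sum_distrib_right)
  qed
  then show ?thesis
    by (intro that[of "\<lambda>\<alpha> x. \<Sum>i\<in>UNIV. x $ i * b i \<alpha> x"] smooth_germ_sum smooth_germ_mult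
        smooth_germ_coord b(1)) auto
qed

text \<open>A monomial of degree \<open>s\<close> is divisible by some \<open>mp_var k ^ N\<close>,
  hence is a combination of the \<open>P i\<close>. Replacing each \<open>P i\<close> by
  \<open>F i\<close> costs an error of order \<open>Suc s\<close>, that is, monomials of degree
  \<open>s\<close> with coefficients vanishing at the origin, which Nakayama's lemma
  absorbs.\<close>

lemma vorder_subset_germ_span:
  fixes F :: "'n::finite \<Rightarrow> real^'n \<Rightarrow> real"
  assumes hom: "\<And>i. homog e (P i)"
    and F: "\<And>i. smooth_germ (F i)" "\<And>i. (\<lambda>x. F i x - mpeval (P i) x) \<in> vorder (Suc e)"
    and gen: "\<And>k. mp_var k ^ N = (\<Sum>i\<in>UNIV. q k i * P i)"
    and s: "CARD('n) * N < s"
  shows "vorder s \<subseteq> germ_span UNIV F"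
proof -
  have "\<forall>\<alpha>\<in>{\<alpha>. total_degree \<alpha> = s}. \<exists>u. \<exists>m. u \<in> germ_span UNIV F \<and> (\<forall>\<beta>. smooth_germ (m \<beta>) \<and> m \<beta> 0 = 0) \<and>
      (\<forall>\<^sub>F x in nhds 0. monomial \<alpha> x = u x + (\<Sum>\<beta> | total_degree \<beta> = s. m \<beta> x * monomial \<beta> x))"
  proof
    fix \<alpha> :: "'n \<Rightarrow>\<^sub>0 nat" assume "\<alpha> \<in> {\<alpha>. total_degree \<alpha> = s}"
    then have \<alpha>: "total_degree \<alpha> = s" by simp
    \<comment> \<open>Pigeonhole: if all exponents were below \<open>N\<close>, the degree would not
      exceed the number of variables times \<open>N\<close>. This is the origin of the bound on
      \<open>s\<close>.\<close>
    have "\<exists>k. N \<le> lookup \<alpha> k"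
    proof (rule ccontr)
      assume "\<not> (\<exists>k. N \<le> lookup \<alpha> k)"
      then have "total_degree \<alpha> \<le> (\<Sum>k\<in>(UNIV :: 'n set). N)"
        unfolding total_degree_def by (intro sum_mono) (meson linorder_le_cases)
      with s \<alpha> show False by simp
    qed
    then obtain k where k: "N \<le> lookup \<alpha> k" ..
    define \<beta> where "\<beta> = \<alpha> - Poly_Mapping.single k N"
    have "\<alpha> = \<beta> + Poly_Mapping.single k N"
      using k by (intro poly_mapping_eqI) (auto simp: \<beta>_def lookup_add lookup_minus lookup_single when_def)
    then have "Poly_Mapping.single \<alpha> 1 = Poly_Mapping.single \<beta> 1 * mp_var k ^ N"
      by (simp add: mp_var_power mult_single)
    also have "\<dots> = (\<Sum>i\<in>UNIV. P i * (Poly_Mapping.single \<beta> 1 * q k i))"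
      by (simp add: gen sum_distrib_left mult_ac)
    finally have "hpart s (Poly_Mapping.single \<alpha> 1) =
        (\<Sum>i\<in>UNIV. P i * restrict_keys (\<lambda>\<gamma>. total_degree \<gamma> + e = s) (Poly_Mapping.single \<beta> 1 * q k i))"
      by (simp add: restrict_keys_sum restrict_keys_mult_homog[OF hom, where Q="\<lambda>d. d = s"])
    moreover have "hpart s (Poly_Mapping.single \<alpha> 1) = Poly_Mapping.single \<alpha> (1::real)"
      by (rule restrict_keys_id) (simp add: \<alpha>)
    \<comment> \<open>Only the component of degree \<open>s - e\<close> is kept as coefficient of
      \<open>P i\<close>; then the product with \<open>F i - P i\<close>, of order
      \<open>Suc e\<close>, has order \<open>Suc s\<close>.\<close>
    moreover define r where "r i = restrict_keys (\<lambda>\<gamma>. total_degree \<gamma> + e = s) (Poly_Mapping.single \<beta> 1 * q k i)" for i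
    ultimately have mon: "Poly_Mapping.single \<alpha> 1 = (\<Sum>i\<in>UNIV. P i * r i)" by simp
    have r: "(\<lambda>x. mpeval (r i) x * (F i x - mpeval (P i) x)) \<in> vorder (Suc s)" for i
    proof (cases "e \<le> s")
      case True
      have "r i \<in> ord_ge (s - e)" by (auto simp: r_def ord_ge_def keys_restrict_keys)
      from vorder_mult[OF vorder_mpeval[OF this] F(2)] True show ?thesis by simp
    next
      case False
      then have "r i = 0" by (auto simp: r_def intro!: restrict_keys_none)
      then show ?thesis by simp
    qed
    have "(\<lambda>x. \<Sum>i\<in>UNIV. - (mpeval (r i) x * (F i x - mpeval (P i) x))) \<in> vorder (Suc s)"
      by (intro vorder_sum vorder_uminus r)
    then obtain m where m: "\<And>\<beta>. smooth_germ (m \<beta>)" "\<And>\<beta>. m \<beta> 0 = 0"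
      "\<forall>\<^sub>F x in nhds 0. (\<Sum>i\<in>UNIV. - (mpeval (r i) x * (F i x - mpeval (P i) x))) =
        (\<Sum>\<beta> | total_degree \<beta> = s. m \<beta> x * monomial \<beta> x)"
      by (rule vorder_Suc_germ_span) (rule that)
    from m(3) have "\<forall>\<^sub>F x in nhds 0. monomial \<alpha> x =
        (\<Sum>i\<in>UNIV. mpeval (r i) x * F i x) + (\<Sum>\<beta> | total_degree \<beta> = s. m \<beta> x * monomial \<beta> x)"
    proof eventually_elim
      case (elim x)
      have "monomial \<alpha> x = (\<Sum>i\<in>UNIV. mpeval (r i) x * F i x) +
          (\<Sum>i\<in>UNIV. - (mpeval (r i) x * (F i x - mpeval (P i) x)))"
        unfolding mon by (simp add: mpeval_sum mpeval_mult sum.distrib[symmetric] algebra_simps)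
      then show ?case by (simp only: elim)
    qed
    moreover have "(\<lambda>x. \<Sum>i\<in>UNIV. mpeval (r i) x * F i x) \<in> germ_span UNIV F"
      by (intro germ_span_sum germ_span_mult smooth_germ_mpeval germ_span_base F) auto
    ultimately show "\<exists>u. \<exists>m. u \<in> germ_span UNIV F \<and> (\<forall>\<beta>. smooth_germ (m \<beta>) \<and> m \<beta> 0 = 0) \<and>
      (\<forall>\<^sub>F x in nhds 0. monomial \<alpha> x = u x + (\<Sum>\<beta> | total_degree \<beta> = s. m \<beta> x * monomial \<beta> x))"
      using m(1,2) by blast
  qed
  from bchoice[OF this] obtain u where
    "\<forall>\<alpha>\<in>{\<alpha>. total_degree \<alpha> = s}. \<exists>m. u \<alpha> \<in> germ_span UNIV F \<and> (\<forall>\<beta>. smooth_germ (m \<beta>) \<and> m \<beta> 0 = 0) \<and>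
      (\<forall>\<^sub>F x in nhds 0. monomial \<alpha> x = u \<alpha> x + (\<Sum>\<beta> | total_degree \<beta> = s. m \<beta> x * monomial \<beta> x))" ..
  from bchoice[OF this] obtain m where um:
    "\<forall>\<alpha>\<in>{\<alpha>. total_degree \<alpha> = s}. u \<alpha> \<in> germ_span UNIV F \<and> (\<forall>\<beta>. smooth_germ (m \<alpha> \<beta>) \<and> m \<alpha> \<beta> 0 = 0) \<and>
      (\<forall>\<^sub>F x in nhds 0. monomial \<alpha> x = u \<alpha> x + (\<Sum>\<beta> | total_degree \<beta> = s. m \<alpha> \<beta> x * monomial \<beta> x))" ..
  \<comment> \<open>The choice of \<open>m\<close> says nothing about other degrees, while
    Nakayama's lemma asks for smooth coefficients vanishing at 0 at all indices.\<close>
  define m' where "m' \<alpha> \<beta> = (if total_degree \<alpha> = s then m \<alpha> \<beta> else (\<lambda>x. 0))" for \<alpha> \<beta>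
  have mono: "monomial \<alpha> \<in> germ_span UNIV F" if "\<alpha> \<in> {\<alpha>. total_degree \<alpha> = s}" for \<alpha>
  proof (rule nakayama_germ_span[OF finite_total_degree_eq _ _ _ _ _ that, where u=u and m=m'])
    show "smooth_germ (m' \<alpha> \<beta>)" "m' \<alpha> \<beta> 0 = 0" for \<alpha> \<beta>
      using um by (auto simp: m'_def smooth_germ_const)
    fix \<alpha> :: "'n \<Rightarrow>\<^sub>0 nat" assume \<alpha>: "\<alpha> \<in> {\<alpha>. total_degree \<alpha> = s}"
    show "u \<alpha> \<in> germ_span UNIV F" using bspec[OF um \<alpha>] by blast
    have "m' \<alpha> = m \<alpha>" using \<alpha> by (auto simp: m'_def)
    then show "\<forall>\<^sub>F x in nhds 0. monomial \<alpha> x = u \<alpha> x + (\<Sum>\<beta> | total_degree \<beta> = s. m' \<alpha> \<beta> x * monomial \<beta> x)"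
      using bspec[OF um \<alpha>] by simp
  qed (rule smooth_germ_mpeval)
  show ?thesis
  proof
    fix h :: "real^'n \<Rightarrow> real" assume "h \<in> vorder s"
    from vorder_germ_span[OF this] obtain b where b: "\<And>\<alpha>. smooth_germ (b \<alpha>)"
      "\<forall>\<^sub>F x in nhds 0. h x = (\<Sum>\<alpha> | total_degree \<alpha> = s. b \<alpha> x * monomial \<alpha> x)"
      by (rule germ_spanE) (rule that)
    have "(\<lambda>x. \<Sum>\<alpha> | total_degree \<alpha> = s. b \<alpha> x * monomial \<alpha> x) \<in> germ_span UNIV F"
      by (intro germ_span_sum germ_span_mult b(1)) (rule mono)
    then show "h \<in> germ_span UNIV F" by (rule germ_span_cong) (use b(2) in eventually_elim, simp)
  qed
qed

section \<open>The truncated Koszul complex\<close>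

context vector_space
begin

lemma span_Int_span_eq_0:
  assumes "finite S" "independent (B \<union> S)" "B \<inter> S = {}" "x \<in> span S" "x \<in> span B"
  shows "x = 0"
  using assms
proof (induction S arbitrary: x rule: finite_induct)
  case (insert a S)
  from insert.prems(3) obtain k where k: "x - scale k a \<in> span S"
    by (auto simp: span_insert)
  have B: "span B \<subseteq> span (B \<union> S)" and S: "span S \<subseteq> span (B \<union> S)" by (intro span_mono; simp)+
  have k0: "k = 0"
  proof (rule ccontr)
    assume k0: "k \<noteq> 0"
    have "x - (x - scale k a) \<in> span (B \<union> S)"
      using k insert.prems(4) B S by (blast intro: span_diff)
    then have "scale k a \<in> span (B \<union> S)" by simp
    from span_scale[OF this, of "inverse k"] have "a \<in> span (B \<union> S)" using k0 by simp
    moreover have "B \<union> insert a S - {a} = B \<union> S" using insert.prems(2) insert.hyps by auto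
    ultimately have "dependent (B \<union> insert a S)" unfolding dependent_def by auto
    with insert.prems(1) show False by blast
  qed
  show ?case
  proof (rule insert.IH)
    show "independent (B \<union> S)" by (rule independent_mono[OF insert.prems(1)]) auto
    show "B \<inter> S = {}" using insert.prems(2) by auto
    show "x \<in> span S" using k k0 by simp
  qed (rule insert.prems)
qed simp

text \<open>A basis of \<open>W\<close> is extended to one of \<open>V\<close>, and the added
  vectors represent a basis of the quotient. It serves both for kernels and for the cokernel of the
  last differential.\<close>

lemma complement_basis:
  assumes W: "subspace W" and V: "subspace V" and "W \<subseteq> V" and T: "finite T" "V \<subseteq> span T"
  obtains S where "finite S" "S \<subseteq> V" "independent S" "\<And>x. x \<in> span S \<Longrightarrow> x \<in> W \<Longrightarrow> x = 0"
    "\<And>v. v \<in> V \<Longrightarrow> \<exists>w\<in>W. v - w \<in> span S" "card S + dim W = dim V"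
proof -
  obtain B where B: "B \<subseteq> W" "independent B" "W \<subseteq> span B" "card B = dim W"
    by (rule basis_exists)
  obtain C where C: "B \<subseteq> C" "C \<subseteq> V" "independent C" "V \<subseteq> span C"
    by (rule maximal_independent_subset_extend[of B V]) (use B \<open>W \<subseteq> V\<close> in auto)
  have "finite C" using independent_span_bound[OF T(1) C(3)] C(2) T(2) by blast
  have BC: "B \<union> (C - B) = C" using C(1) by blast
  show ?thesis
  proof (rule that[of "C - B"])
    show "finite (C - B)" "C - B \<subseteq> V" using \<open>finite C\<close> C(2) by auto
    show "independent (C - B)" by (rule independent_mono[OF C(3)]) auto
    show "x = 0" if "x \<in> span (C - B)" "x \<in> W" for x
      by (rule span_Int_span_eq_0[of "C - B" B]) (use that B(3) C(3) BC \<open>finite C\<close> in auto)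
    show "\<exists>w\<in>W. v - w \<in> span (C - B)" if "v \<in> V" for v
    proof -
      have "v \<in> span (B \<union> (C - B))" using that C(4) BC by auto
      then obtain w z where "v = w + z" "w \<in> span B" "z \<in> span (C - B)"
        unfolding span_Un by blast
      moreover have "span B \<subseteq> W" by (rule span_minimal[OF B(1) W])
      ultimately show ?thesis by (intro bexI[of _ w]) auto
    qed
    have "card C = dim V" using C by (intro basis_card_eq_dim)
    then show "card (C - B) + dim W = dim V"
      using B(4) card_Diff_subset[OF finite_subset[OF C(1) \<open>finite C\<close>] C(1)] card_mono[OF \<open>finite C\<close> C(1)] by simp
  qed
qed

text \<open>Rank and nullity of the restriction to \<open>V\<close>. The space of all chains has
  infinite dimension, so finiteness is assumed only through a finite set whose span contains
  \<open>V\<close>.\<close>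

lemma dim_image_add_dim_kernel:
  assumes lin: "Vector_Spaces.linear scale scale f" and V: "subspace V" and T: "finite T" "V \<subseteq> span T"
  shows "dim (f ` V) + dim {x \<in> V. f x = 0} = dim V"
proof -
  interpret f: Vector_Spaces.linear scale scale f by fact
  let ?K = "{x \<in> V. f x = 0}"
  have K: "subspace ?K"
    using V unfolding subspace_def by (auto simp: f.zero f.add f.scale)
  obtain S where S: "finite S" "S \<subseteq> V" "independent S" "\<And>x. x \<in> span S \<Longrightarrow> x \<in> ?K \<Longrightarrow> x = 0"
    "\<And>v. v \<in> V \<Longrightarrow> \<exists>w\<in>?K. v - w \<in> span S" "card S + dim ?K = dim V"
    by (rule complement_basis[OF K V _ T]) auto
  have SV: "span S \<subseteq> V" by (rule span_minimal[OF S(2) V])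
  have inj: "inj_on f (span S)"
  proof (rule inj_onI)
    fix x y assume "x \<in> span S" "y \<in> span S" "f x = f y"
    then have "x - y \<in> span S" "f (x - y) = 0" by (auto intro: span_diff simp: f.diff)
    with S(4)[of "x - y"] SV show "x = y" by auto
  qed
  have "independent (f ` S)" by (rule f.independent_injective_image[OF S(3) inj])
  moreover have "f ` V \<subseteq> span (f ` S)"
  proof
    fix y assume "y \<in> f ` V"
    then obtain v where v: "v \<in> V" "y = f v" by auto
    from S(5)[OF v(1)] obtain w where w: "f w = 0" "v - w \<in> span S" by auto
    then have "y = f (v - w)" by (simp add: f.diff v(2))
    with w(2) show "y \<in> span (f ` S)" by (simp add: f.span_image)
  qed
  moreover have "f ` S \<subseteq> f ` V" using S(2) by auto
  ultimately have "dim (f ` V) = card (f ` S)" by (metis basis_card_eq_dim)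
  also have "\<dots> = card S" using inj by (intro card_image) (meson inj_on_subset span_superset)
  finally show ?thesis using S(6) by simp
qed

end

abbreviation kscale :: "real \<Rightarrow> (nat set \<Rightarrow> 'n::finite mpoly) \<Rightarrow> nat set \<Rightarrow> 'n mpoly" where
  "kscale c a \<equiv> \<lambda>S. mp_const c * a S"

interpretation kc: vector_space kscale
proof
  fix a b :: real and x y :: "nat set \<Rightarrow> 'n::finite mpoly"
  show "kscale a (x + y) = kscale a x + kscale a y"
    by (simp add: fun_eq_iff distrib_left)
  show "kscale (a + b) x = kscale a x + kscale b x"
    by (simp add: fun_eq_iff distrib_right mp_const_def single_add)
  show "kscale a (kscale b x) = kscale (a * b) x"
    by (simp add: fun_eq_iff mult.assoc[symmetric] mp_const_def mult_single)
  show "kscale 1 x = x"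
    by (simp add: fun_eq_iff mp_const_def)
qed

text \<open>For \<open>s \<le> i * e\<close> truncated subtraction gives degree below \<open>0\<close>, that is, only the zero chain.\<close>

definition tchain :: "nat \<Rightarrow> nat \<Rightarrow> nat \<Rightarrow> nat \<Rightarrow> (nat set \<Rightarrow> 'n::finite mpoly) set" where
  "tchain n e s i = {a \<in> kchain n i. \<forall>S. trunc (s - i * e) (a S) = a S}"

text \<open>The level of truncation is read off from \<open>card S\<close>, so one linear operator
  on all families serves every homological degree at once.\<close>

definition tdiff :: "nat \<Rightarrow> nat \<Rightarrow> nat \<Rightarrow> (nat \<Rightarrow> 'n::finite mpoly) \<Rightarrow> (nat set \<Rightarrow> 'n mpoly) \<Rightarrow> nat set \<Rightarrow> 'n mpoly" where
  "tdiff n e s F a S = trunc (s - card S * e) (kdiff n F a S)"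

lemma trunc_mp_const_mult: "trunc r (mp_const c * p) = mp_const c * trunc r p"
  by (rule poly_mapping_eqI) (simp add: lookup_restrict_keys lookup_mp_const_mult)

lemma linear_tdiff:
  fixes F :: "nat \<Rightarrow> 'n::finite mpoly"
  shows "Vector_Spaces.linear kscale kscale (tdiff n e s F)"
proof -
  have "tdiff n e s F (a + b) = tdiff n e s F a + tdiff n e s F b"
    for a b :: "nat set \<Rightarrow> 'n mpoly"
    by (simp add: fun_eq_iff tdiff_def plus_fun_def kdiff_add restrict_keys_add)
  moreover have "tdiff n e s F (kscale c a) = kscale c (tdiff n e s F a)"
    for c and a :: "nat set \<Rightarrow> 'n mpoly"
    by (simp add: fun_eq_iff tdiff_def kdiff_scale trunc_mp_const_mult)
  ultimately show ?thesis
    by (simp add: Vector_Spaces.linear_iff kc.vector_space_axioms)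
qed

lemma subspace_tchain: "kc.subspace (tchain n e s i :: (nat set \<Rightarrow> 'n::finite mpoly) set)"
  unfolding kc.subspace_def
proof (intro conjI ballI allI)
  show "0 \<in> tchain n e s i" by (simp add: tchain_def zero_fun_def)
  fix a :: "nat set \<Rightarrow> 'n mpoly" assume a: "a \<in> tchain n e s i"
  show "kscale c a \<in> tchain n e s i" for c
    using a kchain_comp[of a n i "\<lambda>p. mp_const c * p"] by (simp add: tchain_def trunc_mp_const_mult)
  fix b :: "nat set \<Rightarrow> 'n mpoly" assume b: "b \<in> tchain n e s i"
  show "a + b \<in> tchain n e s i"
    using a b by (simp add: tchain_def plus_fun_def kchain_add restrict_keys_add)
qed

lemma sum_apply: "(\<Sum>i\<in>A. f i) x = (\<Sum>i\<in>A. f i x :: 'a::comm_monoid_add)"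
  by (induction A rule: infinite_finite_induct) simp_all

lemma tchain_subset_span:
  obtains T :: "(nat set \<Rightarrow> 'n::finite mpoly) set" where "finite T" "tchain n e s i \<subseteq> kc.span T"
proof -
  \<comment> \<open>\<open>E S \<alpha>\<close> is the monomial with exponent
    \<open>\<alpha>\<close> times the wedge product indexed by \<open>S\<close>.\<close>
  define E where "E S \<alpha> = (\<lambda>S'. if S' = S then Poly_Mapping.single \<alpha> (1::real) else 0)"
    for S :: "nat set" and \<alpha> :: "'n \<Rightarrow>\<^sub>0 nat"
  let ?T = "(\<lambda>(S, \<alpha>). E S \<alpha>) ` (Pow {..<n} \<times> {\<alpha>. total_degree \<alpha> \<le> s})"
  show ?thesis
  proof
    show "finite ?T" by (intro finite_imageI finite_cartesian_product finite_total_degree_le) simp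
    show "tchain n e s i \<subseteq> kc.span ?T"
    proof
      fix a :: "nat set \<Rightarrow> 'n mpoly" assume a: "a \<in> tchain n e s i"
      have "a = (\<Sum>S\<in>Pow {..<n}. \<Sum>\<alpha>\<in>keys (a S). kscale (lookup (a S) \<alpha>) (E S \<alpha>))"
      proof
        fix S'
        have "(\<Sum>S\<in>Pow {..<n}. \<Sum>\<alpha>\<in>keys (a S). kscale (lookup (a S) \<alpha>) (E S \<alpha>)) S' =
            (\<Sum>S\<in>Pow {..<n}. \<Sum>\<alpha>\<in>keys (a S). mp_const (lookup (a S) \<alpha>) * E S \<alpha> S')"
          by (simp add: sum_apply)
        also have "\<dots> = (\<Sum>S\<in>Pow {..<n}. if S = S' then \<Sum>\<alpha>\<in>keys (a S). Poly_Mapping.single \<alpha> (lookup (a S) \<alpha>) else 0)"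
          by (rule sum.cong) (auto simp: E_def mp_const_def mult_single)
        also have "\<dots> = a S'"
          using a kchainD[of a n i S'] by (auto simp: sum_single_keys tchain_def)
        finally show "a S' = (\<Sum>S\<in>Pow {..<n}. \<Sum>\<alpha>\<in>keys (a S). kscale (lookup (a S) \<alpha>) (E S \<alpha>)) S'" ..
      qed
      also have "\<dots> \<in> kc.span ?T"
      proof (intro kc.span_sum kc.span_scale kc.span_base)
        fix S \<alpha> assume S: "S \<in> Pow {..<n}" and \<alpha>: "\<alpha> \<in> keys (a S)"
        have "trunc (s - i * e) (a S) = a S" using a by (simp add: tchain_def)
        with \<alpha> have "\<alpha> \<in> keys (trunc (s - i * e) (a S))" by simp
        then have "total_degree \<alpha> \<le> s" by (auto simp: keys_restrict_keys)
        with S show "E S \<alpha> \<in> ?T" by auto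
      qed
      finally show "a \<in> kc.span ?T" .
    qed
  qed
qed

lemma kdiff_ord_ge:
  assumes "\<And>j. j < n \<Longrightarrow> F j \<in> ord_ge e" "\<And>j. j \<in> {..<n} - S \<Longrightarrow> a (insert j S) \<in> ord_ge r"
  shows "kdiff n F a S \<in> ord_ge (e + r)"
proof -
  have "(ksgn S j * F j) * a (insert j S) \<in> ord_ge (e + r)" if "j \<in> {..<n} - S" for j
    using ord_ge_mult[of "ksgn S j" 0 "F j" e] assms that by (intro ord_ge_mult) auto
  then show ?thesis unfolding kdiff_def by (intro ord_ge_sum)
qed

text \<open>Terms cut off in degree \<open>card S + 1\<close> have order at least
  \<open>s - Suc (card S) * e\<close>, and \<open>F\<close> raises this by \<open>e\<close>, so they
  do not reach the degrees kept at \<open>S\<close>. With truncated subtraction the orders are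
  related by an inequality, which suffices.\<close>

lemma kdiff_trunc_diff:
  assumes "\<And>j. j < n \<Longrightarrow> F j \<in> ord_ge e" "finite S"
  shows "kdiff n F a S - kdiff n F (\<lambda>S. trunc (s - card S * e) (a S)) S \<in> ord_ge (s - card S * e)"
proof -
  have "kdiff n F (\<lambda>S. a S - trunc (s - card S * e) (a S)) S \<in> ord_ge (e + (s - Suc (card S) * e))"
    using assms by (intro kdiff_ord_ge) (auto intro: diff_trunc_ord_ge[of _ "s - (e + card S * e)", simplified])
  moreover have "s - card S * e \<le> e + (s - Suc (card S) * e)" by simp
  ultimately show ?thesis unfolding kdiff_diff by (rule ord_ge_mono)
qed

lemma kdiff_hom_part:
  assumes "\<And>j. j < n \<Longrightarrow> homog e (P j)"
  shows "restrict_keys (\<lambda>\<alpha>. Q (total_degree \<alpha>)) (kdiff n P a S) = kdiff n P (\<lambda>S. restrict_keys (\<lambda>\<alpha>. Q (total_degree \<alpha> + e)) (a S)) S"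
proof -
  have "restrict_keys R (ksgn S j * p) = ksgn S j * restrict_keys R p" for R and p :: "'a mpoly" and j
  proof (cases "even (card {i\<in>S. i < j})")
    case True
    then show ?thesis by (simp add: ksgn_def)
  next
    case False
    then show ?thesis by (simp add: ksgn_def restrict_keys_uminus)
  qed
  then show ?thesis
    unfolding kdiff_def restrict_keys_sum
    using restrict_keys_mult_homog[OF assms, where Q=Q] by (intro sum.cong) (auto simp: mult.assoc)
qed

lemma tdiff_tchain:
  assumes "a \<in> tchain n e s (Suc i)" shows "tdiff n e s F a \<in> tchain n e s i"
proof -
  have k: "kdiff n F a \<in> kchain n i" using assms by (intro kdiff_kchain) (simp add: tchain_def)
  have eq: "tdiff n e s F a S = trunc (s - i * e) (kdiff n F a S)" for S
    by (cases "kdiff n F a S = 0") (use kchainD[OF k] in \<open>auto simp: tdiff_def\<close>)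
  have "(\<lambda>S. trunc (s - i * e) (kdiff n F a S)) \<in> kchain n i"
    by (rule kchain_comp[OF k, where \<phi>="trunc (s - i * e)"]) simp
  moreover have "trunc r (trunc r p) = trunc r p" for r and p :: "'a mpoly"
    by (rule restrict_keys_id) (simp add: keys_restrict_keys)
  ultimately show ?thesis by (simp add: tchain_def eq[abs_def])
qed

section \<open>Exactness and ranks of the truncated complex\<close>

locale koszul_initial_forms =
  fixes n e N :: nat and \<nu> :: "nat \<Rightarrow> 'n::finite" and P F :: "nat \<Rightarrow> 'n mpoly" and q :: "nat \<Rightarrow> nat \<Rightarrow> 'n mpoly"
  assumes inj: "inj_on \<nu> {..<n}"
    and gen: "\<And>k. k < n \<Longrightarrow> mp_var (\<nu> k) ^ N = (\<Sum>j<n. q k j * P j)"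
    and hom: "\<And>j. j < n \<Longrightarrow> homog e (P j)"
    and init: "\<And>j. j < n \<Longrightarrow> F j - P j \<in> ord_ge (Suc e)"
begin

lemma F_ord_ge: "j < n \<Longrightarrow> F j \<in> ord_ge e"
  using ord_ge_add[OF ord_ge_mono[OF init] homog_ord_ge[OF hom], of j j] by simp

text \<open>A chain whose boundary has high order is corrected by boundaries, one degree at a time:
  its lowest homogeneous part is a cycle for the initial forms \<open>P\<close>, hence a boundary.\<close>

lemma strictly_exact:
  assumes a: "a \<in> kchain n (Suc i)"
    and da: "\<And>S. kdiff n F a S \<in> ord_ge (s - i * e)" and r: "r \<le> s - Suc i * e"
  shows "\<exists>b\<in>kchain n (Suc (Suc i)). \<forall>S. a S - kdiff n F b S \<in> ord_ge r"
  using r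
proof (induction r)
  case 0
  then show ?case by (intro bexI[of _ "\<lambda>S. 0"]) auto
next
  case (Suc r)
  then obtain b where b: "b \<in> kchain n (Suc (Suc i))" "\<And>S. a S - kdiff n F b S \<in> ord_ge r" by auto
  define a' where "a' S = a S - kdiff n F b S" for S
  have a': "a' \<in> kchain n (Suc i)"
    unfolding a'_def[abs_def] by (intro kchain_diff a kdiff_kchain b)
  have hp: "(\<lambda>S. hpart r (a' S)) \<in> kchain n (Suc i)"
    by (rule kchain_comp[OF a', where \<phi>="hpart r"]) simp
  have cycle: "kdiff n P (\<lambda>S. hpart r (a' S)) S = 0" for S
  proof (cases "S \<subseteq> {..<n}")
    case True
    then have fin: "finite S" using finite_subset by blast
    have "kdiff n F a' S = kdiff n F a S"
      unfolding a'_def[abs_def] by (simp add: kdiff_diff kdiff_kdiff[OF fin])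
    moreover have "Suc (e + r) \<le> s - i * e" using Suc.prems by simp
    ultimately have Fa: "kdiff n F a' S \<in> ord_ge (Suc (e + r))"
      using ord_ge_mono[OF da] by simp
    \<comment> \<open>The boundary for \<open>F\<close> has order above \<open>e + r\<close>, and
      \<open>F j - P j\<close> raises the order of \<open>a'\<close> by \<open>Suc e\<close>. Hence
      the boundary for \<open>P\<close> also has order above \<open>e + r\<close>, and its component
      of degree \<open>e + r\<close>, the boundary of the lowest part of \<open>a'\<close>, is
      zero.\<close>
    have "kdiff n (\<lambda>j. F j - P j) a' S \<in> ord_ge (Suc e + r)"
      by (rule kdiff_ord_ge) (use init b in \<open>auto simp: a'_def\<close>)
    with Fa have "kdiff n F a' S - kdiff n (\<lambda>j. F j - P j) a' S \<in> ord_ge (Suc (e + r))"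
      by (intro ord_ge_diff) auto
    then have Pa: "kdiff n P a' S \<in> ord_ge (Suc (e + r))"
      by (simp add: kdiff_op_diff[symmetric])
    have "kdiff n P (\<lambda>S. restrict_keys (\<lambda>\<alpha>. total_degree \<alpha> + e = r + e) (a' S)) S = hpart (r + e) (kdiff n P a' S)"
      by (rule kdiff_hom_part[symmetric, where Q="\<lambda>d. d = r + e"]) (rule hom)
    also have "\<dots> = 0"
      by (rule homog_ord_ge_eq_0[OF homog_hpart, of _ _ "Suc (e + r)"])
         (use Pa in \<open>auto simp: ord_ge_def keys_restrict_keys\<close>)
    finally show ?thesis by simp
  next
    case False
    then show ?thesis using kchainD[OF kdiff_kchain[OF hp]] by blast
  qed
  obtain c where c: "c \<in> kchain n (Suc (Suc i))" "\<And>S. hpart r (a' S) = kdiff n P c S"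
    by (rule koszul_exact[OF inj gen zero_less_Suc hp cycle]) auto
  \<comment> \<open>Only the component of degree \<open>r - e\<close> of \<open>c\<close>
    contributes to a boundary of degree \<open>r\<close>. Keeping just this one ensures that
    replacing \<open>P\<close> by \<open>F\<close> disturbs only degrees above \<open>r\<close>; for
    \<open>r < e\<close> it is zero.\<close>
  define c' where "c' S = restrict_keys (\<lambda>\<alpha>. total_degree \<alpha> + e = r) (c S)" for S
  have c': "c' \<in> kchain n (Suc (Suc i))"
    unfolding c'_def[abs_def] by (rule kchain_comp[OF c(1), where \<phi>="restrict_keys (\<lambda>\<alpha>. total_degree \<alpha> + e = r)"]) simp
  have hc: "hpart r (a' S) = kdiff n P c' S" for S
  proof -
    have "hpart r (a' S) = hpart r (hpart r (a' S))" by (rule restrict_keys_id[symmetric]) (simp add: keys_restrict_keys)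
    also have "\<dots> = kdiff n P c' S"
      unfolding c(2) c'_def[abs_def] by (rule kdiff_hom_part[where Q="\<lambda>d. d = r"]) (rule hom)
    finally show ?thesis .
  qed
  have "kdiff n (\<lambda>j. F j - P j) c' S \<in> ord_ge (Suc r)" for S
  proof (cases "e \<le> r")
    case True
    have "c' S \<in> ord_ge (r - e)" for S by (auto simp: c'_def ord_ge_def keys_restrict_keys)
    then have "kdiff n (\<lambda>j. F j - P j) c' S \<in> ord_ge (Suc e + (r - e))"
      by (intro kdiff_ord_ge init)
    with True show ?thesis by simp
  next
    case False
    then have "c' = (\<lambda>S. 0)" unfolding c'_def by (intro ext restrict_keys_none) auto
    then show ?thesis by simp
  qed
  then have "a' S - hpart r (a' S) - kdiff n (\<lambda>j. F j - P j) c' S \<in> ord_ge (Suc r)" for S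
    using b(2) by (intro ord_ge_diff diff_hpart_ord_ge) (auto simp: a'_def)
  then have "a S - kdiff n F (\<lambda>S. b S + c' S) S \<in> ord_ge (Suc r)" for S
    unfolding hc kdiff_op_diff[symmetric] kdiff_add by (simp add: a'_def diff_diff_eq)
  with kchain_add[OF b(1) c'] show ?case by blast
qed

text \<open>Truncating before or after the differential agrees in the degrees kept, so the vanishing
  of the square survives. Conversely, \<open>strictly_exact\<close> at its largest admissible
  \<open>r\<close> gives a preimage up to terms that the truncation removes.\<close>

lemma tdiff_exact: "{a \<in> tchain n e s (Suc i). tdiff n e s F a = 0} = tdiff n e s F ` tchain n e s (Suc (Suc i))"
proof (intro equalityI subsetI)
  fix a assume "a \<in> tdiff n e s F ` tchain n e s (Suc (Suc i))"
  then obtain b where b: "b \<in> tchain n e s (Suc (Suc i))" "a = tdiff n e s F b" by auto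
  have a: "a \<in> tchain n e s (Suc i)" using b by (simp add: tdiff_tchain)
  have "tdiff n e s F a S = 0" for S
  proof (cases "S \<subseteq> {..<n}")
    case True
    then have fin: "finite S" using finite_subset by blast
    have "kdiff n F (kdiff n F b) S - kdiff n F a S \<in> ord_ge (s - card S * e)"
      unfolding b(2) tdiff_def[abs_def] by (rule kdiff_trunc_diff[OF F_ord_ge fin])
    then have "kdiff n F a S \<in> ord_ge (s - card S * e)"
      using ord_ge_uminus by (fastforce simp: kdiff_kdiff[OF fin])
    then show ?thesis by (simp add: tdiff_def trunc_eq_0_iff)
  next
    case False
    then show ?thesis using tdiff_tchain[OF a, of F] kchainD[of "tdiff n e s F a" n i S] by (auto simp: tchain_def)
  qed
  with a show "a \<in> {a \<in> tchain n e s (Suc i). tdiff n e s F a = 0}" by (auto simp: fun_eq_iff)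
next
  fix a assume "a \<in> {a \<in> tchain n e s (Suc i). tdiff n e s F a = 0}"
  then have a: "a \<in> kchain n (Suc i)" "\<And>S. trunc (s - Suc i * e) (a S) = a S"
    and da: "tdiff n e s F a = 0" by (auto simp: tchain_def)
  have "kdiff n F a S \<in> ord_ge (s - i * e)" for S
  proof (cases "kdiff n F a S = 0")
    case False
    then have "card S = i" using kchainD[OF kdiff_kchain[OF a(1)]] by blast
    moreover have "tdiff n e s F a S = 0" using da by (simp add: fun_eq_iff)
    ultimately show ?thesis by (simp add: tdiff_def trunc_eq_0_iff)
  qed simp
  from strictly_exact[OF a(1) this order_refl]
  obtain b where b: "b \<in> kchain n (Suc (Suc i))" "\<And>S. a S - kdiff n F b S \<in> ord_ge (s - Suc i * e)" by auto
  \<comment> \<open>The preimage need not respect the degree bound of its homological degree;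
    cutting it down changes its boundary only in degrees that are discarded.\<close>
  define b' where "b' S = trunc (s - card S * e) (b S)" for S
  have eq: "b' S = trunc (s - Suc (Suc i) * e) (b S)" for S
    by (cases "b S = 0") (use kchainD[OF b(1)] in \<open>auto simp: b'_def\<close>)
  have "(\<lambda>S. trunc (s - Suc (Suc i) * e) (b S)) \<in> kchain n (Suc (Suc i))"
    by (rule kchain_comp[OF b(1), where \<phi>="trunc (s - Suc (Suc i) * e)"]) simp
  then have b': "b' \<in> tchain n e s (Suc (Suc i))"
    by (auto simp: tchain_def eq[abs_def] keys_restrict_keys intro!: restrict_keys_id)
  have "tdiff n e s F b' S = a S" for S
  proof (cases "S \<subseteq> {..<n} \<and> card S = Suc i")
    case True
    then have fin: "finite S" using finite_subset by blast
    have "kdiff n F b S - kdiff n F b' S \<in> ord_ge (s - Suc i * e)"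
      using kdiff_trunc_diff[OF F_ord_ge fin, where a=b and s=s] True by (simp add: b'_def[abs_def])
    with b(2)[of S] have "(a S - kdiff n F b S) + (kdiff n F b S - kdiff n F b' S) \<in> ord_ge (s - Suc i * e)"
      by (rule ord_ge_add)
    then have "trunc (s - Suc i * e) (a S) = trunc (s - Suc i * e) (kdiff n F b' S)"
      by (simp only: trunc_eq_iff diff_add_cancel add_diff_eq)
    then show ?thesis using a(2) True by (simp add: tdiff_def)
  next
    case False
    then have "a S = 0" using kchainD[OF a(1)] by blast
    moreover have "tdiff n e s F b' \<in> kchain n (Suc i)"
      using tdiff_tchain[OF b'] by (simp add: tchain_def)
    then have "tdiff n e s F b' S = 0" using kchainD False by blast
    ultimately show ?thesis by simp
  qed
  then show "a \<in> tdiff n e s F ` tchain n e s (Suc (Suc i))"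
    by (intro image_eqI[OF _ b']) auto
qed

lemma dim_tdiff_image:
  "kc.dim (tdiff n e s F ` tchain n e s (Suc i)) + kc.dim (tdiff n e s F ` tchain n e s (Suc (Suc i))) =
    kc.dim (tchain n e s (Suc i) :: (nat set \<Rightarrow> 'n mpoly) set)"
proof -
  obtain T :: "(nat set \<Rightarrow> 'n mpoly) set" where "finite T" "tchain n e s (Suc i) \<subseteq> kc.span T"
    by (rule tchain_subset_span)
  from kc.dim_image_add_dim_kernel[OF linear_tdiff[of n e s F] subspace_tchain this]
  show ?thesis by (simp only: tdiff_exact)
qed

end

text \<open>By exactness two consecutive ranks add up to the dimension of a chain space, which does
  not involve \<open>F\<close>. Descending from degree \<open>n + 1\<close>, where there are no
  nonzero chains, this determines every rank.\<close>

lemma dim_tdiff_image_unique: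
  fixes P P' F F' :: "nat \<Rightarrow> 'n::finite mpoly"
  assumes F: "koszul_initial_forms n e N \<nu> P F q" and F': "koszul_initial_forms n e N' \<nu>' P' F' q'"
    and "i \<le> n"
  shows "kc.dim (tdiff n e s F ` tchain n e s (Suc i)) = kc.dim (tdiff n e s F' ` tchain n e s (Suc i))"
  using assms(3)
proof (induction i rule: inc_induct)
  case base
  have "tdiff n e s G ` tchain n e s (Suc n) = {0}" for G :: "nat \<Rightarrow> 'n mpoly"
  proof -
    have "tchain n e s (Suc n) = ({0} :: (nat set \<Rightarrow> 'n mpoly) set)"
      using kc.subspace_0[OF subspace_tchain] kchain_eq_zero[of n "Suc n"]
      by (fastforce simp: tchain_def fun_eq_iff)
    then show ?thesis by (simp add: tdiff_def[abs_def] zero_fun_def)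
  qed
  then show ?case by simp
next
  case (step i)
  with koszul_initial_forms.dim_tdiff_image[OF F, of s i]
    koszul_initial_forms.dim_tdiff_image[OF F', of s i]
  show ?case by simp
qed

section \<open>The Milnor algebra\<close>

lemma germ_hom: "germ \<in> ring_hom local_smooth_ring (germ_ring :: (real^'n::finite \<Rightarrow> real) set ring)"
proof -
  interpret ideal null_germs "local_smooth_ring :: (real^'n \<Rightarrow> real) ring" by (rule ideal_null_germs)
  show ?thesis using rcos_ring_hom unfolding germ_ring_def germ_def[abs_def] .
qed

lemma germ_closed: "smooth_germ f \<Longrightarrow> germ f \<in> carrier germ_ring"
  using ring_hom_closed[OF germ_hom, of f] by (simp add: local_smooth_ring_def)

lemma germ_add: "smooth_germ f \<Longrightarrow> smooth_germ g \<Longrightarrow> germ (\<lambda>x. f x + g x) = germ f \<oplus>\<^bsub>germ_ring\<^esub> germ g"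
  using ring_hom_add[OF germ_hom, of f g] by (simp add: local_smooth_ring_def)

lemma germ_mult: "smooth_germ f \<Longrightarrow> smooth_germ g \<Longrightarrow> germ (\<lambda>x. f x * g x) = germ f \<otimes>\<^bsub>germ_ring\<^esub> germ g"
  using ring_hom_mult[OF germ_hom, of f g] by (simp add: local_smooth_ring_def)

lemma germ_one: "germ (\<lambda>x. 1) = \<one>\<^bsub>germ_ring\<^esub>"
  using ring_hom_one[OF germ_hom] by (simp add: local_smooth_ring_def)

lemma germ_zero: "germ (\<lambda>x :: real^'n::finite. 0) = \<zero>\<^bsub>germ_ring\<^esub>"
proof -
  interpret cring "germ_ring :: (real^'n \<Rightarrow> real) set ring" by (rule cring_germ_ring)
  have "germ (\<lambda>x :: real^'n. 0) \<oplus>\<^bsub>germ_ring\<^esub> germ (\<lambda>x. 0) = germ (\<lambda>x. 0)"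
    using germ_add[of "\<lambda>x :: real^'n. 0" "\<lambda>x. 0"] by (simp add: smooth_germ_const)
  then show ?thesis
    using germ_closed[OF smooth_germ_const[of 0]] add.r_cancel_one' by metis
qed

lemma germ_uminus: "smooth_germ (f :: real^'n::finite \<Rightarrow> real) \<Longrightarrow> germ (\<lambda>x. - f x) = \<ominus>\<^bsub>germ_ring\<^esub> germ f"
proof -
  interpret cring "germ_ring :: (real^'n \<Rightarrow> real) set ring" by (rule cring_germ_ring)
  assume f: "smooth_germ f"
  have "germ (\<lambda>x. - f x) \<oplus>\<^bsub>germ_ring\<^esub> germ f = \<zero>\<^bsub>germ_ring\<^esub>"
    using germ_add[OF smooth_germ_uminus[OF f] f] by (simp add: germ_zero)
  then show ?thesis
    using germ_closed[OF f] germ_closed[OF smooth_germ_uminus[OF f]] by (metis minus_equality)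
qed

lemma carrier_germ_ring: "carrier (germ_ring :: (real^'n::finite \<Rightarrow> real) set ring) = germ ` Collect smooth_germ"
  unfolding germ_ring_def FactRing_def A_RCOSETS_def RCOSETS_def germ_def[abs_def] a_r_coset_def
  by (auto simp: local_smooth_ring_def)

lemma germ_mem_image_iff:
  assumes "smooth_germ h"
  shows "germ h \<in> germ ` germ_span A v \<longleftrightarrow> h \<in> germ_span A v"
proof
  assume "germ h \<in> germ ` germ_span A v"
  then obtain k where k: "k \<in> germ_span A v" "germ k = germ h" by auto
  then have "\<forall>\<^sub>F x in nhds 0. k x = h x"
    using germ_eq_iff[OF germ_span_smooth[OF k(1)] assms] by simp
  with k(1) show "h \<in> germ_span A v" by (rule germ_span_cong)
qed simp

text \<open>The generated ideal is defined as an intersection of ideals; with explicit coefficients,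
  membership becomes an equation between functions near 0.\<close>

lemma genideal_germ:
  fixes F :: "'n \<Rightarrow> real^'n::finite \<Rightarrow> real"
  assumes F: "\<And>i. smooth_germ (F i)"
  shows "Idl\<^bsub>germ_ring\<^esub> (range (\<lambda>i. germ (F i))) = germ ` germ_span UNIV F"
proof -
  interpret cring "germ_ring :: (real^'n \<Rightarrow> real) set ring" by (rule cring_germ_ring)
  have S: "range (\<lambda>i. germ (F i)) \<subseteq> carrier germ_ring"
    using F germ_closed by auto
  interpret I: ideal "Idl\<^bsub>germ_ring\<^esub> (range (\<lambda>i. germ (F i)))" germ_ring
    by (rule genideal_ideal[OF S])
  have "ideal (germ ` germ_span UNIV F) germ_ring"
  proof (rule idealI)
    show "subgroup (germ ` germ_span UNIV F) (add_monoid germ_ring)"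
    proof (rule add.subgroupI)
      show "germ ` germ_span UNIV F \<subseteq> carrier germ_ring"
        using germ_closed germ_span_smooth by blast
      show "germ ` germ_span UNIV F \<noteq> {}" using germ_span_zero by blast
      fix a assume "a \<in> germ ` germ_span UNIV F"
      then obtain h where h: "h \<in> germ_span UNIV F" "a = germ h" by auto
      have "\<ominus>\<^bsub>germ_ring\<^esub> a = germ (\<lambda>x. - h x)"
        using h by (simp add: germ_uminus germ_span_smooth)
      moreover have "(\<lambda>x. - h x) \<in> germ_span UNIV F"
        using germ_span_diff[OF germ_span_zero h(1)] by simp
      ultimately show "\<ominus>\<^bsub>germ_ring\<^esub> a \<in> germ ` germ_span UNIV F" by blast
      fix b assume "b \<in> germ ` germ_span UNIV F"
      then obtain k where k: "k \<in> germ_span UNIV F" "b = germ k" by auto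
      have "a \<oplus>\<^bsub>germ_ring\<^esub> b = germ (\<lambda>x. h x + k x)"
        using h k by (simp add: germ_add germ_span_smooth)
      then show "a \<oplus>\<^bsub>germ_ring\<^esub> b \<in> germ ` germ_span UNIV F"
        using germ_span_add[OF h(1) k(1)] by blast
    qed
    fix a c :: "(real^'n \<Rightarrow> real) set" assume "a \<in> germ ` germ_span UNIV F" and c: "c \<in> carrier germ_ring"
    then obtain h k where h: "h \<in> germ_span UNIV F" "a = germ h" and k: "smooth_germ k" "c = germ k"
      by (auto simp: carrier_germ_ring)
    have "c \<otimes>\<^bsub>germ_ring\<^esub> a = germ (\<lambda>x. k x * h x)"
      using h k by (simp add: germ_mult germ_span_smooth)
    then show "c \<otimes>\<^bsub>germ_ring\<^esub> a \<in> germ ` germ_span UNIV F"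
      using germ_span_mult[OF k(1) h(1)] by blast
    moreover have "a \<in> carrier germ_ring" using h germ_closed germ_span_smooth by blast
    ultimately show "a \<otimes>\<^bsub>germ_ring\<^esub> c \<in> germ ` germ_span UNIV F"
      using m_comm c by metis
  qed (rule ring_axioms)
  moreover have "germ (F i) \<in> germ ` germ_span UNIV F" for i
    using germ_span_base[of UNIV i F] F by simp
  ultimately have "Idl\<^bsub>germ_ring\<^esub> (range (\<lambda>i. germ (F i))) \<subseteq> germ ` germ_span UNIV F"
    by (intro genideal_minimal) auto
  moreover have "germ h \<in> Idl\<^bsub>germ_ring\<^esub> (range (\<lambda>i. germ (F i)))" if "h \<in> germ_span UNIV F" for h
  proof -
    from that obtain a where a: "\<And>i. smooth_germ (a i)" "\<forall>\<^sub>F x in nhds 0. h x = (\<Sum>i\<in>UNIV. a i x * F i x)"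
      by (rule germ_spanE) (rule that)
    have s: "smooth_germ (\<lambda>x. \<Sum>i\<in>A. a i x * F i x)" for A
      by (intro smooth_germ_sum smooth_germ_mult a F)
    have "germ (\<lambda>x. \<Sum>i\<in>A. a i x * F i x) \<in> Idl\<^bsub>germ_ring\<^esub> (range (\<lambda>i. germ (F i)))" if "finite A" for A
      using that
    proof (induction A rule: finite_induct)
      case empty
      then show ?case by (simp add: germ_zero)
    next
      case (insert j A)
      have "germ (F j) \<in> Idl\<^bsub>germ_ring\<^esub> (range (\<lambda>i. germ (F i)))"
        using genideal_self[OF S] by auto
      then have "germ (a j) \<otimes>\<^bsub>germ_ring\<^esub> germ (F j) \<oplus>\<^bsub>germ_ring\<^esub> germ (\<lambda>x. \<Sum>i\<in>A. a i x * F i x)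
          \<in> Idl\<^bsub>germ_ring\<^esub> (range (\<lambda>i. germ (F i)))"
        by (intro I.a_closed I.I_l_closed insert.IH germ_closed a)
      then show ?case
        using insert.hyps by (simp add: germ_add germ_mult smooth_germ_mult a F s)
    qed
    from this[of UNIV] show ?thesis
      using germ_eq_iff[OF germ_span_smooth[OF that] s[of UNIV]] a(2) by simp
  qed
  ultimately show ?thesis by blast
qed

abbreviation jac :: "(real^'n::finite \<Rightarrow> real) \<Rightarrow> (real^'n \<Rightarrow> real) set" where
  "jac f \<equiv> germ_span UNIV (\<lambda>i. partial_deriv i f)"

lemma jacobian_ideal_eq: "smooth_germ f \<Longrightarrow> jacobian_ideal f = germ ` jac f"
  unfolding jacobian_ideal_def by (intro genideal_germ smooth_germ_partial_deriv)

lemma ideal_jacobian_ideal: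
  assumes "smooth_germ (f :: real^'n::finite \<Rightarrow> real)"
  shows "ideal (jacobian_ideal f) germ_ring"
proof -
  interpret cring "germ_ring :: (real^'n \<Rightarrow> real) set ring" by (rule cring_germ_ring)
  show ?thesis unfolding jacobian_ideal_def
    by (rule genideal_ideal) (use assms germ_closed smooth_germ_partial_deriv in auto)
qed

lemma cring_milnor_algebra: "smooth_germ f \<Longrightarrow> cring (milnor_algebra f)"
  unfolding milnor_algebra_def
  by (rule ideal.quotient_is_cring[OF ideal_jacobian_ideal cring_germ_ring])

section \<open>Residue classes and scalars in the Milnor algebra\<close>

definition milnor_class :: "(real^'n::finite \<Rightarrow> real) \<Rightarrow> (real^'n \<Rightarrow> real) \<Rightarrow> (real^'n \<Rightarrow> real) set set" where
  "milnor_class f h = jacobian_ideal f +>\<^bsub>germ_ring\<^esub> germ h"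

context
  fixes f :: "real^'n::finite \<Rightarrow> real"
  assumes f: "smooth_germ f"
begin

lemma milnor_class_hom: "(\<lambda>a. jacobian_ideal f +>\<^bsub>germ_ring\<^esub> a) \<in> ring_hom germ_ring (milnor_algebra f)"
  unfolding milnor_algebra_def by (rule ideal.rcos_ring_hom[OF ideal_jacobian_ideal[OF f]])

lemma carrier_milnor_algebra: "carrier (milnor_algebra f) = milnor_class f ` Collect smooth_germ"
  unfolding milnor_algebra_def FactRing_def A_RCOSETS_def RCOSETS_def milnor_class_def[abs_def] a_r_coset_def
  using carrier_germ_ring by auto

lemma milnor_class_closed: "smooth_germ h \<Longrightarrow> milnor_class f h \<in> carrier (milnor_algebra f)"
  by (simp add: carrier_milnor_algebra)

lemma milnor_class_add: "smooth_germ a \<Longrightarrow> smooth_germ b \<Longrightarrow>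
    milnor_class f (\<lambda>x. a x + b x) = milnor_class f a \<oplus>\<^bsub>milnor_algebra f\<^esub> milnor_class f b"
  using ring_hom_add[OF milnor_class_hom germ_closed germ_closed, of a b] by (simp add: milnor_class_def germ_add)

lemma milnor_class_mult: "smooth_germ a \<Longrightarrow> smooth_germ b \<Longrightarrow>
    milnor_class f (\<lambda>x. a x * b x) = milnor_class f a \<otimes>\<^bsub>milnor_algebra f\<^esub> milnor_class f b"
  using ring_hom_mult[OF milnor_class_hom germ_closed germ_closed, of a b] by (simp add: milnor_class_def germ_mult)

lemma milnor_class_one: "milnor_class f (\<lambda>x. 1) = \<one>\<^bsub>milnor_algebra f\<^esub>"
  using ring_hom_one[OF milnor_class_hom] by (simp add: milnor_class_def germ_one)

lemma milnor_class_zero: "milnor_class f (\<lambda>x. 0) = \<zero>\<^bsub>milnor_algebra f\<^esub>"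
  using ring_hom_zero[OF milnor_class_hom cring.axioms(1)[OF cring_germ_ring] cring.axioms(1)[OF cring_milnor_algebra[OF f]]]
  by (simp add: milnor_class_def germ_zero)

lemma milnor_class_eq_iff:
  assumes "smooth_germ a" "smooth_germ b"
  shows "milnor_class f a = milnor_class f b \<longleftrightarrow> (\<lambda>x. a x - b x) \<in> jac f"
proof -
  interpret cring "germ_ring :: (real^'n \<Rightarrow> real) set ring" by (rule cring_germ_ring)
  have "germ a \<ominus>\<^bsub>germ_ring\<^esub> germ b = germ (\<lambda>x. a x - b x)"
    using germ_add[OF assms(1) smooth_germ_uminus[OF assms(2)]]
    by (simp add: a_minus_def germ_uminus assms)
  then show ?thesis
    using quotient_eq_iff_same_a_r_cos[OF ideal_jacobian_ideal[OF f] germ_closed germ_closed, of a b] assms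
    by (simp add: milnor_class_def jacobian_ideal_eq[OF f] germ_mem_image_iff smooth_germ_diff)
qed

lemma milnor_class_eq_zero_iff: "smooth_germ a \<Longrightarrow> milnor_class f a = \<zero>\<^bsub>milnor_algebra f\<^esub> \<longleftrightarrow> a \<in> jac f"
  using milnor_class_eq_iff[of a "\<lambda>x. 0"] by (simp add: milnor_class_zero smooth_germ_const)

lemma milnor_scalars_eq: "milnor_scalars f = range (\<lambda>c. milnor_class f (\<lambda>x. c))"
  by (simp add: milnor_scalars_def milnor_class_def)

text \<open>A nonzero constant in the Jacobian ideal would put 1 there. So, for a proper ideal, the
  constants embed and have inverses.\<close>

lemma subfield_milnor_scalars:
  assumes "(\<lambda>x. 1) \<notin> jac f"
  shows "subfield (milnor_scalars f) (milnor_algebra f)"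
proof -
  let ?R = "milnor_algebra f" and ?\<kappa> = "\<lambda>c :: real. milnor_class f (\<lambda>x. c)"
  interpret cring ?R by (rule cring_milnor_algebra[OF f])
  have add: "?\<kappa> (a + b) = ?\<kappa> a \<oplus>\<^bsub>?R\<^esub> ?\<kappa> b" and mult: "?\<kappa> (a * b) = ?\<kappa> a \<otimes>\<^bsub>?R\<^esub> ?\<kappa> b" for a b
    by (simp_all add: milnor_class_add milnor_class_mult smooth_germ_const)
  have closed: "?\<kappa> c \<in> carrier ?R" for c by (simp add: milnor_class_closed smooth_germ_const)
  have uminus: "\<ominus>\<^bsub>?R\<^esub> ?\<kappa> c = ?\<kappa> (- c)" for c
    by (rule minus_equality) (simp_all add: add[symmetric] milnor_class_zero closed)
  have zero_iff: "?\<kappa> c = \<zero>\<^bsub>?R\<^esub> \<longleftrightarrow> c = 0" for c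
  proof
    assume "?\<kappa> c = \<zero>\<^bsub>?R\<^esub>"
    then have "(\<lambda>x. c) \<in> jac f" by (simp add: milnor_class_eq_zero_iff smooth_germ_const)
    from germ_span_mult[OF smooth_germ_const[of "inverse c"] this] assms show "c = 0" by (cases "c = 0") auto
  qed (simp add: milnor_class_zero)
  have sub: "subring (range ?\<kappa>) ?R"
  proof (rule subringI)
    show "\<one>\<^bsub>?R\<^esub> \<in> range ?\<kappa>" by (metis milnor_class_one rangeI)
  qed (auto simp: closed uminus add[symmetric] mult[symmetric])
  have "Units (?R\<lparr>carrier := range ?\<kappa>\<rparr>) = range ?\<kappa> - {\<zero>\<^bsub>?R\<^esub>}"
  proof (intro equalityI subsetI)
    fix k assume "k \<in> Units (?R\<lparr>carrier := range ?\<kappa>\<rparr>)"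
    then obtain a b where ab: "k = ?\<kappa> a" "?\<kappa> b \<otimes>\<^bsub>?R\<^esub> ?\<kappa> a = \<one>\<^bsub>?R\<^esub>"
      by (auto simp: Units_def)
    have "a \<noteq> 0"
    proof
      assume "a = 0"
      with ab(2) have "?\<kappa> 0 = ?\<kappa> 1" by (simp add: mult[symmetric] milnor_class_one[symmetric])
      then have "?\<kappa> 1 = \<zero>\<^bsub>?R\<^esub>" by (simp add: milnor_class_zero)
      then show False using zero_iff[of 1] by simp
    qed
    with ab(1) zero_iff show "k \<in> range ?\<kappa> - {\<zero>\<^bsub>?R\<^esub>}" by auto
  next
    fix k assume "k \<in> range ?\<kappa> - {\<zero>\<^bsub>?R\<^esub>}"
    then obtain a where a: "k = ?\<kappa> a" "a \<noteq> 0" using zero_iff by auto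
    then have "?\<kappa> (inverse a) \<otimes>\<^bsub>?R\<^esub> k = \<one>\<^bsub>?R\<^esub>" "k \<otimes>\<^bsub>?R\<^esub> ?\<kappa> (inverse a) = \<one>\<^bsub>?R\<^esub>"
      by (simp_all add: mult[symmetric] milnor_class_one[symmetric])
    then show "k \<in> Units (?R\<lparr>carrier := range ?\<kappa>\<rparr>)"
      unfolding Units_def using a(1) by auto
  qed
  then show ?thesis
    unfolding milnor_scalars_eq by (intro subfieldI subcringI' sub)
qed

lemma combine_milnor_class:
  assumes "\<And>k. smooth_germ (h k)"
  shows "ring.combine (milnor_algebra f) (map (\<lambda>k. milnor_class f (\<lambda>x. c k)) ks) (map (\<lambda>k. milnor_class f (h k)) ks) =
    milnor_class f (\<lambda>x. \<Sum>k\<leftarrow>ks. c k * h k x)"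
proof -
  interpret cring "milnor_algebra f" by (rule cring_milnor_algebra[OF f])
  have s: "smooth_germ (\<lambda>x. \<Sum>k\<leftarrow>ks. c k * h k x)" for ks
    by (induction ks) (simp_all add: smooth_germ_const smooth_germ_add smooth_germ_mult assms)
  show ?thesis
    by (induction ks) (simp_all add: milnor_class_zero milnor_class_add milnor_class_mult smooth_germ_mult smooth_germ_const assms s)
qed

text \<open>In a space of dimension \<open>d\<close> any \<open>d + 1\<close> classes are dependent;
  the dependence is lifted to real coefficients and read as membership in the Jacobian
  ideal.\<close>

lemma algebraically_isolated_relation:
  assumes "algebraically_isolated f" "\<And>k. smooth_germ (h k)"
  obtains c d k where "(\<lambda>x. \<Sum>k<Suc d. c k * h k x) \<in> jac f" "k < Suc d" "c k \<noteq> 0"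
proof (cases "(\<lambda>x. 1) \<in> jac f")
  case True
  \<comment> \<open>In the zero algebra the scalars are no field, but the relation with the single
    term \<open>h 0\<close> holds.\<close>
  have "(\<lambda>x. h 0 x * 1) \<in> jac f" by (rule germ_span_mult[OF assms(2) True])
  then show ?thesis by (intro that[of "\<lambda>_. 1" 0 0]) auto
next
  case False
  let ?R = "milnor_algebra f" and ?K = "milnor_scalars f"
  interpret cring ?R by (rule cring_milnor_algebra[OF f])
  have K: "subfield ?K ?R" by (rule subfield_milnor_scalars[OF False])
  from assms(1) have "finite_dimension ?K (carrier ?R)"
    by (auto simp: algebraically_isolated_def milnor_number_def split: if_splits)
  then obtain d where d: "dimension d ?K (carrier ?R)" by (auto simp: finite_dimension_def)
  let ?Us = "map (\<lambda>k. milnor_class f (h k)) [0..<Suc d]"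
  have Us: "set ?Us \<subseteq> carrier ?R" by (auto intro: milnor_class_closed assms(2))
  have "dependent ?K ?Us"
    using independent_length_le_dimension[OF K d, of ?Us] Us by fastforce
  from dependent_imp_non_trivial_combine[OF K Us this]
  obtain Ks where Ks: "length Ks = length ?Us" "combine Ks ?Us = \<zero>\<^bsub>?R\<^esub>" "set Ks \<subseteq> ?K" "set Ks \<noteq> {\<zero>\<^bsub>?R\<^esub>}" .
  have "\<forall>k<Suc d. \<exists>c. Ks ! k = milnor_class f (\<lambda>x. c)"
  proof (intro allI impI)
    fix k assume "k < Suc d"
    then have "Ks ! k \<in> ?K" using Ks(1,3) by (auto simp: subset_eq)
    then show "\<exists>c. Ks ! k = milnor_class f (\<lambda>x. c)" by (auto simp: milnor_scalars_eq)
  qed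
  then obtain c where c: "\<And>k. k < Suc d \<Longrightarrow> Ks ! k = milnor_class f (\<lambda>x. c k)" by metis
  have Ks_eq: "Ks = map (\<lambda>k. milnor_class f (\<lambda>x. c k)) [0..<Suc d]"
    using Ks(1) c by (intro nth_equalityI) (simp_all del: upt_Suc)
  have "\<exists>k<Suc d. c k \<noteq> 0"
  proof (rule ccontr)
    assume "\<not> (\<exists>k<Suc d. c k \<noteq> 0)"
    then have "milnor_class f (\<lambda>x. c k) = \<zero>\<^bsub>?R\<^esub>" if "k < Suc d" for k using that by (simp add: milnor_class_zero)
    then have "set Ks = {\<zero>\<^bsub>?R\<^esub>}" unfolding Ks_eq by (force simp del: upt_Suc)
    with Ks(4) show False by simp
  qed
  then obtain k where k: "k < Suc d" "c k \<noteq> 0" by blast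
  have sum: "(\<Sum>k\<leftarrow>[0..<Suc d]. c k * h k x) = (\<Sum>k<Suc d. c k * h k x)" for x
    by (simp add: interv_sum_list_conv_sum_set_nat atLeast0LessThan del: upt_Suc)
  have "milnor_class f (\<lambda>x. \<Sum>k<Suc d. c k * h k x) = \<zero>\<^bsub>?R\<^esub>"
    using combine_milnor_class[where h=h and c=c and ks="[0..<Suc d]", OF assms(2)] Ks(2)
    unfolding Ks_eq sum by (simp only:)
  moreover have "smooth_germ (\<lambda>x. \<Sum>k<Suc d. c k * h k x)"
    by (intro smooth_germ_sum smooth_germ_mult smooth_germ_const assms(2))
  ultimately have "(\<lambda>x. \<Sum>k<Suc d. c k * h k x) \<in> jac f" by (simp add: milnor_class_eq_zero_iff)
  with k show ?thesis by (intro that)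
qed

end

text \<open>Translates between two notions of dimension. In the ring it is built up by line
  extensions, so basis vectors are adjoined one at a time, and injectivity of \<open>\<phi>\<close>
  keeps each new one outside the previous image.\<close>

lemma (in ring) dimension_image_span:
  fixes scl :: "'f::field \<Rightarrow> 'v::ab_group_add \<Rightarrow> 'v"
  assumes V: "vector_space scl"
    and hom: "\<And>x y. \<phi> (x + y) = \<phi> x \<oplus> \<phi> y" "\<And>c x. \<phi> (scl c x) = \<kappa> c \<otimes> \<phi> x" "\<And>x. \<phi> x \<in> carrier R"
    and S: "finite S" "\<not> module.dependent scl S" "inj_on \<phi> (module.span scl S)"
  shows "dimension (card S) (range \<kappa>) (\<phi> ` module.span scl S)"
proof -
  interpret V: vector_space scl by (rule V)
  have zero: "\<phi> 0 = \<zero>"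
    using hom(1)[of 0 0] hom(3)[of 0] add.r_cancel_one' by force
  show ?thesis using S
  proof (induction S rule: finite_induct)
    case empty
    then show ?case by (simp add: zero)
  next
    case (insert v S)
    have sub: "V.span S \<subseteq> V.span (insert v S)" by (rule V.span_mono) auto
    have v: "v \<in> V.span (insert v S)" by (rule V.span_base) simp
    have nv: "v \<notin> V.span S" and ind: "V.independent S"
      using insert.prems(1) insert.hyps by (auto simp: V.independent_insert)
    have "\<phi> v \<notin> \<phi> ` V.span S"
    proof
      assume "\<phi> v \<in> \<phi> ` V.span S"
      then obtain w where "w \<in> V.span S" "\<phi> v = \<phi> w" by auto
      with inj_onD[OF insert.prems(2), of v w] v sub nv show False by auto
    qed
    moreover have "dimension (card S) (range \<kappa>) (\<phi> ` V.span S)"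
      by (rule insert.IH[OF ind inj_on_subset[OF insert.prems(2) sub]])
    ultimately have "dimension (Suc (card S)) (range \<kappa>) (line_extension (range \<kappa>) (\<phi> v) (\<phi> ` V.span S))"
      by (intro Suc_dim hom)
    moreover have "line_extension (range \<kappa>) (\<phi> v) (\<phi> ` V.span S) = \<phi> ` V.span (insert v S)"
    proof (intro equalityI subsetI)
      fix u assume "u \<in> line_extension (range \<kappa>) (\<phi> v) (\<phi> ` V.span S)"
      then obtain k w where "u = \<kappa> k \<otimes> \<phi> v \<oplus> \<phi> w" and w: "w \<in> V.span S"
        by (auto simp: line_extension_mem_iff)
      then have "u = \<phi> (scl k v + w)" by (simp add: hom)
      moreover have "scl k v + w \<in> V.span (insert v S)"
        using w sub v by (intro V.span_add V.span_scale) auto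
      ultimately show "u \<in> \<phi> ` V.span (insert v S)" by blast
    next
      fix u assume "u \<in> \<phi> ` V.span (insert v S)"
      then obtain x k where x: "u = \<phi> x" "x - scl k v \<in> V.span S"
        by (auto simp: V.span_insert)
      have "u = \<phi> (scl k v + (x - scl k v))" by (simp add: x(1))
      also have "\<dots> = \<kappa> k \<otimes> \<phi> v \<oplus> \<phi> (x - scl k v)" by (simp only: hom)
      finally show "u \<in> line_extension (range \<kappa>) (\<phi> v) (\<phi> ` V.span S)"
        using x(2) by (auto simp: line_extension_mem_iff)
    qed
    ultimately show ?case using insert.hyps by simp
  qed
qed

section \<open>Invariance of the Milnor number\<close>

lemma restrict_keys_single: "restrict_keys R (Poly_Mapping.single \<alpha> c) = (if R \<alpha> then Poly_Mapping.single \<alpha> c else 0)"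
  by (rule poly_mapping_eqI) (auto simp: lookup_restrict_keys lookup_single when_def)

text \<open>Replacing the smooth coefficients by Taylor polynomials gives a polynomial relation
  modulo order \<open>Suc d\<close>. As the \<open>P j\<close> are homogeneous, its component of
  degree \<open>k\<close> is again a relation, and the only term on the left is the
  \<open>k\<close>-th power.\<close>

lemma mp_var_power_relation:
  fixes P :: "'n::finite \<Rightarrow> 'n mpoly"
  assumes hom: "\<And>j. homog e (P j)"
    and rel: "(\<lambda>x. \<Sum>k<Suc d. c k * x $ i ^ k) \<in> germ_span UNIV (\<lambda>j. mpeval (P j))"
    and k: "k < Suc d" "c k \<noteq> 0"
  shows "\<exists>q. mp_var i ^ k = (\<Sum>j\<in>UNIV. q j * P j)"
proof -
  from rel obtain a where a: "\<And>j. smooth_germ (a j)"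
    "\<forall>\<^sub>F x in nhds 0. (\<Sum>k<Suc d. c k * x $ i ^ k) = (\<Sum>j\<in>UNIV. a j x * mpeval (P j) x)"
    by (rule germ_spanE) (rule that)
  have "\<forall>j. \<exists>b. (\<lambda>x. a j x - mpeval b x) \<in> vorder (Suc d)"
    using smooth_germ_taylor[OF a(1)] by blast
  from choice[OF this] obtain b where b: "\<And>j. (\<lambda>x. a j x - mpeval (b j) x) \<in> vorder (Suc d)"
    by blast
  define H where "H = (\<Sum>k<Suc d. mp_const (c k) * mp_var i ^ k)"
  have "(\<lambda>x. (a j x - mpeval (b j) x) * mpeval (P j) x) \<in> vorder (Suc d)" for j
    using vorder_mult[OF b, of "mpeval (P j)" 0 j] by (simp add: smooth_germ_mpeval)
  then have "(\<lambda>x. \<Sum>j\<in>UNIV. (a j x - mpeval (b j) x) * mpeval (P j) x) \<in> vorder (Suc d)"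
    by (intro vorder_sum)
  then have "mpeval (H - (\<Sum>j\<in>UNIV. b j * P j)) \<in> vorder (Suc d)"
  proof (rule vorder_cong)
    from a(2) show "\<forall>\<^sub>F x in nhds 0. (\<Sum>j\<in>UNIV. (a j x - mpeval (b j) x) * mpeval (P j) x) =
        mpeval (H - (\<Sum>j\<in>UNIV. b j * P j)) x"
    proof eventually_elim
      case (elim x)
      have H: "mpeval H x = (\<Sum>k<Suc d. c k * x $ i ^ k)"
        unfolding H_def mpeval_sum mpeval_mult mpeval_power by simp
      then show ?case
        by (simp only: mpeval_diff H elim mpeval_sum mpeval_mult left_diff_distrib sum_subtractf)
    qed
  qed
  then have "H - (\<Sum>j\<in>UNIV. b j * P j) \<in> ord_ge (Suc d)" by (simp add: mpeval_vorder_iff)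
  \<comment> \<open>Since \<open>k < Suc d\<close>, the component of degree \<open>k\<close> is not
    affected by the error term.\<close>
  then have "hpart k (H - (\<Sum>j\<in>UNIV. b j * P j)) = 0"
    using k(1) by (intro restrict_keys_none) (auto simp: ord_ge_def)
  moreover have "hpart k H = mp_const (c k) * mp_var i ^ k"
  proof -
    have "hpart k (mp_const (c l) * mp_var i ^ l) = (if l = k then mp_const (c l) * mp_var i ^ l else 0)" for l
      by (simp add: mp_var_power mp_const_def mult_single restrict_keys_single)
    then have "hpart k H = (\<Sum>l<Suc d. if l = k then mp_const (c l) * mp_var i ^ l else 0)"
      unfolding H_def restrict_keys_sum by simp
    then show ?thesis using k(1) by (simp del: sum.lessThan_Suc)
  qed
  moreover have "hpart k (\<Sum>j\<in>UNIV. b j * P j) = (\<Sum>j\<in>UNIV. restrict_keys (\<lambda>\<alpha>. total_degree \<alpha> + e = k) (b j) * P j)"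
    unfolding restrict_keys_sum
  proof (rule sum.cong)
    show "hpart k (b j * P j) = restrict_keys (\<lambda>\<alpha>. total_degree \<alpha> + e = k) (b j) * P j" for j
      using restrict_keys_mult_homog[OF hom[of j], where Q="\<lambda>d. d = k" and p="b j"] by (simp only: mult.commute)
  qed simp
  ultimately have "mp_const (c k) * mp_var i ^ k = (\<Sum>j\<in>UNIV. restrict_keys (\<lambda>\<alpha>. total_degree \<alpha> + e = k) (b j) * P j)"
    by (simp add: restrict_keys_diff)
  then have "mp_const (inverse (c k)) * (mp_const (c k) * mp_var i ^ k) =
      (\<Sum>j\<in>UNIV. mp_const (inverse (c k)) * restrict_keys (\<lambda>\<alpha>. total_degree \<alpha> + e = k) (b j) * P j)"
    by (simp add: sum_distrib_left mult.assoc)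
  moreover have "mp_const (inverse (c k)) * mp_const (c k) = (1 :: 'n mpoly)"
    using k(2) by (simp add: mp_const_def mult_single)
  ultimately have "mp_var i ^ k = (\<Sum>j\<in>UNIV. mp_const (inverse (c k)) * restrict_keys (\<lambda>\<alpha>. total_degree \<alpha> + e = k) (b j) * P j)"
    by (simp add: mult.assoc[symmetric])
  then show ?thesis
    by (intro exI[of _ "\<lambda>j. mp_const (inverse (c k)) * restrict_keys (\<lambda>\<alpha>. total_degree \<alpha> + e = k) (b j)"])
qed

text \<open>The dependence among the powers of one coordinate in the Milnor algebra of
  \<open>p\<close> yields a power of that variable in the ideal of polynomials generated by the
  derivatives.\<close>

lemma isolated_homogeneous_powers:
  fixes p :: "'n::finite mpoly"
  assumes p: "homog (Suc e) p" and iso: "algebraically_isolated (mpeval p)"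
  obtains N q where "\<And>i. mp_var i ^ N = (\<Sum>j\<in>UNIV. q i j * mp_deriv j p)"
proof -
  have "\<forall>i. \<exists>k q. mp_var i ^ k = (\<Sum>j\<in>UNIV. q j * mp_deriv j p)"
  proof
    fix i
    have s: "smooth_germ (\<lambda>x :: real^'n. x $ i ^ k)" for k
      using smooth_germ_mpeval[of "mp_var i ^ k"] by (simp add: mpeval_power[abs_def])
    obtain c d k where "(\<lambda>x. \<Sum>k<Suc d. c k * x $ i ^ k) \<in> jac (mpeval p)" "k < Suc d" "c k \<noteq> 0"
      by (rule algebraically_isolated_relation[OF smooth_germ_mpeval iso, of "\<lambda>k x. x $ i ^ k", OF s])
    with mp_var_power_relation[where P="\<lambda>j. mp_deriv j p", OF homog_mp_deriv[OF p]]
    show "\<exists>k q. mp_var i ^ k = (\<Sum>j\<in>UNIV. q j * mp_deriv j p)"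
      unfolding partial_deriv_mpeval by blast
  qed
  from choice[OF this] obtain k where "\<forall>i. \<exists>q. mp_var i ^ k i = (\<Sum>j\<in>UNIV. q j * mp_deriv j p)" ..
  from choice[OF this] obtain q where q: "\<And>i. mp_var i ^ k i = (\<Sum>j\<in>UNIV. q i j * mp_deriv j p)" by blast
  \<comment> \<open>A common exponent for all variables, as required by the monomial ideals.\<close>
  define N where "N = Max (range k)"
  have "mp_var i ^ N = (\<Sum>j\<in>UNIV. (mp_var i ^ (N - k i) * q i j) * mp_deriv j p)" for i
  proof -
    have "k i \<le> N" unfolding N_def by simp
    then have "mp_var i ^ N = mp_var i ^ (N - k i) * mp_var i ^ k i" by (simp add: power_add[symmetric])
    then show ?thesis by (simp add: q sum_distrib_left mult.assoc)
  qed
  then show ?thesis by (rule that)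
qed

text \<open>Degree zero chains are polynomials of degree below \<open>s\<close>. They represent all
  classes because \<open>vorder s\<close> lies in the Jacobian ideal, and those representing zero
  form the image of the last truncated differential.\<close>

lemma milnor_number_eq_dim:
  fixes f :: "real^'n::finite \<Rightarrow> real"
  assumes f: "smooth_germ f" and \<nu>: "bij_betw \<nu> {..<n} (UNIV :: 'n set)"
    and T: "\<And>j. j < n \<Longrightarrow> (\<lambda>x. partial_deriv (\<nu> j) f x - mpeval (T j) x) \<in> vorder s"
    and T_ord: "\<And>j. j < n \<Longrightarrow> T j \<in> ord_ge e"
    and s: "vorder s \<subseteq> jac f" and proper: "(\<lambda>x. 1) \<notin> jac f"
  shows "milnor_number f =
    enat (kc.dim (tchain n e s 0 :: (nat set \<Rightarrow> 'n mpoly) set) - kc.dim (tdiff n e s T ` tchain n e s (Suc 0)))"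
proof -
  let ?V = "tchain n e s 0 :: (nat set \<Rightarrow> 'n mpoly) set" and ?W = "tdiff n e s T ` tchain n e s (Suc 0)"
  let ?R = "milnor_algebra f"
  have reindex: "(\<Sum>i\<in>UNIV. w i) = (\<Sum>j<n. w (\<nu> j))" for w :: "'n \<Rightarrow> 'b::comm_monoid_add"
    by (rule sum.reindex_bij_betw[OF \<nu>, symmetric])
  \<comment> \<open>The terms cut off lie in \<open>vorder s\<close>, hence in the Jacobian
    ideal.\<close>
  have trunc_jac: "mpeval (trunc s p) \<in> jac f \<longleftrightarrow> mpeval p \<in> jac f" for p
  proof -
    have "mpeval (p - trunc s p) \<in> jac f" using s vorder_mpeval[OF diff_trunc_ord_ge] by blast
    then have d: "(\<lambda>x. mpeval p x - mpeval (trunc s p) x) \<in> jac f" by (simp add: mpeval_diff[abs_def])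
    show ?thesis
      using germ_span_add[OF d, of "mpeval (trunc s p)"] germ_span_diff[OF _ d, of "mpeval p"] by auto
  qed
  have approx: "(\<lambda>x. partial_deriv (\<nu> j) f x * mpeval p x - mpeval (T j * p) x) \<in> vorder s" if "j < n" for j p
    using vorder_mult[OF T[OF that], of "mpeval p" 0]
    by (simp add: smooth_germ_mpeval mpeval_mult left_diff_distrib)
  have Vdeg: "trunc s (a {}) = a {}" if "a \<in> ?V" for a
    using that by (simp add: tchain_def)
  have kd: "kdiff n T b {} = (\<Sum>j<n. T j * b {j})" for b
    by (simp add: kdiff_def ksgn_def)
  \<comment> \<open>Both directions replace smooth data by polynomials modulo
    \<open>vorder s\<close>: the partial derivatives by \<open>T\<close>, and, in the converse, the
    smooth coefficients by Taylor polynomials.\<close>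
  have W_iff: "a \<in> ?W \<longleftrightarrow> mpeval (a {}) \<in> jac f" if a: "a \<in> ?V" for a
  proof
    assume "a \<in> ?W"
    then obtain b where b: "b \<in> tchain n e s (Suc 0)" "a = tdiff n e s T b" by auto
    have "(\<lambda>x. (\<Sum>j<n. mpeval (b {j}) x * partial_deriv (\<nu> j) f x) -
        (\<Sum>j<n. partial_deriv (\<nu> j) f x * mpeval (b {j}) x - mpeval (T j * b {j}) x)) \<in> jac f"
    proof (rule germ_span_diff)
      show "(\<lambda>x. \<Sum>j<n. mpeval (b {j}) x * partial_deriv (\<nu> j) f x) \<in> jac f"
        by (intro germ_span_sum germ_span_mult smooth_germ_mpeval
            germ_span_base[where v="\<lambda>i. partial_deriv i f"] smooth_germ_partial_deriv f) auto
      show "(\<lambda>x. \<Sum>j<n. partial_deriv (\<nu> j) f x * mpeval (b {j}) x - mpeval (T j * b {j}) x) \<in> jac f"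
        by (intro subsetD[OF s] vorder_sum approx) simp
    qed
    then have "mpeval (kdiff n T b {}) \<in> jac f"
      by (simp add: kd mpeval_sum[abs_def] sum_subtractf mult.commute)
    then show "mpeval (a {}) \<in> jac f" by (simp add: b(2) tdiff_def trunc_jac)
  next
    assume "mpeval (a {}) \<in> jac f"
    then obtain c where c: "\<And>i. smooth_germ (c i)"
      "\<forall>\<^sub>F x in nhds 0. mpeval (a {}) x = (\<Sum>i\<in>UNIV. c i x * partial_deriv i f x)"
      by (rule germ_spanE) (rule that)
    have "\<forall>i. \<exists>b. (\<lambda>x. c i x - mpeval b x) \<in> vorder s"
      using smooth_germ_taylor[OF c(1)] by blast
    from choice[OF this] obtain b where b: "\<And>i. (\<lambda>x. c i x - mpeval (b i) x) \<in> vorder s" by blast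
    have 1: "(\<lambda>x. (c i x - mpeval (b i) x) * partial_deriv i f x) \<in> vorder s" for i
      using vorder_mult[OF b, of "partial_deriv i f" 0 i] by (simp add: smooth_germ_partial_deriv f)
    have "(\<lambda>x. \<Sum>j<n. (c (\<nu> j) x - mpeval (b (\<nu> j)) x) * partial_deriv (\<nu> j) f x +
        (partial_deriv (\<nu> j) f x * mpeval (b (\<nu> j)) x - mpeval (T j * b (\<nu> j)) x)) \<in> vorder s"
      by (intro vorder_sum vorder_add 1 approx) simp
    then have "mpeval (a {} - (\<Sum>j<n. T j * b (\<nu> j))) \<in> vorder s"
    proof (rule vorder_cong)
      from c(2) show "\<forall>\<^sub>F x in nhds 0. (\<Sum>j<n. (c (\<nu> j) x - mpeval (b (\<nu> j)) x) * partial_deriv (\<nu> j) f x +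
          (partial_deriv (\<nu> j) f x * mpeval (b (\<nu> j)) x - mpeval (T j * b (\<nu> j)) x)) =
          mpeval (a {} - (\<Sum>j<n. T j * b (\<nu> j))) x"
        by eventually_elim
           (simp add: reindex mpeval_diff mpeval_sum sum_subtractf[symmetric],
            rule sum.cong, simp_all add: algebra_simps)
    qed
    then have 2: "a {} - (\<Sum>j<n. T j * b (\<nu> j)) \<in> ord_ge s" by (simp add: mpeval_vorder_iff)
    \<comment> \<open>The coefficients become a chain supported on singletons. Cutting them at
      degree \<open>s - e\<close> is harmless, because \<open>T j\<close> has order at least
      \<open>e\<close> and the discarded products have order at least \<open>s\<close>.\<close>
    define b' where "b' S = (if \<exists>j<n. S = {j} then trunc (s - e) (b (\<nu> (the_elem S))) else 0)" for S
    have b'_tchain: "b' \<in> tchain n e s (Suc 0)"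
      by (auto simp: tchain_def kchain_def b'_def keys_restrict_keys intro!: restrict_keys_id)
    have "tdiff n e s T b' S = a S" for S
    proof (cases "S = {}")
      case True
      have "(\<Sum>j<n. T j * (b (\<nu> j) - trunc (s - e) (b (\<nu> j)))) \<in> ord_ge (e + (s - e))"
        by (intro ord_ge_sum ord_ge_mult T_ord diff_trunc_ord_ge) simp
      then have "(\<Sum>j<n. T j * (b (\<nu> j) - trunc (s - e) (b (\<nu> j)))) \<in> ord_ge s"
        by (rule ord_ge_mono) simp
      from ord_ge_add[OF 2 this] have "a {} - (\<Sum>j<n. T j * trunc (s - e) (b (\<nu> j))) \<in> ord_ge s"
        by (simp add: right_diff_distrib sum_subtractf)
      moreover have "(\<Sum>j<n. T j * trunc (s - e) (b (\<nu> j))) = kdiff n T b' {}"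
        unfolding kd by (rule sum.cong) (auto simp: b'_def)
      ultimately have "trunc s (a {}) = trunc s (kdiff n T b' {})" by (simp add: trunc_eq_iff)
      then show ?thesis using True Vdeg[OF a] by (simp add: tdiff_def)
    next
      case False
      have z: "x S = 0" if "x \<in> ?V" for x
        using that False kchainD[of x n 0 S] finite_subset[of S "{..<n}"] by (auto simp: tchain_def)
      show ?thesis using z[OF a] z[OF tdiff_tchain[OF b'_tchain, of T]] by simp
    qed
    then show "a \<in> ?W" by (intro image_eqI[OF _ b'_tchain]) auto
  qed
  obtain B :: "(nat set \<Rightarrow> 'n mpoly) set" where B: "finite B" "?V \<subseteq> kc.span B"
    by (rule tchain_subset_span)
  have W: "kc.subspace ?W"
  proof -
    interpret d: Vector_Spaces.linear kscale kscale "tdiff n e s T" by (rule linear_tdiff)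
    show ?thesis by (rule d.subspace_image[OF subspace_tchain])
  qed
  have WV: "?W \<subseteq> ?V" using tdiff_tchain by blast
  obtain S where S: "finite S" "S \<subseteq> ?V" "kc.independent S" "\<And>x. x \<in> kc.span S \<Longrightarrow> x \<in> ?W \<Longrightarrow> x = 0"
    "\<And>v. v \<in> ?V \<Longrightarrow> \<exists>w\<in>?W. v - w \<in> kc.span S" "card S + kc.dim ?W = kc.dim ?V"
    by (rule kc.complement_basis[OF W subspace_tchain WV B]) blast
  interpret R: cring ?R by (rule cring_milnor_algebra[OF f])
  define \<phi> where "\<phi> a = milnor_class f (mpeval (a {}))" for a :: "nat set \<Rightarrow> 'n mpoly"
  define \<kappa> where "\<kappa> c = milnor_class f (\<lambda>x. c)" for c
  have spanV: "kc.span S \<subseteq> ?V" by (rule kc.span_minimal[OF S(2) subspace_tchain])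
  have \<phi>_add: "\<phi> (a + b) = \<phi> a \<oplus>\<^bsub>?R\<^esub> \<phi> b" for a b
    by (simp add: \<phi>_def milnor_class_add[OF f, symmetric] smooth_germ_mpeval mpeval_add[abs_def])
  have \<phi>_eq: "\<phi> a = \<phi> b \<longleftrightarrow> mpeval ((a - b) {}) \<in> jac f" for a b
    by (simp add: \<phi>_def milnor_class_eq_iff[OF f] smooth_germ_mpeval mpeval_diff[abs_def])
  have "inj_on \<phi> (kc.span S)"
  proof (rule inj_onI)
    fix a b assume ab: "a \<in> kc.span S" "b \<in> kc.span S" "\<phi> a = \<phi> b"
    then have d: "a - b \<in> kc.span S" by (intro kc.span_diff)
    then have "a - b \<in> ?W" using W_iff[of "a - b"] spanV ab(3) unfolding \<phi>_eq by blast
    from S(4)[OF d this] show "a = b" by simp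
  qed
  then have "R.dimension (card S) (range \<kappa>) (\<phi> ` kc.span S)"
    by (intro R.dimension_image_span[OF kc.vector_space_axioms] S \<phi>_add)
       (auto simp: \<phi>_def \<kappa>_def milnor_class_closed[OF f] smooth_germ_mpeval mpeval_mult[abs_def]
         milnor_class_mult[OF f] smooth_germ_const)
  moreover have "range \<kappa> = milnor_scalars f" by (simp add: milnor_scalars_eq[OF f] \<kappa>_def)
  moreover have "\<phi> ` kc.span S = carrier ?R"
  proof (intro equalityI subsetI)
    fix y assume "y \<in> carrier ?R"
    then obtain h where h: "smooth_germ h" "y = milnor_class f h" by (auto simp: carrier_milnor_algebra[OF f])
    obtain p where p: "(\<lambda>x. h x - mpeval p x) \<in> vorder s" using smooth_germ_taylor[OF h(1)] by blast
    define a where "a S = (if S = {} then trunc s p else 0)" for S :: "nat set"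
    have a: "a \<in> ?V" by (auto simp: tchain_def kchain_def a_def keys_restrict_keys intro!: restrict_keys_id)
    \<comment> \<open>Subtracting an element of the image does not change the class and moves the
      representative into the chosen complement.\<close>
    from S(5)[OF this] obtain w where w: "w \<in> ?W" "a - w \<in> kc.span S" by blast
    have "mpeval (w {}) \<in> jac f" using W_iff w(1) WV by blast
    then have "\<phi> a = \<phi> (a - w)" unfolding \<phi>_eq by simp
    moreover have "y = \<phi> a"
    proof -
      have "(\<lambda>x. (h x - mpeval p x) + mpeval (p - trunc s p) x) \<in> jac f"
        by (intro subsetD[OF s] vorder_add p vorder_mpeval diff_trunc_ord_ge)
      then show ?thesis
        by (simp add: h(2) \<phi>_def a_def milnor_class_eq_iff[OF f] h(1) smooth_germ_mpeval mpeval_diff)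
    qed
    ultimately show "y \<in> \<phi> ` kc.span S" using w(2) by blast
  qed (auto simp: \<phi>_def milnor_class_closed[OF f] smooth_germ_mpeval)
  ultimately have dim: "R.dimension (card S) (milnor_scalars f) (carrier ?R)" by simp
  have "R.dim (milnor_scalars f) (carrier ?R) = card S"
    using R.dimI[OF subfield_milnor_scalars[OF f proper] dim] by (simp add: over_def)
  moreover have "R.finite_dimension (milnor_scalars f) (carrier ?R)"
    using dim by (rule R.finite_dimensionI)
  ultimately show ?thesis using S(6) by (simp add: milnor_number_def)
qed

text \<open>As \<open>\<phi>\<close> fixes 0, the Lipschitz inequalities against 0 make the norms of
  \<open>x\<close> and \<open>\<phi> x\<close> comparable, so power bounds transfer both ways with
  changed constants.\<close>

lemma R_asymp_lipschitz_equiv_bounds: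
  fixes f g :: "real^'n::finite \<Rightarrow> real"
  assumes "R_asymp_lipschitz_equiv f g"
  shows "\<forall>\<^sub>F x in nhds 0. \<bar>g x\<bar> \<le> C * norm x ^ m \<Longrightarrow> \<exists>C'. \<forall>\<^sub>F x in nhds 0. \<bar>f x\<bar> \<le> C' * norm x ^ m"
    and "\<forall>\<^sub>F x in nhds 0. \<bar>f x\<bar> \<le> C * norm x ^ m \<Longrightarrow> \<exists>C'. \<forall>\<^sub>F x in nhds 0. \<bar>g x\<bar> \<le> C' * norm x ^ m"
proof -
  from assms obtain \<phi> U V W c\<^sub>1 c\<^sub>2 where UV: "open U" "0 \<in> U" "open V" "0 \<in> V" "lipeomorphism U V \<phi>" "\<phi> 0 = 0"
    and W: "0 \<in> interior W" "W \<subseteq> U" and c: "c\<^sub>1 > 0" "c\<^sub>2 > 0"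
    and fg: "\<And>x. x \<in> W \<Longrightarrow> c\<^sub>2 * \<bar>f x\<bar> \<le> \<bar>g (\<phi> x)\<bar>" "\<And>x. x \<in> W \<Longrightarrow> \<bar>g (\<phi> x)\<bar> \<le> c\<^sub>1 * \<bar>f x\<bar>"
    unfolding R_asymp_lipschitz_equiv_def by blast
  from UV(5) obtain L where L: "L > 0" and bij: "bij_betw \<phi> U V"
    and lip: "\<And>x y. x \<in> U \<Longrightarrow> y \<in> U \<Longrightarrow> 1 / L * norm (x - y) \<le> norm (\<phi> x - \<phi> y) \<and> norm (\<phi> x - \<phi> y) \<le> L * norm (x - y)"
    unfolding lipeomorphism_def by blast
  have up: "norm (\<phi> x) \<le> L * norm x" and low: "norm x \<le> L * norm (\<phi> x)" if "x \<in> U" for x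
    using lip[OF that UV(2)] UV(6) L by (simp_all add: field_simps)
  obtain r where r: "r > 0" "\<And>x. norm x < r \<Longrightarrow> x \<in> W"
    using W(1) by (auto simp: mem_interior subset_eq)
  {
    assume "\<forall>\<^sub>F x in nhds 0. \<bar>g x\<bar> \<le> C * norm x ^ m"
    then obtain d where d: "d > 0" "\<And>y. norm y < d \<Longrightarrow> \<bar>g y\<bar> \<le> C * norm y ^ m"
      by (auto simp: eventually_nhds_metric)
    \<comment> \<open>The radius \<open>r\<close> keeps \<open>x\<close> in \<open>W\<close>, and
      \<open>d / L\<close> keeps \<open>\<phi> x\<close> where the bound on \<open>g\<close>
      holds.\<close>
    have "\<bar>f x\<bar> \<le> (\<bar>C\<bar> * L ^ m / c\<^sub>2) * norm x ^ m" if x: "norm x < min r (d / L)" for x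
    proof -
      have xW: "x \<in> W" using r(2) x by simp
      then have xU: "x \<in> U" using W(2) by blast
      have "L * norm x < d" using x L by (simp add: field_simps)
      then have "\<bar>g (\<phi> x)\<bar> \<le> C * norm (\<phi> x) ^ m" using up[OF xU] by (intro d(2)) simp
      also have "\<dots> \<le> \<bar>C\<bar> * (L * norm x) ^ m"
        using up[OF xU] L by (intro mult_mono power_mono) auto
      finally have "c\<^sub>2 * \<bar>f x\<bar> \<le> \<bar>C\<bar> * L ^ m * norm x ^ m"
        using fg(1)[OF xW] by (simp add: power_mult_distrib)
      then show ?thesis using c(2) by (simp add: field_simps)
    qed
    moreover have "min r (d / L) > 0" using r(1) d(1) L by simp
    ultimately have "\<forall>\<^sub>F x in nhds 0. \<bar>f x\<bar> \<le> (\<bar>C\<bar> * L ^ m / c\<^sub>2) * norm x ^ m"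
      unfolding eventually_nhds_metric by (intro exI[of _ "min r (d / L)"]) simp
    then show "\<exists>C'. \<forall>\<^sub>F x in nhds 0. \<bar>f x\<bar> \<le> C' * norm x ^ m" ..
  next
    assume "\<forall>\<^sub>F x in nhds 0. \<bar>f x\<bar> \<le> C * norm x ^ m"
    then obtain d where d: "d > 0" "\<And>y. norm y < d \<Longrightarrow> \<bar>f y\<bar> \<le> C * norm y ^ m"
      by (auto simp: eventually_nhds_metric)
    \<comment> \<open>Now \<open>y\<close> varies in the target. Surjectivity onto the open set
      \<open>V\<close> provides a preimage, and the lower Lipschitz bound makes it small enough to
      lie in \<open>W\<close> and within \<open>d\<close>.\<close>
    have "\<forall>\<^sub>F y in nhds 0. norm y < min r d / L"
      using r(1) d(1) L unfolding eventually_nhds_metric by (intro exI[of _ "min r d / L"]) simp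
    moreover have "\<forall>\<^sub>F y in nhds 0. y \<in> V" using UV(3,4) by (rule eventually_nhds_in_open)
    ultimately have "\<forall>\<^sub>F y in nhds 0. \<bar>g y\<bar> \<le> (c\<^sub>1 * \<bar>C\<bar> * L ^ m) * norm y ^ m"
    proof eventually_elim
      case (elim y)
      then obtain x where x: "x \<in> U" "y = \<phi> x" using bij by (auto simp: bij_betw_def)
      have "L * norm y < min r d" using elim(1) L by (simp add: pos_less_divide_eq mult.commute)
      then have xs: "norm x < min r d" using low[OF x(1)] x(2) by simp
      then have "\<bar>f x\<bar> \<le> C * norm x ^ m" by (intro d(2)) simp
      also have "\<dots> \<le> \<bar>C\<bar> * (L * norm y) ^ m"
        using low[OF x(1)] L x(2) by (intro mult_mono power_mono) auto
      finally have "c\<^sub>1 * \<bar>f x\<bar> \<le> c\<^sub>1 * (\<bar>C\<bar> * (L * norm y) ^ m)" using c(1) by simp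
      moreover have "\<bar>g y\<bar> \<le> c\<^sub>1 * \<bar>f x\<bar>" unfolding x(2) using xs by (intro fg(2) r(2)) simp
      ultimately show ?case by (simp add: power_mult_distrib mult_ac)
    qed
    then show "\<exists>C'. \<forall>\<^sub>F x in nhds 0. \<bar>g x\<bar> \<le> C' * norm x ^ m" ..
  }
qed

lemma homogeneous_approx_bound:
  assumes "homog k P" "(\<lambda>x. f x - mpeval P x) \<in> vorder (Suc k)"
  obtains C where "\<forall>\<^sub>F x in nhds 0. \<bar>f x\<bar> \<le> C * norm x ^ k"
proof -
  have "(\<lambda>x. (f x - mpeval P x) + mpeval P x) \<in> vorder k"
    by (intro vorder_add vorder_Suc[OF assms(2)] vorder_mpeval homog_ord_ge assms(1))
  then have "f \<in> vorder k" by simp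
  then show ?thesis by (rule vorder_bound) (rule that)
qed

section \<open>Germs with an algebraically isolated initial form of degree
  \<open>Suc e\<close>\<close>

locale isolated_initial_form =
  fixes f :: "real^'n::finite \<Rightarrow> real" and e :: nat and P :: "'n mpoly"
  assumes f: "smooth_germ f" and P: "homog (Suc e) P" "P \<noteq> 0"
    and init: "(\<lambda>x. f x - mpeval P x) \<in> vorder (Suc (Suc e))"
    and iso: "algebraically_isolated (mpeval P)"
begin

lemma partial_deriv_init: "(\<lambda>x. partial_deriv i f x - mpeval (mp_deriv i P) x) \<in> vorder (Suc e)"
proof -
  have "\<forall>\<^sub>F x in nhds 0. partial_deriv i (\<lambda>x. (f x - mpeval P x) + mpeval P x) x =
      partial_deriv i (\<lambda>x. f x - mpeval P x) x + partial_deriv i (mpeval P) x"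
    using smooth_germ_eventually_differentiable[OF vorder_smooth[OF init]]
      smooth_germ_eventually_differentiable[OF smooth_germ_mpeval[of P]]
    by eventually_elim (rule partial_deriv_add)
  then have "\<forall>\<^sub>F x in nhds 0. partial_deriv i (\<lambda>x. f x - mpeval P x) x = partial_deriv i f x - mpeval (mp_deriv i P) x"
    by eventually_elim (simp add: partial_deriv_mpeval)
  with vorder_partial_deriv[OF init] show ?thesis by (rule vorder_cong)
qed

text \<open>A nonzero linear initial form has a nonzero derivative, by Euler's relation. The
  corresponding partial derivative of \<open>f\<close> does not vanish at 0, so it is a
  unit.\<close>

lemma jac_nonsingular: "e = 0 \<Longrightarrow> jac f = Collect smooth_germ"
proof -
  assume e: "e = 0"
  have "\<exists>i. mp_deriv i P \<noteq> 0"
  proof (rule ccontr)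
    assume "\<not> (\<exists>i. mp_deriv i P \<noteq> 0)"
    then have "mp_const (real (Suc e)) * P = 0" using euler_homog[OF P(1)] by simp
    then have "real (Suc e) * lookup P \<alpha> = 0" for \<alpha> by (metis lookup_mp_const_mult lookup_zero)
    then have "P = 0" by (intro poly_mapping_eqI) simp
    with P(2) show False ..
  qed
  then obtain i where i: "mp_deriv i P \<noteq> 0" ..
  have hom: "homog 0 (mp_deriv i P)" using homog_mp_deriv[OF P(1)] e by simp
  have "lookup (mp_deriv i P) \<alpha> = 0" if "\<alpha> \<noteq> 0" for \<alpha>
  proof (rule ccontr)
    assume "lookup (mp_deriv i P) \<alpha> \<noteq> 0"
    then have "\<alpha> \<in> keys (mp_deriv i P)" by (simp add: in_keys_iff)
    with hom have "total_degree \<alpha> = 0" by (simp add: homog_def)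
    with that show False by (simp add: total_degree_eq_0_iff)
  qed
  with i have "lookup (mp_deriv i P) 0 \<noteq> 0" by (metis poly_mapping_eqI lookup_zero)
  moreover have "partial_deriv i f 0 = mpeval (mp_deriv i P) 0"
    using vorder_Suc_at_0[OF partial_deriv_init[of i]] by simp
  ultimately have nz: "partial_deriv i f 0 \<noteq> 0" by (simp add: mpeval_0)
  have s: "smooth_germ (partial_deriv i f)" by (rule smooth_germ_partial_deriv[OF f])
  have "partial_deriv i f \<in> jac f"
    by (rule germ_span_base[where v="\<lambda>i. partial_deriv i f"]) (simp_all add: s)
  from germ_span_mult[OF smooth_germ_inverse[OF s nz] this]
  have one: "(\<lambda>x. 1) \<in> jac f"
  proof (rule germ_span_cong)
    have "isCont (partial_deriv i f) 0"
      using smooth_germ_eventually_differentiable[OF s]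
      by (auto dest!: eventually_nhds_x_imp_x intro: differentiable_imp_continuous_within)
    then have "(partial_deriv i f \<longlongrightarrow> partial_deriv i f 0) (nhds 0)"
      by (simp add: isCont_def tendsto_nhds_iff)
    then have "\<forall>\<^sub>F x in nhds 0. partial_deriv i f x \<noteq> 0" using nz by (rule tendsto_imp_eventually_ne)
    then show "\<forall>\<^sub>F x in nhds 0. inverse (partial_deriv i f x) * partial_deriv i f x = 1"
      by eventually_elim simp
  qed
  have "h \<in> jac f" if "smooth_germ h" for h
    using germ_span_mult[OF that one] by simp
  then show ?thesis using germ_span_smooth by blast
qed

text \<open>The derivatives of the initial form have positive degree \<open>e\<close>, so all
  generators vanish at the origin.\<close>

lemma jac_proper:
  assumes "0 < e" shows "(\<lambda>x. 1) \<notin> jac f"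
proof
  assume "(\<lambda>x. 1) \<in> jac f"
  then obtain a where "\<forall>\<^sub>F x in nhds 0. (1::real) = (\<Sum>i\<in>UNIV. a i x * partial_deriv i f x)"
    by (rule germ_spanE) (rule that)
  then have "1 = (\<Sum>i\<in>UNIV. a i 0 * partial_deriv i f 0)" by (rule eventually_nhds_x_imp_x)
  moreover have "partial_deriv i f 0 = 0" for i
  proof -
    have "lookup (mp_deriv i P) 0 = 0"
      using homog_mp_deriv[OF P(1), of i] assms by (force simp: homog_def in_keys_iff)
    then show ?thesis using vorder_Suc_at_0[OF partial_deriv_init[of i]] by (simp add: mpeval_0)
  qed
  ultimately show False by simp
qed

text \<open>Stated for all large \<open>s\<close>, so that two germs can be truncated at the same
  level and this level can exceed \<open>e\<close>.\<close>

lemma vorder_subset_jac: "\<exists>s0. \<forall>s\<ge>s0. vorder s \<subseteq> jac f"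
proof -
  obtain N q where "\<And>i. mp_var i ^ N = (\<Sum>j\<in>UNIV. q i j * mp_deriv j P)"
    by (rule isolated_homogeneous_powers[OF P(1) iso]) (rule that)
  from vorder_subset_germ_span[OF homog_mp_deriv[OF P(1)] smooth_germ_partial_deriv[OF f] partial_deriv_init this]
  show ?thesis by (intro exI[of _ "Suc (CARD('n) * N)"]) auto
qed

text \<open>The condition \<open>Suc e \<le> s\<close> ensures that Taylor polynomials modulo order
  \<open>s\<close> still show the initial forms of the partial derivatives.\<close>

lemma koszul_data:
  assumes \<nu>: "bij_betw \<nu> {..<n} (UNIV :: 'n set)" and s: "Suc e \<le> s"
  obtains N q T where "koszul_initial_forms n e N \<nu> (\<lambda>j. mp_deriv (\<nu> j) P) T q"
    "\<And>j. (\<lambda>x. partial_deriv (\<nu> j) f x - mpeval (T j) x) \<in> vorder s"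
proof -
  obtain N q where q: "\<And>i. mp_var i ^ N = (\<Sum>j\<in>UNIV. q i j * mp_deriv j P)"
    by (rule isolated_homogeneous_powers[OF P(1) iso]) (rule that)
  have "\<forall>j. \<exists>t. (\<lambda>x. partial_deriv (\<nu> j) f x - mpeval t x) \<in> vorder s"
    using smooth_germ_taylor[OF smooth_germ_partial_deriv[OF f]] by blast
  from choice[OF this] obtain T where T: "\<And>j. (\<lambda>x. partial_deriv (\<nu> j) f x - mpeval (T j) x) \<in> vorder s"
    by blast
  have "koszul_initial_forms n e N \<nu> (\<lambda>j. mp_deriv (\<nu> j) P) T (\<lambda>k j. q (\<nu> k) (\<nu> j))"
  proof
    show "inj_on \<nu> {..<n}" using \<nu> by (simp add: bij_betw_def)
    show "mp_var (\<nu> k) ^ N = (\<Sum>j<n. q (\<nu> k) (\<nu> j) * mp_deriv (\<nu> j) P)" for k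
      unfolding q[of "\<nu> k"] by (rule sum.reindex_bij_betw[OF \<nu>, symmetric])
    show "homog e (mp_deriv (\<nu> j) P)" for j by (rule homog_mp_deriv[OF P(1)])
    show "T j - mp_deriv (\<nu> j) P \<in> ord_ge (Suc e)" for j
    proof -
      from vorder_diff[OF partial_deriv_init[of "\<nu> j"] vorder_mono[OF T[of j] s]]
      have "mpeval (T j - mp_deriv (\<nu> j) P) \<in> vorder (Suc e)" by (simp add: mpeval_diff[abs_def])
      then show ?thesis by (simp add: mpeval_vorder_iff)
    qed
  qed
  then show ?thesis by (rule that) (rule T)
qed

end

lemma milnor_number_unique:
  fixes f g :: "real^'n::finite \<Rightarrow> real"
  assumes F: "isolated_initial_form f e P" and G: "isolated_initial_form g e Q"
  shows "milnor_number f = milnor_number g"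
proof (cases "e = 0")
  case True
  have smooth: "smooth_germ f" "smooth_germ g"
    using F G by (auto simp: isolated_initial_form_def)
  \<comment> \<open>Both ideals are the whole ring, so the two Milnor algebras and their scalars
    coincide literally.\<close>
  have "jacobian_ideal f = jacobian_ideal g"
    using isolated_initial_form.jac_nonsingular[OF F True] isolated_initial_form.jac_nonsingular[OF G True]
    by (simp add: jacobian_ideal_eq smooth)
  then show ?thesis by (simp add: milnor_number_def milnor_algebra_def milnor_scalars_def)
next
  case False
  obtain \<nu> where \<nu>: "bij_betw \<nu> {..<CARD('n)} (UNIV :: 'n set)"
    using ex_bij_betw_nat_finite[of "UNIV :: 'n set"] by (auto simp: atLeast0LessThan)
  obtain s1 s2 where "\<forall>s\<ge>s1. vorder s \<subseteq> jac f" "\<forall>s\<ge>s2. vorder s \<subseteq> jac g"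
    using isolated_initial_form.vorder_subset_jac[OF F] isolated_initial_form.vorder_subset_jac[OF G] by blast
  then obtain s where s: "vorder s \<subseteq> jac f" "vorder s \<subseteq> jac g" "Suc e \<le> s"
    by (meson le_max_iff_disj order_refl max.cobounded1 max.cobounded2)
  obtain N q T where T: "koszul_initial_forms CARD('n) e N \<nu> (\<lambda>j. mp_deriv (\<nu> j) P) T q"
    "\<And>j. (\<lambda>x. partial_deriv (\<nu> j) f x - mpeval (T j) x) \<in> vorder s"
    by (rule isolated_initial_form.koszul_data[OF F \<nu> s(3)]) (rule that)
  obtain N' q' T' where T': "koszul_initial_forms CARD('n) e N' \<nu> (\<lambda>j. mp_deriv (\<nu> j) Q) T' q'"
    "\<And>j. (\<lambda>x. partial_deriv (\<nu> j) g x - mpeval (T' j) x) \<in> vorder s"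
    by (rule isolated_initial_form.koszul_data[OF G \<nu> s(3)]) (rule that)
  have "milnor_number f = enat (kc.dim (tchain CARD('n) e s 0 :: (nat set \<Rightarrow> 'n mpoly) set) -
      kc.dim (tdiff CARD('n) e s T ` tchain CARD('n) e s (Suc 0)))"
    using F False
    by (intro milnor_number_eq_dim[OF _ \<nu> T(2) koszul_initial_forms.F_ord_ge[OF T(1)] s(1)]
        isolated_initial_form.jac_proper[OF F]) (auto simp: isolated_initial_form_def)
  moreover have "milnor_number g = enat (kc.dim (tchain CARD('n) e s 0 :: (nat set \<Rightarrow> 'n mpoly) set) -
      kc.dim (tdiff CARD('n) e s T' ` tchain CARD('n) e s (Suc 0)))"
    using G False
    by (intro milnor_number_eq_dim[OF _ \<nu> T'(2) koszul_initial_forms.F_ord_ge[OF T'(1)] s(2)]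
        isolated_initial_form.jac_proper[OF G]) (auto simp: isolated_initial_form_def)
  \<comment> \<open>With the same \<open>s\<close>, \<open>e\<close> and number of variables only
    the rank of the last differential could differ, and it does not.\<close>
  ultimately show ?thesis using dim_tdiff_image_unique[OF T(1) T'(1), of 0 s] by simp
qed

theorem theorem4p3:
  fixes f g :: "real^'n::finite \<Rightarrow> real"
  assumes "smooth_germ f" and "smooth_germ g"
    and "f 0 = 0" and "g 0 = 0"
    and "has_initial_part f" and "has_initial_part g"
    and "algebraically_isolated (initial_part f)"
    and "algebraically_isolated (initial_part g)"
    and "R_asymp_lipschitz_equiv f g"
  shows "milnor_number f = milnor_number g"
proof -
  obtain k P where P: "homog k P" "P \<noteq> 0" "initial_part f = mpeval P"
    "(\<lambda>x. f x - mpeval P x) \<in> vorder (Suc k)"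
    by (rule initial_part_expansion[OF assms(1,5)]) (rule that)
  obtain m Q where Q: "homog m Q" "Q \<noteq> 0" "initial_part g = mpeval Q"
    "(\<lambda>x. g x - mpeval Q x) \<in> vorder (Suc m)"
    by (rule initial_part_expansion[OF assms(2,6)]) (rule that)
  obtain C where "\<forall>\<^sub>F x in nhds 0. \<bar>g x\<bar> \<le> C * norm x ^ m"
    by (rule homogeneous_approx_bound[OF Q(1,4)]) (rule that)
  \<comment> \<open>The growth bound of \<open>g\<close> passes to \<open>f\<close>, whose leading
    form has degree \<open>k\<close>.\<close>
  then have "m \<le> k"
    using R_asymp_lipschitz_equiv_bounds(1)[OF assms(9)] order_le_of_bound[OF P(1,2,4)] by blast
  obtain C where "\<forall>\<^sub>F x in nhds 0. \<bar>f x\<bar> \<le> C * norm x ^ k"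
    by (rule homogeneous_approx_bound[OF P(1,4)]) (rule that)
  then have "k \<le> m"
    using R_asymp_lipschitz_equiv_bounds(2)[OF assms(9)] order_le_of_bound[OF Q(1,2,4)] by blast
  with \<open>m \<le> k\<close> have mk: "m = k" by simp
  \<comment> \<open>The value at 0 is the constant term of the initial form, so
    \<open>f 0 = 0\<close> makes the order positive and \<open>e\<close> can be defined as its
    predecessor.\<close>
  have "k \<noteq> 0"
  proof
    assume k: "k = 0"
    then have "mpeval P 0 = 0" using vorder_Suc_at_0[OF P(4)] assms(3) by simp
    then have "lookup P 0 = 0" by (simp add: mpeval_0)
    then have "P = 0" using P(1) k
      by (intro poly_mapping_eqI) (metis homog_def in_keys_iff lookup_zero total_degree_eq_0_iff)
    with P(2) show False ..
  qed
  then obtain e where e: "k = Suc e" by (cases k) auto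
  have "isolated_initial_form f e P"
    by unfold_locales (use assms P e in auto)
  moreover have "isolated_initial_form g e Q"
    by unfold_locales (use assms Q e mk in auto)
  ultimately show ?thesis by (rule milnor_number_unique)
qed

end
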